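(* Let $k$ be a field of characteristic zero, let $A$ be an associative (not necessarily commutative or unital) $k$-algebra and let $I\subseteq A$ be a two-sided ideal, giving the algebra extension $I\hookrightarrow A\twoheadrightarrow A/I$. Suppose that $I$ and $A$ both have local left units (or that $I$ and $A$ both have local right units). Then for every $n\ge 0$ the excision map $\rho: HC_n(I)\to HC_n(A,I)$ is an isomorphism.
   Context: All tensor products are over $k$. An algebra $R$ has local left units if for every finite subset $S\subseteq R$ there is $e\in R$ with $es=s$ for all $s\in S$ (local right units: $se=s$ for all $s\in S$). For an algebra $R$ put $C_n(R):=R^{\otimes n+1}$ with differential $$b(f_0\otimes\cdots\otimes f_n)=\sum_{i=0}^{n-1}(-1)^i f_0\otimes\cdots\otimes f_if_{i+1}\otimes\cdots\otimes f_n+(-1)^n f_nf_0\otimes f_1\otimes\cdots\otimes f_{n-1}$$ (and $b=0$ on $C_0(R)$). The cyclic operator is $t(f_0\otimes\cdots\otimes f_n)=(-1)^n f_n\otimes f_0\otimes\cdots\otimes f_{n-1}$. Let $CC_n(R):=C_n(R)/\operatorname{im}(1-t)$ be the coinvariants under $t$; $b$ descends to $CC_\bullet(R)$, and $HC_n(R):=H_n(CC_\bullet(R),b)$. For a two-sided ideal $I\subseteq A$ put $CC_n(A,I):=\ker(CC_n(A)\to CC_n(A/I))$ and $HC_n(A,I):=H_n(CC_\bullet(A,I),b)$. The excision map $\rho$ is the map on homology induced by the chain map $CC_\bullet(I)\to CC_\bullet(A,I)$ sending the class of a tensor to the class of the same tensor. *)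

theory Defs
  imports Complex_Main "HOL-Library.Poly_Mapping" "HOL-Algebra.QuotRing" "HOL-Algebra.Module"
begin

section \<open>Associative algebras without unit\<close>

text \<open>
  The ground field is a type \<open>'k\<close>.  Vector spaces and algebras over it are
  \<^type>\<open>module\<close> records; their component \<open>one\<close> carries no meaning, and neither does \<open>mult\<close>
  when the record stands for a mere vector space.
\<close>

definition ground_field :: "'k::field ring" where
  "ground_field = \<lparr>carrier = UNIV, mult = (*), one = 1, zero = 0, add = (+)\<rparr>"

locale assoc_algebra = module "ground_field :: 'k ring" A
  for A :: "('k::field, 'a) module" (structure) +
  assumes mult_closed: "\<lbrakk>x \<in> carrier A; y \<in> carrier A\<rbrakk> \<Longrightarrow> x \<otimes> y \<in> carrier A"
    and mult_assoc: "\<lbrakk>x \<in> carrier A; y \<in> carrier A; z \<in> carrier A\<rbrakk> \<Longrightarrow> (x \<otimes> y) \<otimes> z = x \<otimes> (y \<otimes> z)"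
    and mult_l_distr: "\<lbrakk>x \<in> carrier A; y \<in> carrier A; z \<in> carrier A\<rbrakk> \<Longrightarrow> (x \<oplus> y) \<otimes> z = x \<otimes> z \<oplus> y \<otimes> z"
    and mult_r_distr: "\<lbrakk>x \<in> carrier A; y \<in> carrier A; z \<in> carrier A\<rbrakk> \<Longrightarrow> x \<otimes> (y \<oplus> z) = x \<otimes> y \<oplus> x \<otimes> z"
    and smult_mult_left: "\<lbrakk>x \<in> carrier A; y \<in> carrier A\<rbrakk> \<Longrightarrow> (c \<odot> x) \<otimes> y = c \<odot> (x \<otimes> y)"
    and smult_mult_right: "\<lbrakk>x \<in> carrier A; y \<in> carrier A\<rbrakk> \<Longrightarrow> x \<otimes> (c \<odot> y) = c \<odot> (x \<otimes> y)"

definition two_sided_ideal :: "'a set \<Rightarrow> ('k::field, 'a) module \<Rightarrow> bool" where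
  "two_sided_ideal I A \<longleftrightarrow>
     submodule I (ground_field :: 'k ring) A \<and>
     (\<forall>a\<in>carrier A. \<forall>x\<in>I. a \<otimes>\<^bsub>A\<^esub> x \<in> I \<and> x \<otimes>\<^bsub>A\<^esub> a \<in> I)"

abbreviation subalg :: "('k, 'a) module \<Rightarrow> 'a set \<Rightarrow> ('k, 'a) module" where
  "subalg A I \<equiv> A\<lparr>carrier := I\<rparr>"

definition has_local_left_units :: "('k, 'a) module \<Rightarrow> bool" where
  "has_local_left_units R \<longleftrightarrow>
     (\<forall>S. finite S \<and> S \<subseteq> carrier R \<longrightarrow> (\<exists>e\<in>carrier R. \<forall>s\<in>S. e \<otimes>\<^bsub>R\<^esub> s = s))"

definition has_local_right_units :: "('k, 'a) module \<Rightarrow> bool" where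
  "has_local_right_units R \<longleftrightarrow>
     (\<forall>S. finite S \<and> S \<subseteq> carrier R \<longrightarrow> (\<exists>e\<in>carrier R. \<forall>s\<in>S. s \<otimes>\<^bsub>R\<^esub> e = s))"


section \<open>Quotients of vector spaces and algebras\<close>

text \<open>Both \<open>M/N\<close> for a subspace \<open>N\<close> and \<open>A/I\<close> for a two-sided ideal \<open>I\<close>: the quotient ring of the
  library, whose elements are the cosets, with the induced scalar multiplication.\<close>

definition quot :: "('k, 'a) module \<Rightarrow> 'a set \<Rightarrow> ('k, 'a set) module" where
  "quot M N = ring.extend (M Quot N)
     (module.fields (\<lambda>c Q. \<Union>x\<in>Q. N +>\<^bsub>M\<^esub> (c \<odot>\<^bsub>M\<^esub> x)))"

text \<open>The map into \<open>M/N\<close> induced on cosets by a linear map \<open>f\<close> into \<open>M\<close>.  If \<open>f\<close> maps the subspace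
  divided out of the source into \<open>N\<close>, all the cosets in the union coincide.\<close>

definition induced :: "('k, 'b) module \<Rightarrow> 'b set \<Rightarrow> ('a \<Rightarrow> 'b) \<Rightarrow> 'a set \<Rightarrow> 'b set" where
  "induced M N f Q = (\<Union>x\<in>Q. N +>\<^bsub>M\<^esub> f x)"

definition linear_iso :: "('k, 'a) module \<Rightarrow> ('k, 'b) module \<Rightarrow> ('a \<Rightarrow> 'b) \<Rightarrow> bool" where
  "linear_iso M N f \<longleftrightarrow>
     bij_betw f (carrier M) (carrier N) \<and>
     (\<forall>x\<in>carrier M. \<forall>y\<in>carrier M. f (x \<oplus>\<^bsub>M\<^esub> y) = f x \<oplus>\<^bsub>N\<^esub> f y) \<and>
     (\<forall>c. \<forall>x\<in>carrier M. f (c \<odot>\<^bsub>M\<^esub> x) = c \<odot>\<^bsub>N\<^esub> f x)"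


section \<open>Tensor powers\<close>

definition fscale :: "'k::field \<Rightarrow> ('x \<Rightarrow>\<^sub>0 'k) \<Rightarrow> ('x \<Rightarrow>\<^sub>0 'k)" where
  "fscale c = Poly_Mapping.map ((*) c)"

lemma lookup_fscale: "Poly_Mapping.lookup (fscale c f) x = c * Poly_Mapping.lookup f x"
  by (simp add: fscale_def Poly_Mapping.map.rep_eq when_def)

global_interpretation free: vector_space "fscale :: 'k::field \<Rightarrow> ('x \<Rightarrow>\<^sub>0 'k) \<Rightarrow> ('x \<Rightarrow>\<^sub>0 'k)"
  by standard
    (auto intro!: poly_mapping_eqI simp: lookup_fscale lookup_add algebra_simps)

definition free_space :: "'x set \<Rightarrow> ('k::field, 'x \<Rightarrow>\<^sub>0 'k) module" where
  "free_space S = \<lparr>carrier = {f. Poly_Mapping.keys f \<subseteq> S}, mult = (\<lambda>_ _. 0), one = 0,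
     zero = 0, add = (+), smult = fscale\<rparr>"

definition lin_ext :: "('x \<Rightarrow> ('y \<Rightarrow>\<^sub>0 'k)) \<Rightarrow> ('x \<Rightarrow>\<^sub>0 'k::field) \<Rightarrow> ('y \<Rightarrow>\<^sub>0 'k)" where
  "lin_ext g f = (\<Sum>x\<in>Poly_Mapping.keys f. fscale (Poly_Mapping.lookup f x) (g x))"

text \<open>The tensor power with \<open>n + 1\<close> factors: the free vector space on the words \<open>[f\<^sub>0, \<dots>, f\<^sub>n]\<close>
  modulo the multilinearity relations.\<close>

definition tuples :: "('k, 'a) module \<Rightarrow> nat \<Rightarrow> 'a list set" where
  "tuples R n = {xs. length xs = Suc n \<and> set xs \<subseteq> carrier R}"

abbreviation word :: "'a list \<Rightarrow> ('a list \<Rightarrow>\<^sub>0 'k::field)" where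
  "word xs \<equiv> Poly_Mapping.single xs 1"

definition multilinear_rels :: "('k::field, 'a) module \<Rightarrow> nat \<Rightarrow> ('a list \<Rightarrow>\<^sub>0 'k) set" where
  "multilinear_rels R n =
     {word (us @ (x \<oplus>\<^bsub>R\<^esub> y) # vs) - word (us @ x # vs) - word (us @ y # vs) | us x y vs.
        us @ x # vs \<in> tuples R n \<and> y \<in> carrier R} \<union>
     {word (us @ (c \<odot>\<^bsub>R\<^esub> x) # vs) - fscale c (word (us @ x # vs)) | us c x vs.
        us @ x # vs \<in> tuples R n}"

definition tensor_null :: "('k::field, 'a) module \<Rightarrow> nat \<Rightarrow> ('a list \<Rightarrow>\<^sub>0 'k) set" where
  "tensor_null R n = free.span (multilinear_rels R n)"

definition hochschild :: "('k::field, 'a) module \<Rightarrow> nat \<Rightarrow> ('k, ('a list \<Rightarrow>\<^sub>0 'k) set) module" where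
  "hochschild R n = quot (free_space (tuples R n)) (tensor_null R n)"

text \<open>The linear map into \<open>hochschild R n\<close> sending the class of a word \<open>xs\<close> to the class of \<open>g xs\<close>.\<close>

definition hochschild_induced :: "('k::field, 'b) module \<Rightarrow> nat \<Rightarrow> ('a list \<Rightarrow> ('b list \<Rightarrow>\<^sub>0 'k))
    \<Rightarrow> ('a list \<Rightarrow>\<^sub>0 'k) set \<Rightarrow> ('b list \<Rightarrow>\<^sub>0 'k) set" where
  "hochschild_induced R n g = induced (free_space (tuples R n)) (tensor_null R n) (lin_ext g)"


section \<open>The cyclic complex\<close>

definition b_word :: "('k::field, 'a) module \<Rightarrow> nat \<Rightarrow> 'a list \<Rightarrow> ('a list \<Rightarrow>\<^sub>0 'k)" where
  "b_word R n xs = (if n = 0 then 0 else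
     (\<Sum>i<n. fscale ((-1) ^ i) (word (take i xs @ (xs ! i \<otimes>\<^bsub>R\<^esub> xs ! Suc i) # drop (i + 2) xs)))
     + fscale ((-1) ^ n) (word ((last xs \<otimes>\<^bsub>R\<^esub> hd xs) # butlast (tl xs))))"

text \<open>Differentials \<open>d n\<close> go from degree \<open>n\<close> to degree \<open>n - 1\<close>; in degree \<open>0\<close>, where \<open>0 - 1 = 0\<close>,
  they are zero.\<close>

definition hochschild_b :: "('k::field, 'a) module \<Rightarrow> nat \<Rightarrow> ('a list \<Rightarrow>\<^sub>0 'k) set \<Rightarrow> ('a list \<Rightarrow>\<^sub>0 'k) set" where
  "hochschild_b R n = hochschild_induced R (n - 1) (b_word R n)"

definition t_word :: "nat \<Rightarrow> 'a list \<Rightarrow> ('a list \<Rightarrow>\<^sub>0 'k::field)" where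
  "t_word n xs = fscale ((-1) ^ n) (word (last xs # butlast xs))"

definition hochschild_t :: "('k::field, 'a) module \<Rightarrow> nat \<Rightarrow> ('a list \<Rightarrow>\<^sub>0 'k) set \<Rightarrow> ('a list \<Rightarrow>\<^sub>0 'k) set" where
  "hochschild_t R n = hochschild_induced R n (t_word n)"

definition im_one_minus_t :: "('k::field, 'a) module \<Rightarrow> nat \<Rightarrow> ('a list \<Rightarrow>\<^sub>0 'k) set set" where
  "im_one_minus_t R n = (\<lambda>Q. Q \<ominus>\<^bsub>hochschild R n\<^esub> hochschild_t R n Q) ` carrier (hochschild R n)"

definition CC :: "('k::field, 'a) module \<Rightarrow> nat \<Rightarrow> ('k, ('a list \<Rightarrow>\<^sub>0 'k) set set) module" where
  "CC R n = quot (hochschild R n) (im_one_minus_t R n)"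

definition CC_b :: "('k::field, 'a) module \<Rightarrow> nat
    \<Rightarrow> ('a list \<Rightarrow>\<^sub>0 'k) set set \<Rightarrow> ('a list \<Rightarrow>\<^sub>0 'k) set set" where
  "CC_b R n = induced (hochschild R (n - 1)) (im_one_minus_t R (n - 1)) (hochschild_b R n)"

text \<open>The map \<open>CC\<^sub>n(R) \<rightarrow> CC\<^sub>n(S)\<close> induced by an algebra homomorphism \<open>\<phi>\<close> from \<open>R\<close> to \<open>S\<close>; the formula
  does not involve \<open>R\<close>.\<close>

definition CC_map :: "('k::field, 'b) module \<Rightarrow> ('a \<Rightarrow> 'b) \<Rightarrow> nat
    \<Rightarrow> ('a list \<Rightarrow>\<^sub>0 'k) set set \<Rightarrow> ('b list \<Rightarrow>\<^sub>0 'k) set set" where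
  "CC_map S \<phi> n =
     induced (hochschild S n) (im_one_minus_t S n) (hochschild_induced S n (\<lambda>xs. word (map \<phi> xs)))"

definition CC_rel :: "('k::field, 'a) module \<Rightarrow> 'a set \<Rightarrow> nat
    \<Rightarrow> ('k, ('a list \<Rightarrow>\<^sub>0 'k) set set) module" where
  "CC_rel A I n = (CC A n)
     \<lparr>carrier := a_kernel (CC A n) (CC (quot A I) n) (CC_map (quot A I) (\<lambda>a. I +>\<^bsub>A\<^esub> a) n)\<rparr>"


section \<open>Cyclic homology and the excision map\<close>

definition cycles :: "(nat \<Rightarrow> ('k, 'a) module) \<Rightarrow> (nat \<Rightarrow> 'a \<Rightarrow> 'a) \<Rightarrow> nat \<Rightarrow> 'a set" where
  "cycles M d n = a_kernel (M n) (M (n - 1)) (d n)"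

definition boundaries :: "(nat \<Rightarrow> ('k, 'a) module) \<Rightarrow> (nat \<Rightarrow> 'a \<Rightarrow> 'a) \<Rightarrow> nat \<Rightarrow> 'a set" where
  "boundaries M d n = d (Suc n) ` carrier (M (Suc n))"

definition homology :: "(nat \<Rightarrow> ('k, 'a) module) \<Rightarrow> (nat \<Rightarrow> 'a \<Rightarrow> 'a) \<Rightarrow> nat \<Rightarrow> ('k, 'a set) module"
  where "homology M d n = quot ((M n)\<lparr>carrier := cycles M d n\<rparr>) (boundaries M d n)"

definition HC :: "('k::field, 'a) module \<Rightarrow> nat \<Rightarrow> ('k, ('a list \<Rightarrow>\<^sub>0 'k) set set set) module" where
  "HC R = homology (CC R) (CC_b R)"

definition HC_rel :: "('k::field, 'a) module \<Rightarrow> 'a set \<Rightarrow> nat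
    \<Rightarrow> ('k, ('a list \<Rightarrow>\<^sub>0 'k) set set set) module" where
  "HC_rel A I = homology (CC_rel A I) (CC_b A)"

text \<open>Induced on homology by the chain map that the inclusion of \<open>I\<close> into \<open>A\<close> induces, with
  values in the relative complex.\<close>

definition excision_map :: "('k::field, 'a) module \<Rightarrow> 'a set \<Rightarrow> nat
    \<Rightarrow> ('a list \<Rightarrow>\<^sub>0 'k) set set set \<Rightarrow> ('a list \<Rightarrow>\<^sub>0 'k) set set set" where
  "excision_map A I n =
     induced (CC_rel A I n) (boundaries (CC_rel A I) (CC_b A) n) (CC_map A (\<lambda>x. x) n)"

end

theory Submission
  imports Defs
begin

text \<open>
  The proof compares \<open>CC(I)\<close> with \<open>CC(A,I)\<close> through a filtration.  Write \<open>A = I \<oplus> V\<close> as a vector space.  The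
  relative complex is spanned by cyclic words with at least one letter in \<open>I\<close>, and a product of two letters
  lies in \<open>I\<close> as soon as one of the factors does.  Hence the differential \<open>b\<close> does not increase the number
  of letters outside \<open>I\<close>.  The words with at most \<open>p\<close> such letters form a subcomplex (\<open>level\<close>); for
  \<open>p = 0\<close> it is the image of \<open>CC(I)\<close>.  Excision says that the successive quotients for \<open>p > 0\<close> are acyclic.

  In such a quotient only products of two neighbouring letters of \<open>I\<close> survive, so that \<open>b\<close> acts as the bar
  differential on each maximal block of letters of \<open>I\<close>.  If \<open>e\<close> is a left unit for the letters that
  occur, then putting \<open>e\<close> in front of a block contracts it.  Doing this for one block after the other and
  adding up, with signs, gives an operator \<open>D\<close> on cyclic words with
  \<open>b D + D b = q\<close>, where \<open>q\<close> is the number of blocks, that is, the number of crossings from a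
  letter of \<open>V\<close> to a letter of \<open>I\<close>.  Right units are put at the end of a block.  As \<open>q > 0\<close> for words of both
  kinds of letters and the characteristic is zero, \<open>q\<close> can be inverted.  A chain whose boundary comes from
  \<open>I\<close> is thus pushed down the filtration, first in \<open>q\<close> and then in \<open>p\<close>, by subtracting boundaries
  \<open>b (D x) / q\<close>, until it comes from \<open>I\<close> itself.  This is \<open>reduce_to_ideal\<close>; applied to cycles it yields
  surjectivity of the excision map, and applied to chains with boundary in \<open>I\<close> it yields injectivity.

  Two devices keep the computation on words.  The operator \<open>D\<close> is \<open>s N\<close>, where \<open>N\<close> is the norm of the
  cyclic operator and \<open>s\<close> puts \<open>e\<close> in front of the word, applying to the first and the last letter
  the linear projections that select a crossing there; since \<open>N b = b' N\<close> with the bar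
  differential \<open>b'\<close> (\<open>norm_b_eq_bar_norm\<close>), the homotopy formula is checked for \<open>b'\<close>, one rotation at a time
  (\<open>insert_unit_homotopy\<close>).  In characteristic zero the same identity shows that \<open>b\<close> respects the
  cyclic relations and that \<open>b b\<close> vanishes modulo them.  Moreover, all homology groups are described by chains, that is formal linear combinations of
  words, modulo explicit subspaces (\<open>presentation\<close>).
\<close>


section \<open>Spaces presented as quotients of subspaces of a free vector space\<close>

text \<open>The map \<open>c\<close> identifies \<open>M\<close> with \<open>F / K\<close>.  The spaces below are quotients of quotients, with sets of
  sets of chains as elements; a presentation replaces them by representatives in \<open>F\<close>.\<close>

locale presentation =
  fixes F K :: "('x \<Rightarrow>\<^sub>0 'k::field) set" and c :: "('x \<Rightarrow>\<^sub>0 'k) \<Rightarrow> 'm" and M :: "('k, 'm) module" (structure)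
  assumes subspace_F: "free.subspace F"
    and subspace_K: "free.subspace K"
    and K_le: "K \<subseteq> F"
    and carrier_eq: "carrier M = c ` F"
    and class_eq: "\<lbrakk>f \<in> F; g \<in> F\<rbrakk> \<Longrightarrow> c f = c g \<longleftrightarrow> f - g \<in> K"
    and class_add: "\<lbrakk>f \<in> F; g \<in> F\<rbrakk> \<Longrightarrow> c f \<oplus> c g = c (f + g)"
    and class_scale: "f \<in> F \<Longrightarrow> a \<odot> c f = c (fscale a f)"
    and class_zero: "\<zero> = c 0"
begin

lemma coset_image:
  assumes "L \<subseteq> F" and "f \<in> F"
  shows "c ` L +>\<^bsub>M\<^esub> c f = c ` {l + f | l. l \<in> L}"
  using assms by (auto simp: a_r_coset_def' class_add subsetD)+

lemma coset_mem_iff: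
  assumes L: "free.subspace L" "K \<subseteq> L" "L \<subseteq> F" and f: "f \<in> F" and g: "g \<in> F"
  shows "c g \<in> c ` L +>\<^bsub>M\<^esub> c f \<longleftrightarrow> g - f \<in> L"
proof
  assume "c g \<in> c ` L +>\<^bsub>M\<^esub> c f"
  then obtain l where l: "l \<in> L" "c g = c (l + f)"
    unfolding coset_image[OF L(3) f] by auto
  have "l + f \<in> F" using l L f subspace_F free.subspace_add by blast
  then have "g - (l + f) \<in> L" using l L(2) class_eq[OF g] by auto
  then have "g - (l + f) + l \<in> L" using l L(1) free.subspace_add by blast
  then show "g - f \<in> L" by simp
next
  assume "g - f \<in> L"
  then show "c g \<in> c ` L +>\<^bsub>M\<^esub> c f"
    unfolding coset_image[OF L(3) f] by force
qed

lemma coset_subset: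
  assumes "L \<subseteq> F" and "f \<in> F"
  shows "c ` L +>\<^bsub>M\<^esub> c f \<subseteq> c ` F"
  unfolding coset_image[OF assms] using assms subspace_F free.subspace_add by blast

lemma coset_eq_iff:
  assumes L: "free.subspace L" "K \<subseteq> L" "L \<subseteq> F" and f: "f \<in> F" and g: "g \<in> F"
  shows "c ` L +>\<^bsub>M\<^esub> c f = c ` L +>\<^bsub>M\<^esub> c g \<longleftrightarrow> f - g \<in> L"
proof
  assume eq: "c ` L +>\<^bsub>M\<^esub> c f = c ` L +>\<^bsub>M\<^esub> c g"
  have "c f \<in> c ` L +>\<^bsub>M\<^esub> c f"
    using coset_mem_iff[OF L f f] free.subspace_0[OF L(1)] by simp
  then show "f - g \<in> L"
    unfolding eq coset_mem_iff[OF L g f] .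
next
  assume fg: "f - g \<in> L"
  have "h - f \<in> L \<longleftrightarrow> h - g \<in> L" for h
  proof -
    have "h - g = (h - f) + (f - g)" "h - f = (h - g) - (f - g)" by simp_all
    then show ?thesis using fg L(1) free.subspace_add free.subspace_diff by metis
  qed
  then have "x \<in> c ` L +>\<^bsub>M\<^esub> c f \<longleftrightarrow> x \<in> c ` L +>\<^bsub>M\<^esub> c g" for x
    using coset_mem_iff[OF L f] coset_mem_iff[OF L g] coset_subset[OF L(3) f] coset_subset[OF L(3) g]
    by blast
  then show "c ` L +>\<^bsub>M\<^esub> c f = c ` L +>\<^bsub>M\<^esub> c g" by blast
qed

lemma coset_self:
  assumes L: "free.subspace L" "K \<subseteq> L" "L \<subseteq> F" and f: "f \<in> F"
  shows "c f \<in> c ` L +>\<^bsub>M\<^esub> c f"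
  using coset_mem_iff[OF L f f] free.subspace_0[OF L(1)] by simp

text \<open>Every element of a coset has the form \<open>c g\<close>, so a union of cosets that all coincide is any
  one of them.\<close>

lemma union_over_coset:
  assumes L: "free.subspace L" "K \<subseteq> L" "L \<subseteq> F" and f: "f \<in> F"
    and const: "\<And>g. \<lbrakk>g \<in> F; g - f \<in> L\<rbrakk> \<Longrightarrow> X (c g) = Y"
  shows "(\<Union>x\<in>c ` L +>\<^bsub>M\<^esub> c f. X x) = Y"
proof -
  have "X x = Y" if "x \<in> c ` L +>\<^bsub>M\<^esub> c f" for x
    using that coset_subset[OF L(3) f] const coset_mem_iff[OF L f] by blast
  then show ?thesis using coset_self[OF L f] by blast
qed

lemma presentation_quot:
  assumes L: "free.subspace L" "K \<subseteq> L" "L \<subseteq> F"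
  shows "presentation F L (\<lambda>f. c ` L +>\<^bsub>M\<^esub> c f) (quot M (c ` L))"
proof
  show "free.subspace F" "free.subspace L" "L \<subseteq> F" by (fact subspace_F L)+
  show "carrier (quot M (c ` L)) = (\<lambda>f. c ` L +>\<^bsub>M\<^esub> c f) ` F"
  proof -
    have "carrier (quot M (c ` L)) = (\<lambda>x. c ` L +>\<^bsub>M\<^esub> x) ` carrier M"
      by (auto simp: quot_def FactRing_simps ring.defs module.defs)
    then show ?thesis by (simp add: carrier_eq image_image)
  qed
  show "\<zero>\<^bsub>quot M (c ` L)\<^esub> = c ` L +>\<^bsub>M\<^esub> c 0"
    using coset_image[OF L(3), of 0] free.subspace_0[OF subspace_F]
    by (simp add: quot_def FactRing_simps ring.defs module.defs)
  fix f assume f: "f \<in> F"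
  show "a \<odot>\<^bsub>quot M (c ` L)\<^esub> (c ` L +>\<^bsub>M\<^esub> c f) = c ` L +>\<^bsub>M\<^esub> c (fscale a f)" for a
  proof -
    have "c ` L +>\<^bsub>M\<^esub> (a \<odot> c g) = c ` L +>\<^bsub>M\<^esub> c (fscale a f)" if "g \<in> F" "g - f \<in> L" for g
    proof -
      have "fscale a g - fscale a f \<in> L"
        using that L(1) free.subspace_scale by (metis free.scale_right_diff_distrib)
      then show ?thesis
        using that f coset_eq_iff[OF L] free.subspace_scale[OF subspace_F] by (simp add: class_scale)
    qed
    then have "(\<Union>x\<in>c ` L +>\<^bsub>M\<^esub> c f. c ` L +>\<^bsub>M\<^esub> (a \<odot> x)) = c ` L +>\<^bsub>M\<^esub> c (fscale a f)"
      by (rule union_over_coset[OF L f])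
    then show ?thesis by (simp add: quot_def ring.defs module.defs)
  qed
  fix g assume g: "g \<in> F"
  show "c ` L +>\<^bsub>M\<^esub> c f = c ` L +>\<^bsub>M\<^esub> c g \<longleftrightarrow> f - g \<in> L"
    by (rule coset_eq_iff[OF L f g])
  show "(c ` L +>\<^bsub>M\<^esub> c f) \<oplus>\<^bsub>quot M (c ` L)\<^esub> (c ` L +>\<^bsub>M\<^esub> c g) = c ` L +>\<^bsub>M\<^esub> c (f + g)"
  proof -
    have fg: "f + g \<in> F" using f g subspace_F free.subspace_add by blast
    have "set_add M (c ` L +>\<^bsub>M\<^esub> c f) (c ` L +>\<^bsub>M\<^esub> c g)
        = {x \<oplus> y | x y. x \<in> c ` {l + f | l. l \<in> L} \<and> y \<in> c ` {l + g | l. l \<in> L}}"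
      unfolding coset_image[OF L(3) f] coset_image[OF L(3) g] by (auto simp: set_add_def set_mult_def)
    also have "\<dots> = {c (l + f) \<oplus> c (l' + g) | l l'. l \<in> L \<and> l' \<in> L}" by auto
    also have "\<dots> = {c ((l + l') + (f + g)) | l l'. l \<in> L \<and> l' \<in> L}"
    proof -
      have "c (l + f) \<oplus> c (l' + g) = c ((l + l') + (f + g))" if "l \<in> L" "l' \<in> L" for l l'
      proof -
        have "l + f \<in> F" "l' + g \<in> F"
          using that L(3) f g free.subspace_add[OF subspace_F] by auto
        then show ?thesis using class_add by (simp add: algebra_simps)
      qed
      then show ?thesis by (metis (no_types, opaque_lifting))
    qed
    also have "\<dots> = c ` {l + (f + g) | l. l \<in> L}"
    proof -
      have "\<exists>l1 l2. l1 \<in> L \<and> l2 \<in> L \<and> l = l1 + l2" if "l \<in> L" for l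
        using that free.subspace_0[OF L(1)] by (metis add.right_neutral)
      then show ?thesis using free.subspace_add[OF L(1)] by (auto simp: image_iff) metis
    qed
    finally show ?thesis
      unfolding coset_image[OF L(3) fg] by (simp add: quot_def FactRing_def ring.defs module.defs)
  qed
qed

lemma presentation_subspace:
  assumes "free.subspace F'" "K \<subseteq> F'" "F' \<subseteq> F"
  shows "presentation F' K c (M\<lparr>carrier := c ` F'\<rparr>)"
proof
  fix f g assume "f \<in> F'" "g \<in> F'"
  then have "f \<in> F" "g \<in> F" using assms by auto
  then show "c f = c g \<longleftrightarrow> f - g \<in> K" "c f \<oplus>\<^bsub>M\<lparr>carrier := c ` F'\<rparr>\<^esub> c g = c (f + g)"
    using class_eq class_add by auto
qed (use assms subspace_K class_scale class_zero in auto)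

lemma class_minus:
  assumes f: "f \<in> F"
  shows "\<ominus> c f = c (- f)"
proof -
  have f': "- f \<in> F" using f subspace_F free.subspace_neg by blast
  have u: "y = c (- f)" if y: "y \<in> carrier M" "c f \<oplus> y = \<zero>" for y
  proof -
    obtain g where g: "g \<in> F" "y = c g" using y carrier_eq by auto
    have fg: "f + g \<in> F" using f g subspace_F free.subspace_add by blast
    have "c (f + g) = c 0" using y g f class_add class_zero by simp
    then have "f + g \<in> K" using class_eq[OF fg] free.subspace_0[OF subspace_F] by simp
    then have "g - (- f) \<in> K" by (simp add: add.commute)
    then show ?thesis using class_eq g f' by blast
  qed
  have "c f \<oplus> c (- f) = \<zero>" "c (- f) \<oplus> c f = \<zero>" "c (- f) \<in> carrier M"
    using f f' class_add class_zero carrier_eq by auto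
  then show ?thesis
    unfolding a_inv_def m_inv_def by (intro the_equality) (auto intro: u)
qed

lemma class_diff:
  assumes "f \<in> F" "g \<in> F"
  shows "c f \<ominus> c g = c (f - g)"
  using assms free.subspace_neg[OF subspace_F] by (simp add: a_minus_def class_minus class_add)

lemma class_zero_iff: "f \<in> F \<Longrightarrow> c f = \<zero> \<longleftrightarrow> f \<in> K"
  using class_eq[of f 0] free.subspace_0[OF subspace_F] by (simp add: class_zero)

end

text \<open>The union that defines the induced map runs over all representatives of a coset.  It is one coset,
  because \<open>g\<close> maps \<open>L\<close> into \<open>L'\<close>.\<close>

lemma induced_class:
  assumes M: "presentation F K c M" and N: "presentation F' K' c' N"
    and L: "free.subspace L" "K \<subseteq> L" "L \<subseteq> F"
    and L': "free.subspace L'" "K' \<subseteq> L'" "L' \<subseteq> F'"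
    and h: "\<And>f. f \<in> F \<Longrightarrow> h (c f) = c' (g f)"
    and g: "module_hom fscale fscale g" "\<And>f. f \<in> F \<Longrightarrow> g f \<in> F'" "\<And>f. f \<in> L \<Longrightarrow> g f \<in> L'"
    and f: "f \<in> F"
  shows "induced N (c' ` L') h (c ` L +>\<^bsub>M\<^esub> c f) = c' ` L' +>\<^bsub>N\<^esub> c' (g f)"
  unfolding induced_def
proof (rule presentation.union_over_coset[OF M L f])
  fix f' assume f': "f' \<in> F" "f' - f \<in> L"
  then have "g f' - g f \<in> L'" using g module_hom.diff by metis
  then show "c' ` L' +>\<^bsub>N\<^esub> h (c f') = c' ` L' +>\<^bsub>N\<^esub> c' (g f)"
    using h f' f g presentation.coset_eq_iff[OF N L'] by simp
qed

lemma presentation_free_space: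
  "presentation {f. Poly_Mapping.keys f \<subseteq> S} {0} (\<lambda>f. f) (free_space S)"
proof
  show "free.subspace {f :: 'a \<Rightarrow>\<^sub>0 'b::field. Poly_Mapping.keys f \<subseteq> S}"
  proof (rule free.subspaceI)
    show "fscale a f \<in> {f. Poly_Mapping.keys f \<subseteq> S}" if "f \<in> {f. Poly_Mapping.keys f \<subseteq> S}" for a f
      using that by (auto simp: in_keys_iff lookup_fscale)
  qed (use keys_add in force)+
qed (auto simp: free_space_def)

text \<open>A map that is the identity on representatives is an isomorphism as soon as the subspaces of the two
  presentations are related in the way that injectivity and surjectivity require.\<close>

lemma linear_iso_presentations:
  assumes M: "presentation F K c M" and N: "presentation F' K' c' N"
    and h: "\<And>f. f \<in> F \<Longrightarrow> h (c f) = c' f"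
    and le: "F \<subseteq> F'" and K: "F \<inter> K' \<subseteq> K" and K': "K \<subseteq> K'"
    and surj: "\<And>f. f \<in> F' \<Longrightarrow> \<exists>g\<in>F. f - g \<in> K'"
  shows "linear_iso M N h"
proof -
  interpret M: presentation F K c M by (fact M)
  interpret N: presentation F' K' c' N by (fact N)
  have add: "f + g \<in> F" "f - g \<in> F" "fscale a f \<in> F" if "f \<in> F" "g \<in> F" for f g a
    using that free.subspace_add free.subspace_diff free.subspace_scale M.subspace_F by blast+
  have "inj_on h (carrier M)"
  proof (rule inj_onI)
    fix x y assume "x \<in> carrier M" "y \<in> carrier M" and eq: "h x = h y"
    then obtain f g where fg: "f \<in> F" "g \<in> F" "x = c f" "y = c g" using M.carrier_eq by auto
    then have "f - g \<in> K'" using eq h N.class_eq le by auto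
    then show "x = y" using fg K add M.class_eq by auto
  qed
  moreover have "h ` carrier M = carrier N"
  proof
    show "h ` carrier M \<subseteq> carrier N" using h le by (auto simp: M.carrier_eq N.carrier_eq)
    show "carrier N \<subseteq> h ` carrier M"
    proof
      fix y assume "y \<in> carrier N"
      then obtain f where f: "f \<in> F'" "y = c' f" using N.carrier_eq by auto
      then obtain g where g: "g \<in> F" "f - g \<in> K'" using surj by blast
      then have "y = h (c g)" using f h N.class_eq le by auto
      then show "y \<in> h ` carrier M" using g M.carrier_eq by auto
    qed
  qed
  ultimately show ?thesis
    unfolding linear_iso_def bij_betw_def
    using h le add by (auto simp: M.carrier_eq M.class_add N.class_add M.class_scale N.class_scale subsetD)
qed


section \<open>Linear operators on words\<close>

lemma lin_ext_superset:
  assumes "finite S" "Poly_Mapping.keys f \<subseteq> S"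
  shows "lin_ext g f = (\<Sum>x\<in>S. fscale (Poly_Mapping.lookup f x) (g x))"
  unfolding lin_ext_def
  by (rule sum.mono_neutral_left) (use assms in \<open>auto simp: in_keys_iff\<close>)

lemma module_hom_lin_ext: "module_hom fscale fscale (lin_ext (g :: 'a \<Rightarrow> ('b \<Rightarrow>\<^sub>0 'k::field)))"
proof (unfold_locales)
  fix f h :: "'a \<Rightarrow>\<^sub>0 'k"
  let ?S = "Poly_Mapping.keys f \<union> Poly_Mapping.keys h"
  have "Poly_Mapping.keys (f + h) \<subseteq> ?S" by (rule keys_add)
  then show "lin_ext g (f + h) = lin_ext g f + lin_ext g h"
    by (simp add: lin_ext_superset[of ?S] lookup_add free.scale_left_distrib sum.distrib)
next
  fix a and f :: "'a \<Rightarrow>\<^sub>0 'k"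
  have "Poly_Mapping.keys (fscale a f) \<subseteq> Poly_Mapping.keys f"
    by (auto simp: in_keys_iff lookup_fscale)
  then show "lin_ext g (fscale a f) = fscale a (lin_ext g f)"
    by (simp add: lin_ext_superset[of "Poly_Mapping.keys f"] lookup_fscale free.scale_sum_right)
qed

lemmas lin_ext_add = module_hom.add[OF module_hom_lin_ext]
lemmas lin_ext_diff = module_hom.diff[OF module_hom_lin_ext]
lemmas lin_ext_neg = module_hom.neg[OF module_hom_lin_ext]
lemmas lin_ext_zero [simp] = module_hom.zero[OF module_hom_lin_ext]
lemmas lin_ext_scale = module_hom.scale[OF module_hom_lin_ext]
lemmas lin_ext_sum = module_hom.sum[OF module_hom_lin_ext]

lemmas lin_ext_linear = lin_ext_add lin_ext_diff lin_ext_neg lin_ext_scale lin_ext_sum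

lemma lin_ext_single [simp]: "lin_ext g (Poly_Mapping.single x 1) = g x"
  by (simp add: lin_ext_def)

definition word_map :: "('a list \<Rightarrow> 'b list) \<Rightarrow> ('a list \<Rightarrow>\<^sub>0 'k::field) \<Rightarrow> ('b list \<Rightarrow>\<^sub>0 'k)" where
  "word_map L = lin_ext (\<lambda>xs. word (L xs))"

lemma word_map_word [simp]: "word_map L (word xs) = word (L xs)"
  by (simp add: word_map_def)

lemma module_hom_word_map: "module_hom fscale fscale (word_map L)"
  unfolding word_map_def by (rule module_hom_lin_ext)

lemmas word_map_linear = module_hom.add[OF module_hom_word_map] module_hom.diff[OF module_hom_word_map]
  module_hom.neg[OF module_hom_word_map] module_hom.scale[OF module_hom_word_map]
  module_hom.sum[OF module_hom_word_map] module_hom.zero[OF module_hom_word_map]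

lemma hom_span:
  assumes "module_hom fscale fscale g" "free.subspace W" "\<And>x. x \<in> S \<Longrightarrow> g x \<in> W" "x \<in> free.span S"
  shows "g x \<in> W"
proof -
  have "g x \<in> free.span (g ` S)"
    using assms(4) module_hom.span_image[OF assms(1)] by blast
  then show ?thesis using free.span_minimal[of "g ` S" W] assms(2,3) by blast
qed

lemma hom_eq_on_span:
  assumes "module_hom fscale fscale g" "module_hom fscale fscale h"
    and "\<And>x. x \<in> S \<Longrightarrow> g x = h x" "x \<in> free.span S"
  shows "g x = h x"
  using assms(4)
proof (rule free.span_induct)
  show "free.subspace {x. g x = h x}"
    using assms(1,2) by (intro free.subspaceI) (auto simp: module_hom.add module_hom.scale module_hom.zero)
qed (use assms(3) in auto)

definition chain_space :: "('k::field, 'a) module \<Rightarrow> nat \<Rightarrow> ('a list \<Rightarrow>\<^sub>0 'k) set" where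
  "chain_space R n = {f. Poly_Mapping.keys f \<subseteq> tuples R n}"

lemma span_singles: "free.span ((\<lambda>x. Poly_Mapping.single x 1) ` S) = {f :: 'x \<Rightarrow>\<^sub>0 'k::field. Poly_Mapping.keys f \<subseteq> S}"
proof
  show "free.span ((\<lambda>x. Poly_Mapping.single x 1) ` S) \<subseteq> {f :: 'x \<Rightarrow>\<^sub>0 'k. Poly_Mapping.keys f \<subseteq> S}"
    using presentation.subspace_F[OF presentation_free_space]
    by (intro free.span_minimal) auto
  show "{f :: 'x \<Rightarrow>\<^sub>0 'k. Poly_Mapping.keys f \<subseteq> S} \<subseteq> free.span ((\<lambda>x. Poly_Mapping.single x 1) ` S)"
  proof safe
    fix f :: "'x \<Rightarrow>\<^sub>0 'k" assume f: "Poly_Mapping.keys f \<subseteq> S"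
    have "f = (\<Sum>x\<in>Poly_Mapping.keys f. fscale (Poly_Mapping.lookup f x) (Poly_Mapping.single x 1))"
      by (rule poly_mapping_eqI)
        (auto simp: lookup_sum lookup_fscale lookup_single when_def in_keys_iff if_distrib sum.delta cong: if_cong)
    moreover have "\<dots> \<in> free.span ((\<lambda>x. Poly_Mapping.single x 1) ` S)"
      using f by (intro free.span_sum free.span_scale free.span_base) auto
    ultimately show "f \<in> free.span ((\<lambda>x. Poly_Mapping.single x 1) ` S)" by simp
  qed
qed

lemma chains_span: "chain_space R n = free.span (word ` tuples R n)"
  by (simp add: chain_space_def span_singles)

lemma subspace_chain_space [simp]: "free.subspace (chain_space R n)"
  by (simp add: chains_span)

lemma word_in_chains [simp]: "word xs \<in> chain_space R n \<longleftrightarrow> xs \<in> tuples R n"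
  by (simp add: chain_space_def)

lemma hom_chains:
  assumes "module_hom fscale fscale g" "free.subspace W" "\<And>xs. xs \<in> tuples R n \<Longrightarrow> g (word xs) \<in> W" "x \<in> chain_space R n"
  shows "g x \<in> W"
  using hom_span[OF assms(1,2), of "word ` tuples R n"] assms(3,4) by (auto simp: chains_span)

lemma hom_eq_on_chains:
  assumes "module_hom fscale fscale g" "module_hom fscale fscale h"
    and "\<And>xs. xs \<in> tuples R n \<Longrightarrow> g (word xs) = h (word xs)" "x \<in> chain_space R n"
  shows "g x = h x"
  using hom_eq_on_span[OF assms(1,2), of "word ` tuples R n"] assms(3,4) by (auto simp: chains_span)


section \<open>Operators that are linear in every letter\<close>

definition closed_carrier :: "('k, 'a) module \<Rightarrow> bool" where
  "closed_carrier R \<longleftrightarrow> (\<forall>x\<in>carrier R. \<forall>y\<in>carrier R. x \<oplus>\<^bsub>R\<^esub> y \<in> carrier R) \<and>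
     (\<forall>a. \<forall>x\<in>carrier R. a \<odot>\<^bsub>R\<^esub> x \<in> carrier R)"

definition linear_on :: "('k, 'a) module \<Rightarrow> ('k, 'b) module \<Rightarrow> ('a \<Rightarrow> 'b) \<Rightarrow> bool" where
  "linear_on R S f \<longleftrightarrow> (\<forall>x\<in>carrier R. f x \<in> carrier S) \<and>
     (\<forall>x\<in>carrier R. \<forall>y\<in>carrier R. f (x \<oplus>\<^bsub>R\<^esub> y) = f x \<oplus>\<^bsub>S\<^esub> f y) \<and>
     (\<forall>a. \<forall>x\<in>carrier R. f (a \<odot>\<^bsub>R\<^esub> x) = a \<odot>\<^bsub>S\<^esub> f x)"

lemma linear_on_ident: "linear_on R R (\<lambda>x. x)"
  by (simp add: linear_on_def)

lemma linear_on_comp: "linear_on R S f \<Longrightarrow> linear_on S T g \<Longrightarrow> linear_on R T (\<lambda>x. g (f x))"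
  by (simp add: linear_on_def)

text \<open>As a function of any one letter, the word \<open>L xs\<close> changes in one place, and there linearly.
  This is what makes the operator induced by \<open>L\<close> descend to tensor powers.\<close>

definition slotwise :: "('k, 'a) module \<Rightarrow> ('k, 'b) module \<Rightarrow> nat \<Rightarrow> nat \<Rightarrow> ('a list \<Rightarrow> 'b list) \<Rightarrow> bool" where
  "slotwise R S n m L \<longleftrightarrow> (\<forall>xs\<in>tuples R n. L xs \<in> tuples S m) \<and>
     (\<forall>us x vs. us @ x # vs \<in> tuples R n \<longrightarrow>
       (\<exists>us' f vs'. linear_on R S f \<and> (\<forall>z\<in>carrier R. L (us @ z # vs) = us' @ f z # vs')))"

lemma slotwise_comp:
  assumes "slotwise R S n m L" "slotwise S T m k L'"
  shows "slotwise R T n k (\<lambda>xs. L' (L xs))"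
  unfolding slotwise_def
proof (intro conjI ballI allI impI)
  show "L' (L xs) \<in> tuples T k" if "xs \<in> tuples R n" for xs
    using that assms by (simp add: slotwise_def)
next
  fix us x vs assume *: "us @ x # vs \<in> tuples R n"
  then obtain us' f vs' where f: "linear_on R S f" "\<And>z. z \<in> carrier R \<Longrightarrow> L (us @ z # vs) = us' @ f z # vs'"
    using assms(1) unfolding slotwise_def by meson
  have "x \<in> carrier R" using * by (auto simp: tuples_def)
  then have "us' @ f x # vs' \<in> tuples S m"
    using * f(2) assms(1) unfolding slotwise_def by metis
  then obtain us'' g vs'' where g: "linear_on S T g" "\<And>z. z \<in> carrier S \<Longrightarrow> L' (us' @ z # vs') = us'' @ g z # vs''"
    using assms(2) unfolding slotwise_def by meson
  have "\<forall>z\<in>carrier R. L' (L (us @ z # vs)) = us'' @ g (f z) # vs''"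
    using f g by (simp add: linear_on_def)
  then show "\<exists>us' f vs'. linear_on R T f \<and> (\<forall>z\<in>carrier R. L' (L (us @ z # vs)) = us' @ f z # vs')"
    using linear_on_comp[OF f(1) g(1)] by blast
qed

lemma tuples_replace: "us @ x # vs \<in> tuples R n \<Longrightarrow> y \<in> carrier R \<Longrightarrow> us @ y # vs \<in> tuples R n"
  by (simp add: tuples_def)

lemma tensor_null_add:
  assumes "us @ x # vs \<in> tuples R n" "y \<in> carrier R"
  shows "word (us @ (x \<oplus>\<^bsub>R\<^esub> y) # vs) - word (us @ x # vs) - word (us @ y # vs) \<in> tensor_null R n"
  unfolding tensor_null_def multilinear_rels_def using assms by (intro free.span_base) blast

lemma tensor_null_scale:
  assumes "us @ x # vs \<in> tuples R n"
  shows "word (us @ (a \<odot>\<^bsub>R\<^esub> x) # vs) - fscale a (word (us @ x # vs)) \<in> tensor_null R n"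
  unfolding tensor_null_def multilinear_rels_def using assms by (intro free.span_base) blast

lemma tensor_null_zero_letter:
  assumes "us @ x # vs \<in> tuples R n"
  shows "word (us @ (0 \<odot>\<^bsub>R\<^esub> x) # vs) \<in> tensor_null R n"
  using tensor_null_scale[OF assms, of 0] by simp

lemma subspace_tensor_null [simp]: "free.subspace (tensor_null R n)"
  by (simp add: tensor_null_def)

lemma word_map_tensor_null:
  assumes R: "closed_carrier R" and L: "slotwise R S n m L" and x: "x \<in> tensor_null R n"
  shows "word_map L x \<in> tensor_null S m"
proof (rule hom_span[OF module_hom_word_map subspace_tensor_null _ x[unfolded tensor_null_def]])
  fix r assume "r \<in> multilinear_rels R n"
  then consider
    us x y vs where "us @ x # vs \<in> tuples R n" "y \<in> carrier R"
      "r = word (us @ (x \<oplus>\<^bsub>R\<^esub> y) # vs) - word (us @ x # vs) - word (us @ y # vs)"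
  | us a x vs where "us @ x # vs \<in> tuples R n" "r = word (us @ (a \<odot>\<^bsub>R\<^esub> x) # vs) - fscale a (word (us @ x # vs))"
    unfolding multilinear_rels_def by blast
  then show "word_map L r \<in> tensor_null S m"
  proof cases
    case 1
    obtain us' f vs' where f: "linear_on R S f" "\<And>z. z \<in> carrier R \<Longrightarrow> L (us @ z # vs) = us' @ f z # vs'"
      using 1(1) L unfolding slotwise_def by meson
    have x: "x \<in> carrier R" using 1 by (auto simp: tuples_def)
    have "us' @ f x # vs' \<in> tuples S m"
      using 1 f(2)[OF x] L unfolding slotwise_def by metis
    then show ?thesis
      using 1 x R f tensor_null_add[of us' "f x" vs' S m "f y"]
      by (simp add: word_map_linear closed_carrier_def linear_on_def)
  next
    case 2
    obtain us' f vs' where f: "linear_on R S f" "\<And>z. z \<in> carrier R \<Longrightarrow> L (us @ z # vs) = us' @ f z # vs'"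
      using 2(1) L unfolding slotwise_def by meson
    have x: "x \<in> carrier R" using 2 by (auto simp: tuples_def)
    have "us' @ f x # vs' \<in> tuples S m"
      using 2 f(2)[OF x] L unfolding slotwise_def by metis
    then show ?thesis
      using 2 x R f tensor_null_scale[of us' "f x" vs' S m a]
      by (simp add: word_map_linear closed_carrier_def linear_on_def)
  qed
qed

lemma slotwise_map:
  assumes "linear_on R S f"
  shows "slotwise R S n n (map f)"
  unfolding slotwise_def
proof (intro conjI ballI allI impI)
  show "map f xs \<in> tuples S n" if "xs \<in> tuples R n" for xs
    using that assms by (auto simp: tuples_def linear_on_def)
  show "\<exists>us' f' vs'. linear_on R S f' \<and> (\<forall>z\<in>carrier R. map f (us @ z # vs) = us' @ f' z # vs')" for us x vs
    using assms by auto
qed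

lemma slotwise_rotate1: "slotwise R R n n rotate1"
  unfolding slotwise_def
proof (intro conjI ballI allI impI)
  show "rotate1 xs \<in> tuples R n" if "xs \<in> tuples R n" for xs
    using that by (auto simp: tuples_def)
  show "\<exists>us' f vs'. linear_on R R f \<and> (\<forall>z\<in>carrier R. rotate1 (us @ z # vs) = us' @ f z # vs')" for us x vs
  proof (cases us)
    case Nil
    then have "\<forall>z\<in>carrier R. rotate1 (us @ z # vs) = vs @ z # []" by simp
    then show ?thesis using linear_on_ident by blast
  next
    case (Cons u us')
    then have "\<forall>z\<in>carrier R. rotate1 (us @ z # vs) = us' @ z # (vs @ [u])" by simp
    then show ?thesis using linear_on_ident by blast
  qed
qed

lemma slotwise_rotate: "slotwise R R n n (rotate k)"
proof (induction k)
  case 0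
  show ?case by (simp add: slotwise_def) (use linear_on_ident in blast)
next
  case (Suc k)
  then show ?case using slotwise_comp[OF Suc slotwise_rotate1] by simp
qed

lemma slotwise_Cons:
  assumes "e \<in> carrier R"
  shows "slotwise R R n (Suc n) (Cons e)"
  unfolding slotwise_def
proof (intro conjI ballI allI impI)
  show "e # xs \<in> tuples R (Suc n)" if "xs \<in> tuples R n" for xs
    using that assms by (auto simp: tuples_def)
  show "\<exists>us' f vs'. linear_on R R f \<and> (\<forall>z\<in>carrier R. e # us @ z # vs = us' @ f z # vs')" for us x vs
    using linear_on_ident by (metis append_Cons)
qed


section \<open>The cyclic complex as a quotient of the chains\<close>

definition cyclic_rels :: "('k::field, 'a) module \<Rightarrow> nat \<Rightarrow> ('a list \<Rightarrow>\<^sub>0 'k) set" where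
  "cyclic_rels R n = {word xs - t_word n xs | xs. xs \<in> tuples R n}"

definition cyclic_null :: "('k::field, 'a) module \<Rightarrow> nat \<Rightarrow> ('a list \<Rightarrow>\<^sub>0 'k) set" where
  "cyclic_null R n = free.span (multilinear_rels R n \<union> cyclic_rels R n)"

lemma subspace_cyclic_null [simp]: "free.subspace (cyclic_null R n)"
  by (simp add: cyclic_null_def)

lemma tensor_null_le_cyclic_null: "tensor_null R n \<subseteq> cyclic_null R n"
  unfolding tensor_null_def cyclic_null_def by (rule free.span_mono) simp

lemma cyclic_rels_le_cyclic_null: "free.span (cyclic_rels R n) \<subseteq> cyclic_null R n"
  unfolding cyclic_null_def by (rule free.span_mono) simp

lemma hom_cyclic_null:
  assumes "module_hom fscale fscale g" "free.subspace W"
    and "\<And>x. x \<in> tensor_null R n \<Longrightarrow> g x \<in> W"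
    and "\<And>xs. xs \<in> tuples R n \<Longrightarrow> g (word xs - t_word n xs) \<in> W" and "x \<in> cyclic_null R n"
  shows "g x \<in> W"
proof (rule hom_span[OF assms(1,2) _ assms(5)[unfolded cyclic_null_def]])
  fix y assume "y \<in> multilinear_rels R n \<union> cyclic_rels R n"
  then show "g y \<in> W"
    using assms(3,4) free.span_base[of y "multilinear_rels R n"] by (auto simp: tensor_null_def cyclic_rels_def)
qed

lemma tensor_null_le_chains:
  assumes "closed_carrier R"
  shows "tensor_null R n \<subseteq> chain_space R n"
  unfolding tensor_null_def
proof (rule free.span_minimal)
  show "multilinear_rels R n \<subseteq> chain_space R n"
  proof
    fix r assume "r \<in> multilinear_rels R n"
    then consider
      us x y vs where "us @ x # vs \<in> tuples R n" "y \<in> carrier R"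
        "r = word (us @ (x \<oplus>\<^bsub>R\<^esub> y) # vs) - word (us @ x # vs) - word (us @ y # vs)"
    | us a x vs where "us @ x # vs \<in> tuples R n" "r = word (us @ (a \<odot>\<^bsub>R\<^esub> x) # vs) - fscale a (word (us @ x # vs))"
      unfolding multilinear_rels_def by blast
    then show "r \<in> chain_space R n"
    proof cases
      case 1
      have "x \<in> carrier R" using 1 by (auto simp: tuples_def)
      then show ?thesis using 1 assms tuples_replace[OF 1(1)]
        by (auto simp: closed_carrier_def intro!: free.subspace_diff)
    next
      case 2
      have "x \<in> carrier R" using 2 by (auto simp: tuples_def)
      then show ?thesis using 2 assms tuples_replace[OF 2(1)]
        by (auto simp: closed_carrier_def intro!: free.subspace_diff free.subspace_scale)
    qed
  qed
qed simp

lemma t_tuple: "xs \<in> tuples R n \<Longrightarrow> last xs # butlast xs \<in> tuples R n"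
  by (cases xs rule: rev_cases) (auto simp: tuples_def)

lemma t_word_in_chains: "xs \<in> tuples R n \<Longrightarrow> t_word n xs \<in> chain_space R n"
  unfolding t_word_def using t_tuple by (intro free.subspace_scale) auto

lemma cyclic_null_le_chains:
  assumes "closed_carrier R"
  shows "cyclic_null R n \<subseteq> chain_space R n"
  unfolding cyclic_null_def
proof (rule free.span_minimal)
  have "multilinear_rels R n \<subseteq> chain_space R n"
    using tensor_null_le_chains[OF assms] free.span_superset unfolding tensor_null_def by blast
  moreover have "cyclic_rels R n \<subseteq> chain_space R n"
    by (auto simp: cyclic_rels_def t_word_in_chains intro!: free.subspace_diff)
  ultimately show "multilinear_rels R n \<union> cyclic_rels R n \<subseteq> chain_space R n" by blast
qed simp

lemma slotwise_t: "slotwise R R n n (\<lambda>xs. last xs # butlast xs)"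
proof -
  have t: "last xs # butlast xs = rotate n xs" if "length xs = Suc n" for xs :: "'a list"
  proof (cases xs rule: rev_cases)
    case (snoc ys y)
    then show ?thesis using that rotate_append[of ys "[y]"] by simp
  qed (use that in simp)
  show ?thesis
    unfolding slotwise_def
  proof (intro conjI ballI allI impI)
    show "last xs # butlast xs \<in> tuples R n" if "xs \<in> tuples R n" for xs using t_tuple[OF that] .
    fix us x vs assume *: "us @ x # vs \<in> tuples R n"
    then obtain us' f vs' where "linear_on R R f \<and> (\<forall>z\<in>carrier R. rotate n (us @ z # vs) = us' @ f z # vs')"
      using slotwise_rotate unfolding slotwise_def by meson
    moreover have "last (us @ z # vs) # butlast (us @ z # vs) = rotate n (us @ z # vs)" for z
      by (rule t) (use * in \<open>simp add: tuples_def\<close>)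
    ultimately show "\<exists>us' f vs'. linear_on R R f \<and>
        (\<forall>z\<in>carrier R. last (us @ z # vs) # butlast (us @ z # vs) = us' @ f z # vs')"
      by metis
  qed
qed

lemma lin_ext_fscale: "lin_ext (\<lambda>x. fscale a (g x)) f = fscale a (lin_ext g f)"
  by (simp add: lin_ext_def free.scale_sum_right mult.commute)

lemma lin_ext_t: "lin_ext (t_word n) f = fscale ((-1) ^ n) (word_map (\<lambda>xs. last xs # butlast xs) f)"
  unfolding t_word_def word_map_def lin_ext_fscale ..

lemma t_tensor_null:
  assumes "closed_carrier R" "x \<in> tensor_null R n"
  shows "lin_ext (t_word n) x \<in> tensor_null R n"
  unfolding lin_ext_t using word_map_tensor_null[OF assms(1) slotwise_t assms(2)]
  by (intro free.subspace_scale) auto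

lemma map_t_word: "xs \<noteq> [] \<Longrightarrow> word_map (map f) (t_word n xs) = t_word n (map f xs)"
  by (simp add: t_word_def word_map_linear last_map map_butlast)

lemma word_map_chains:
  assumes "slotwise R S n m L" "x \<in> chain_space R n"
  shows "word_map L x \<in> chain_space S m"
  by (rule hom_chains[OF module_hom_word_map _ _ assms(2)]) (use assms(1) in \<open>auto simp: slotwise_def\<close>)

text \<open>Functoriality of the cyclic coinvariants under maps that are merely linear.  It applies to
  linear projections onto an ideal and to linear sections, which need not be multiplicative.\<close>

lemma map_cyclic_null:
  assumes R: "closed_carrier R" and f: "linear_on R S f" and x: "x \<in> cyclic_null R n"
  shows "word_map (map f) x \<in> cyclic_null S n"
proof (rule hom_cyclic_null[OF module_hom_word_map subspace_cyclic_null _ _ x])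
  show "word_map (map f) y \<in> cyclic_null S n" if "y \<in> tensor_null R n" for y
    using word_map_tensor_null[OF R slotwise_map[OF f] that] tensor_null_le_cyclic_null by blast
  fix xs assume xs: "xs \<in> tuples R n"
  then have "xs \<noteq> []" "map f xs \<in> tuples S n"
    using f by (auto simp: tuples_def linear_on_def)
  then have "word_map (map f) (word xs - t_word n xs) \<in> cyclic_rels S n"
    by (auto simp: word_map_linear map_t_word cyclic_rels_def)
  then show "word_map (map f) (word xs - t_word n xs) \<in> cyclic_null S n"
    using cyclic_rels_le_cyclic_null free.span_base by blast
qed

abbreviation tensor_class :: "('k::field, 'a) module \<Rightarrow> nat \<Rightarrow> ('a list \<Rightarrow>\<^sub>0 'k) \<Rightarrow> ('a list \<Rightarrow>\<^sub>0 'k) set" where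
  "tensor_class R n f \<equiv> tensor_null R n +>\<^bsub>free_space (tuples R n)\<^esub> f"

abbreviation cyclic_class :: "('k::field, 'a) module \<Rightarrow> nat \<Rightarrow> ('a list \<Rightarrow>\<^sub>0 'k) \<Rightarrow> ('a list \<Rightarrow>\<^sub>0 'k) set set" where
  "cyclic_class R n f \<equiv> im_one_minus_t R n +>\<^bsub>hochschild R n\<^esub> tensor_class R n f"

lemma presentation_chains: "presentation (chain_space R n) {0} (\<lambda>f. f) (free_space (tuples R n))"
  unfolding chain_space_def by (rule presentation_free_space)

lemma tensor_null_facts:
  assumes "closed_carrier R"
  shows "free.subspace (tensor_null R n)" "{0} \<subseteq> tensor_null R n" "tensor_null R n \<subseteq> chain_space R n"
  using tensor_null_le_chains[OF assms] free.subspace_0[OF subspace_tensor_null] by auto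

lemma presentation_hochschild:
  assumes "closed_carrier R"
  shows "presentation (chain_space R n) (tensor_null R n) (tensor_class R n) (hochschild R n)"
  using presentation.presentation_quot[OF presentation_chains tensor_null_facts[OF assms]]
  by (simp add: hochschild_def)

lemma hochschild_induced_class:
  assumes "closed_carrier R" "closed_carrier S" and f: "f \<in> chain_space R n"
    and g: "\<And>f. f \<in> chain_space R n \<Longrightarrow> lin_ext g f \<in> chain_space S m" "\<And>f. f \<in> tensor_null R n \<Longrightarrow> lin_ext g f \<in> tensor_null S m"
  shows "hochschild_induced S m g (tensor_class R n f) = tensor_class S m (lin_ext g f)"
  using induced_class[OF presentation_chains presentation_chains tensor_null_facts[OF assms(1)]
    tensor_null_facts[OF assms(2)] _ module_hom_lin_ext g f, of "lin_ext g"]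
  by (simp add: hochschild_induced_def)

lemma t_chains: "f \<in> chain_space R n \<Longrightarrow> lin_ext (t_word n) f \<in> chain_space R n"
  unfolding lin_ext_t using word_map_chains[OF slotwise_t] by (intro free.subspace_scale) auto

lemma one_minus_t_image:
  "cyclic_null R n = {x - lin_ext (t_word n) x + y | x y. x \<in> chain_space R n \<and> y \<in> tensor_null R n}"
proof -
  have hom: "module_hom fscale fscale (\<lambda>x. x - lin_ext (t_word n) x)"
    by unfold_locales (simp_all add: lin_ext_linear free.scale_right_diff_distrib)
  have "cyclic_rels R n = (\<lambda>x. x - lin_ext (t_word n) x) ` word ` tuples R n"
    by (auto simp: cyclic_rels_def image_image)
  then have "free.span (cyclic_rels R n) = (\<lambda>x. x - lin_ext (t_word n) x) ` chain_space R n"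
    by (simp only: module_hom.span_image[OF hom] chains_span)
  then show ?thesis
    unfolding cyclic_null_def Un_commute[of "multilinear_rels R n"] free.span_Un tensor_null_def[symmetric] by auto
qed

lemma im_one_minus_t_eq:
  assumes R: "closed_carrier R"
  shows "im_one_minus_t R n = tensor_class R n ` cyclic_null R n"
proof -
  interpret presentation "chain_space R n" "tensor_null R n" "tensor_class R n" "hochschild R n"
    by (rule presentation_hochschild[OF R])
  have t: "hochschild_t R n (tensor_class R n x) = tensor_class R n (lin_ext (t_word n) x)" if "x \<in> chain_space R n" for x
    unfolding hochschild_t_def
    by (rule hochschild_induced_class[OF R R that t_chains t_tensor_null[OF R]])
  have "im_one_minus_t R n = (\<lambda>x. tensor_class R n (x - lin_ext (t_word n) x)) ` chain_space R n"
    unfolding im_one_minus_t_def carrier_eq image_image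
    by (intro image_cong refl) (simp only: class_diff t_chains t)
  also have "\<dots> = tensor_class R n ` cyclic_null R n"
  proof -
    have "tensor_class R n (x - lin_ext (t_word n) x + y) = tensor_class R n (x - lin_ext (t_word n) x)"
      if "x \<in> chain_space R n" "y \<in> tensor_null R n" for x y
    proof -
      have "x - lin_ext (t_word n) x \<in> chain_space R n" "x - lin_ext (t_word n) x + y \<in> chain_space R n"
        using that K_le t_chains by (auto intro!: free.subspace_diff free.subspace_add)
      then show ?thesis using class_eq that by auto
    qed
    note eq = this
    show ?thesis
    proof
      show "(\<lambda>x. tensor_class R n (x - lin_ext (t_word n) x)) ` chain_space R n \<subseteq> tensor_class R n ` cyclic_null R n"
        unfolding one_minus_t_image using free.subspace_0[OF subspace_K] by (force intro!: imageI)
      show "tensor_class R n ` cyclic_null R n \<subseteq> (\<lambda>x. tensor_class R n (x - lin_ext (t_word n) x)) ` chain_space R n"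
        unfolding one_minus_t_image using eq by auto
    qed
  qed
  finally show ?thesis .
qed

lemma cyclic_null_facts:
  assumes "closed_carrier R"
  shows "free.subspace (cyclic_null R n)" "tensor_null R n \<subseteq> cyclic_null R n" "cyclic_null R n \<subseteq> chain_space R n"
  by (simp_all only: cyclic_null_le_chains[OF assms] tensor_null_le_cyclic_null subspace_cyclic_null)

lemma presentation_CC:
  assumes "closed_carrier R"
  shows "presentation (chain_space R n) (cyclic_null R n) (cyclic_class R n) (CC R n)"
  using presentation.presentation_quot[OF presentation_hochschild[OF assms] cyclic_null_facts[OF assms]]
  by (simp add: CC_def im_one_minus_t_eq[OF assms])

lemma CC_induced_class:
  assumes R: "closed_carrier R" and S: "closed_carrier S" and f: "f \<in> chain_space R n"
    and g: "\<And>f. f \<in> chain_space R n \<Longrightarrow> lin_ext g f \<in> chain_space S m" "\<And>f. f \<in> tensor_null R n \<Longrightarrow> lin_ext g f \<in> tensor_null S m"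
      "\<And>f. f \<in> cyclic_null R n \<Longrightarrow> lin_ext g f \<in> cyclic_null S m"
  shows "induced (hochschild S m) (im_one_minus_t S m) (hochschild_induced S m g) (cyclic_class R n f)
    = cyclic_class S m (lin_ext g f)"
  unfolding im_one_minus_t_eq[OF R] im_one_minus_t_eq[OF S]
  by (rule induced_class[OF presentation_hochschild[OF R] presentation_hochschild[OF S] cyclic_null_facts[OF R]
    cyclic_null_facts[OF S] hochschild_induced_class[OF R S _ g(1,2)] module_hom_lin_ext g(1,3) f])

lemma CC_map_class:
  assumes R: "closed_carrier R" and S: "closed_carrier S" and \<phi>: "linear_on R S \<phi>" and f: "f \<in> chain_space R n"
  shows "CC_map S \<phi> n (cyclic_class R n f) = cyclic_class S n (word_map (map \<phi>) f)"
  unfolding CC_map_def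
  using CC_induced_class[OF R S f, of "\<lambda>xs. word (map \<phi> xs)" n, folded word_map_def]
    word_map_chains[OF slotwise_map[OF \<phi>]] word_map_tensor_null[OF R slotwise_map[OF \<phi>]] map_cyclic_null[OF R \<phi>]
  by auto


section \<open>Contractions of neighbouring letters\<close>

text \<open>The part of the axioms of an algebra that an ideal inherits by restriction.\<close>

locale weak_algebra =
  fixes R :: "('k::field, 'a) module" (structure)
  assumes closed: "closed_carrier R"
    and times_closed: "\<lbrakk>x \<in> carrier R; y \<in> carrier R\<rbrakk> \<Longrightarrow> x \<otimes> y \<in> carrier R"
    and times_assoc: "\<lbrakk>x \<in> carrier R; y \<in> carrier R; z \<in> carrier R\<rbrakk> \<Longrightarrow> (x \<otimes> y) \<otimes> z = x \<otimes> (y \<otimes> z)"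
    and linear_times_right: "y \<in> carrier R \<Longrightarrow> linear_on R R (\<lambda>x. x \<otimes> y)"
    and linear_times_left: "x \<in> carrier R \<Longrightarrow> linear_on R R (\<lambda>y. x \<otimes> y)"

fun contract :: "('k, 'a) module \<Rightarrow> nat \<Rightarrow> 'a list \<Rightarrow> 'a list" where
  "contract R 0 (x # y # r) = (x \<otimes>\<^bsub>R\<^esub> y) # r"
| "contract R (Suc i) (x # r) = x # contract R i r"
| "contract R i xs = xs"

lemma contract_append: "contract R (length us) (us @ x # y # vs) = us @ (x \<otimes>\<^bsub>R\<^esub> y) # vs"
  by (induction us) auto

lemma split_neighbours:
  assumes "Suc i < length xs"
  obtains us x y vs where "xs = us @ x # y # vs" "length us = i"
proof -
  have "xs = take i xs @ xs ! i # xs ! Suc i # drop (i + 2) xs"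
    using assms by (simp add: id_take_nth_drop Cons_nth_drop_Suc)
  moreover have "length (take i xs) = i" using assms by simp
  ultimately show ?thesis using that by blast
qed

lemma length_contract: "Suc i < length xs \<Longrightarrow> length (contract R i xs) = length xs - 1"
  by (erule split_neighbours) (auto simp: contract_append)

lemma rotate_contract:
  assumes "Suc i < length xs"
  shows "rotate i (contract R i xs) = contract R 0 (rotate i xs)"
proof -
  obtain us x y vs where xs: "xs = us @ x # y # vs" "length us = i"
    using split_neighbours[OF assms] .
  show ?thesis
    using rotate_append[of us] by (simp add: xs(1) contract_append xs(2)[symmetric])
qed

lemma contract_eq_take_drop:
  assumes "Suc i < length xs"
  shows "take i xs @ (xs ! i \<otimes>\<^bsub>R\<^esub> xs ! Suc i) # drop (i + 2) xs = contract R i xs"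
proof -
  obtain us x y vs where xs: "xs = us @ x # y # vs" "length us = i"
    using split_neighbours[OF assms] .
  show ?thesis by (simp add: xs(1) contract_append xs(2)[symmetric] nth_append)
qed

text \<open>The part of the Hochschild differential that does not multiply across the ends of a word:
  the differential of the bar complex.\<close>

definition bar_word :: "('k::field, 'a) module \<Rightarrow> 'a list \<Rightarrow> ('a list \<Rightarrow>\<^sub>0 'k)" where
  "bar_word R xs = (\<Sum>i<length xs - 1. fscale ((-1) ^ i) (word (contract R i xs)))"

lemma rotate_last: "length xs = Suc n \<Longrightarrow> rotate n xs = last xs # butlast xs"
proof (cases xs rule: rev_cases)
  case (snoc ys y)
  moreover assume "length xs = Suc n"
  ultimately show ?thesis using rotate_append[of ys "[y]"] by simp
qed simp

lemma b_word_eq: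
  assumes "length xs = Suc n" "0 < n"
  shows "b_word R n xs = bar_word R xs + fscale ((-1) ^ n) (word (contract R 0 (rotate n xs)))"
proof -
  have "(last xs \<otimes>\<^bsub>R\<^esub> hd xs) # butlast (tl xs) = contract R 0 (rotate n xs)"
    using assms unfolding rotate_last[OF assms(1)] by (cases xs) auto
  moreover have "(\<Sum>i<n. fscale ((-1) ^ i) (word (take i xs @ (xs ! i \<otimes>\<^bsub>R\<^esub> xs ! Suc i) # drop (i + 2) xs)))
      = bar_word R xs"
    unfolding bar_word_def using assms(1)
    by (intro sum.cong) (simp_all del: add_2_eq_Suc' add: contract_eq_take_drop)
  ultimately show ?thesis using assms(2) by (simp add: b_word_def)
qed

lemma bar_word_simps:
  "bar_word R [] = 0" "bar_word R [x] = 0"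
  "bar_word R (x # y # r) = word ((x \<otimes>\<^bsub>R\<^esub> y) # r) - word_map (Cons x) (bar_word R (y # r))"
proof -
  show "bar_word R (x # y # r) = word ((x \<otimes>\<^bsub>R\<^esub> y) # r) - word_map (Cons x) (bar_word R (y # r))"
    unfolding bar_word_def
    by (simp add: sum.lessThan_Suc_shift word_map_linear sum_negf del: sum.lessThan_Suc)
qed (simp_all add: bar_word_def)

lemma tuples_Cons: "x # xs \<in> tuples R (Suc n) \<longleftrightarrow> x \<in> carrier R \<and> xs \<in> tuples R n"
  by (auto simp: tuples_def)

context weak_algebra
begin

lemma contract_tuples:
  assumes "i < n" "xs \<in> tuples R n"
  shows "contract R i xs \<in> tuples R (n - 1)"
proof -
  have "Suc i < length xs" using assms by (simp add: tuples_def)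
  then obtain us x y vs where xs: "xs = us @ x # y # vs" "length us = i"
    by (rule split_neighbours)
  have "contract R i xs = us @ (x \<otimes> y) # vs" using contract_append xs by metis
  then show ?thesis using assms xs times_closed by (auto simp: tuples_def)
qed

lemma slotwise_contract: "i < n \<Longrightarrow> slotwise R R n (n - 1) (contract R i)"
proof (induction i arbitrary: n)
  case 0
  show ?case
    unfolding slotwise_def
  proof (intro conjI ballI allI impI)
    show "contract R 0 xs \<in> tuples R (n - 1)" if "xs \<in> tuples R n" for xs
      by (rule contract_tuples[OF 0 that])
    fix us x vs assume *: "us @ x # vs \<in> tuples R n"
    consider (first) v vs' where "us = []" "vs = v # vs'" | (second) u where "us = [u]"
      | (later) u u' us' where "us = u # u' # us'"
    proof (cases us)
      case Nil
      then show ?thesis using * 0 that(1) by (cases vs) (auto simp: tuples_def)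
    next
      case (Cons u us')
      then show ?thesis using that by (cases us') auto
    qed
    then show "\<exists>us' f vs'. linear_on R R f \<and> (\<forall>z\<in>carrier R. contract R 0 (us @ z # vs) = us' @ f z # vs')"
    proof cases
      case first
      then have "linear_on R R (\<lambda>z. z \<otimes> v)" using * linear_times_right by (simp add: tuples_def)
      moreover have "contract R 0 (us @ z # vs) = [] @ (z \<otimes> v) # vs'" for z using first by simp
      ultimately show ?thesis by blast
    next
      case second
      then have "linear_on R R (\<lambda>z. u \<otimes> z)" using * linear_times_left by (simp add: tuples_def)
      moreover have "contract R 0 (us @ z # vs) = [] @ (u \<otimes> z) # vs" for z using second by simp
      ultimately show ?thesis by blast
    next
      case later
      then have "contract R 0 (us @ z # vs) = ((u \<otimes> u') # us') @ z # vs" for z by simp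
      then show ?thesis using linear_on_ident by blast
    qed
  qed
next
  case (Suc i)
  obtain m where n: "n = Suc m" "i < m" using Suc(2) by (cases n) auto
  note IH = Suc(1)[OF n(2)]
  show ?case
    unfolding slotwise_def
  proof (intro conjI ballI allI impI)
    show "contract R (Suc i) xs \<in> tuples R (n - 1)" if "xs \<in> tuples R n" for xs
      by (rule contract_tuples[OF Suc(2) that])
    fix us x vs assume *: "us @ x # vs \<in> tuples R n"
    show "\<exists>us' f vs'. linear_on R R f \<and> (\<forall>z\<in>carrier R. contract R (Suc i) (us @ z # vs) = us' @ f z # vs')"
    proof (cases us)
      case Nil
      then have "contract R (Suc i) (us @ z # vs) = [] @ z # contract R i vs" for z by simp
      then show ?thesis using linear_on_ident by blast
    next
      case (Cons u us')
      then have "us' @ x # vs \<in> tuples R m" using * n by (simp add: tuples_Cons)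
      then obtain us'' f vs'' where "linear_on R R f" "\<forall>z\<in>carrier R. contract R i (us' @ z # vs) = us'' @ f z # vs''"
        using IH unfolding slotwise_def by meson
      then have "linear_on R R f \<and> (\<forall>z\<in>carrier R. contract R (Suc i) (us @ z # vs) = (u # us'') @ f z # vs'')"
        using Cons by simp
      then show ?thesis by blast
    qed
  qed
qed

end


section \<open>The cyclic norm\<close>

text \<open>The sum of all powers of the cyclic operator.  The powers of its inverse are used, since they
  rotate a word to the left.\<close>

definition norm_word :: "'a list \<Rightarrow> ('a list \<Rightarrow>\<^sub>0 'k::field)" where
  "norm_word xs = (\<Sum>k<length xs. fscale ((-1) ^ ((length xs - 1) * k)) (word (rotate k xs)))"

lemma sign_eq: "even (m + m') \<Longrightarrow> (-1 :: 'k::ring_1) ^ m = (-1) ^ m'"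
  by (auto simp: minus_one_power_iff)

lemma sum_periodic_shift:
  fixes g :: "nat \<Rightarrow> 'v::ab_group_add"
  assumes "\<And>k. g (k + N) = g k"
  shows "(\<Sum>k<N. g (k + i)) = (\<Sum>k<N. g k)"
proof (induction i)
  case (Suc i)
  have "(\<Sum>k<N. g (k + Suc i)) + g i = (\<Sum>k<Suc N. g (k + i))"
    by (subst sum.lessThan_Suc_shift) (simp add: add.commute)
  also have "\<dots> = (\<Sum>k<N. g (k + i)) + g i"
    using assms[of i] by (simp add: add.commute)
  finally show ?case using Suc by simp
qed simp

lemma rotate_period: "rotate (k + length xs) xs = rotate k xs"
  using rotate_rotate[of k "length xs" xs] by simp

lemma norm_word_rotate:
  "norm_word (rotate i xs) = fscale ((-1) ^ ((length xs - 1) * i)) (norm_word xs)"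
proof (cases "xs = []")
  case False
  then obtain n where n: "length xs = Suc n" by (cases xs) auto
  define g where "g = (\<lambda>k. fscale ((-1) ^ (n * k)) (word (rotate k xs)) :: 'a list \<Rightarrow>\<^sub>0 'b)"
  have "g (k + Suc n) = g k" for k
  proof -
    have "(-1 :: 'b) ^ (n * (k + Suc n)) = (-1) ^ (n * k)" by (rule sign_eq) (cases "even n"; cases "even k"; simp)
    then show ?thesis using rotate_period[of k xs] by (simp add: g_def n)
  qed
  then have "(\<Sum>k<Suc n. g (k + i)) = (\<Sum>k<Suc n. g k)" by (rule sum_periodic_shift)
  moreover have "norm_word (rotate i xs) = (\<Sum>k<Suc n. fscale ((-1) ^ (n * i)) (g (k + i)))"
  proof -
    have "(-1 :: 'b) ^ (n * i) * (-1) ^ (n * (k + i)) = (-1) ^ (n * k)" for k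
      unfolding power_add[symmetric] by (rule sign_eq) (cases "even n"; cases "even k"; simp)
    then show ?thesis by (simp add: norm_word_def n g_def rotate_rotate)
  qed
  ultimately have "norm_word (rotate i xs) = fscale ((-1) ^ (n * i)) (\<Sum>k<Suc n. g k)"
    by (simp only: free.scale_sum_right[symmetric])
  then show ?thesis
    by (simp add: norm_word_def n g_def del: sum.lessThan_Suc)
qed (simp add: norm_word_def)

lemma norm_one_minus_t:
  fixes xs :: "'a list"
  assumes "length xs = Suc n"
  shows "lin_ext norm_word (word xs - t_word n xs :: 'a list \<Rightarrow>\<^sub>0 'k::field) = 0"
proof -
  have "norm_word (last xs # butlast xs) = fscale ((-1) ^ (n * n)) (norm_word xs :: 'a list \<Rightarrow>\<^sub>0 'k)"
    using norm_word_rotate[of n xs] assms by (simp add: rotate_last)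
  moreover have "(-1 :: 'k) ^ n * (-1) ^ (n * n) = (-1) ^ (0::nat)"
    unfolding power_add[symmetric] by (rule sign_eq) (cases "even n"; simp)
  ultimately show ?thesis
    by (simp add: lin_ext_linear t_word_def)
qed

text \<open>With \<open>t\<close> the cyclic operator and \<open>d\<^sub>0\<close> the product of the first two letters, both sides equal
  \<open>N d\<^sub>0 N\<close>, because the \<open>i\<close>-th term of either differential is a conjugate of \<open>d\<^sub>0\<close> by \<open>t\<^sup>i\<close>:
  next to \<open>N\<close> the powers of \<open>t\<close> are absorbed, and on the other side of \<open>d\<^sub>0\<close> they add up to \<open>N\<close>.\<close>

lemma norm_b_eq_bar_norm:
  assumes len: "length xs = Suc n" and "0 < n"
  shows "lin_ext norm_word (b_word R n xs) = lin_ext (bar_word R) (norm_word xs)"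
proof -
  \<comment> \<open>The terms of \<open>N d\<^sub>0 N\<close> and of \<open>b' N\<close>.  They match by \<open>G i k = H (n - i) (k + i)\<close>, with \<open>k + i\<close> read modulo \<open>n + 1\<close>.\<close>
  define H where "H = (\<lambda>l k. fscale ((-1) ^ (n * k + (n - 1) * l)) (word (rotate l (contract R 0 (rotate k xs)))) :: 'a list \<Rightarrow>\<^sub>0 'b)"
  define G where "G = (\<lambda>i k. fscale ((-1) ^ (n * k + i)) (word (contract R i (rotate k xs))) :: 'a list \<Rightarrow>\<^sub>0 'b)"
  have len_contract: "length (contract R i (rotate k xs)) = n" if "i < n" for i k
    using length_contract[of i "rotate k xs" R] that len by simp
  have norm_contract: "fscale ((-1) ^ (n * k)) (norm_word (contract R 0 (rotate k xs))) = (\<Sum>l<n. H l k)" for k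
    using len_contract[of 0 k] \<open>0 < n\<close> by (simp add: norm_word_def H_def free.scale_sum_right power_add)
  have "lin_ext norm_word (b_word R n xs) = (\<Sum>k<Suc n. \<Sum>l<n. H l k)"
  proof -
    have "fscale ((-1) ^ i) (norm_word (contract R i xs)) = (\<Sum>l<n. H l i)" if "i < n" for i
    proof -
      have "norm_word (contract R 0 (rotate i xs)) = fscale ((-1) ^ ((n - 1) * i)) (norm_word (contract R i xs) :: 'a list \<Rightarrow>\<^sub>0 'b)"
        using norm_word_rotate[of i "contract R i xs"] rotate_contract[of i xs R] that len len_contract[OF that, of 0] by simp
      moreover have "(-1 :: 'b) ^ (n * i) * (-1) ^ ((n - 1) * i) = (-1) ^ i"
        unfolding power_add[symmetric] by (rule sign_eq) (use \<open>0 < n\<close> in \<open>cases n; simp add: algebra_simps\<close>)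
      ultimately show ?thesis using norm_contract[of i] by simp
    qed
    moreover have "fscale ((-1) ^ n) (norm_word (contract R 0 (rotate n xs))) = (\<Sum>l<n. H l n)"
    proof -
      have "(-1 :: 'b) ^ (n * n) = (-1) ^ n" by (rule sign_eq) simp
      then show ?thesis using norm_contract[of n] by simp
    qed
    ultimately show ?thesis
      using len by (simp add: b_word_eq[OF len \<open>0 < n\<close>] bar_word_def lin_ext_linear)
  qed
  also have "\<dots> = (\<Sum>k<Suc n. \<Sum>i<n. H (n - i) k)"
  proof (rule sum.cong[OF refl])
    fix k
    have "H n k = H 0 k"
    proof -
      have "rotate n (contract R 0 (rotate k xs)) = contract R 0 (rotate k xs)"
        by (rule rotate_id) (use len_contract[of 0 k] \<open>0 < n\<close> in simp)
      moreover have "(-1 :: 'b) ^ (n * k + (n - 1) * n) = (-1) ^ (n * k + (n - 1) * 0)"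
        by (rule sign_eq) (use \<open>0 < n\<close> in \<open>cases "even n"; cases "even k"; simp\<close>)
      ultimately show ?thesis unfolding H_def by simp
    qed
    moreover have "(\<Sum>i<n. H (n - i) k) = (\<Sum>i<n. H (Suc i) k)"
    proof -
      have "(\<Sum>i<n. H (n - i) k) = (\<Sum>i<n. H (Suc (n - Suc i)) k)"
        by (intro sum.cong) (auto simp: Suc_diff_Suc)
      then show ?thesis by (simp add: sum.nat_diff_reindex[of "\<lambda>i. H (Suc i) k"])
    qed
    moreover have "H 0 k + (\<Sum>i<n. H (Suc i) k) = (\<Sum>i<n. H i k) + H n k"
      using sum.lessThan_Suc_shift[of "\<lambda>i. H i k" n] by simp
    ultimately show "(\<Sum>l<n. H l k) = (\<Sum>i<n. H (n - i) k)" by simp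
  qed
  also have "\<dots> = (\<Sum>i<n. \<Sum>k<Suc n. H (n - i) k)" by (rule sum.swap)
  also have "\<dots> = (\<Sum>i<n. \<Sum>k<Suc n. H (n - i) (k + i))"
  proof (rule sum.cong[OF refl], rule sum_periodic_shift[symmetric])
    fix i k
    have "(-1 :: 'b) ^ (n * (k + Suc n) + (n - 1) * (n - i)) = (-1) ^ (n * k + (n - 1) * (n - i))"
      by (rule sign_eq) (cases "even n"; cases "even k"; simp)
    then show "H (n - i) (k + Suc n) = H (n - i) k"
      using rotate_period[of k xs] len by (simp add: H_def)
  qed
  also have "\<dots> = (\<Sum>i<n. \<Sum>k<Suc n. G i k)"
  proof (intro sum.cong refl)
    fix i k assume "i \<in> {..<n}"
    then have i: "i < n" by simp
    have "rotate (n - i) (contract R 0 (rotate (k + i) xs)) = contract R i (rotate k xs)"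
    proof -
      have "contract R 0 (rotate (k + i) xs) = rotate i (contract R i (rotate k xs))"
        using rotate_contract[of i "rotate k xs" R] i len by (simp add: rotate_rotate add.commute)
      then show ?thesis using i len_contract[OF i, of k] by (simp add: rotate_rotate)
    qed
    moreover have "(-1 :: 'b) ^ (n * (k + i) + (n - 1) * (n - i)) = (-1) ^ (n * k + i)"
    proof -
      obtain j where j: "n = Suc j" using i by (cases n) auto
      obtain d where d: "n = i + d" using i less_imp_add_positive by blast
      have "even (n * (k + i) + (n - 1) * (n - i) + (n * k + i))"
        using j d by (cases "even i"; cases "even d"; cases "even k") (auto simp: j)
      then show ?thesis by (rule sign_eq)
    qed
    ultimately show "H (n - i) (k + i) = G i k" by (simp add: H_def G_def)
  qed
  also have "\<dots> = (\<Sum>k<Suc n. \<Sum>i<n. G i k)" by (rule sum.swap)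
  also have "\<dots> = lin_ext (bar_word R) (norm_word xs)"
  proof -
    have "fscale ((-1) ^ (n * k)) (bar_word R (rotate k xs)) = (\<Sum>i<n. G i k)" for k
      using len by (simp add: bar_word_def free.scale_sum_right G_def power_add)
    then show ?thesis using len by (simp add: norm_word_def lin_ext_linear)
  qed
  finally show ?thesis .
qed

lemma rotate_tuples: "xs \<in> tuples R n \<Longrightarrow> rotate k xs \<in> tuples R n"
  by (auto simp: tuples_def)

lemma rotate_cyclic:
  fixes R :: "('k::field, 'a) module"
  assumes "xs \<in> tuples R n"
  shows "word xs - fscale ((-1) ^ (n * k)) (word (rotate k xs)) \<in> free.span (cyclic_rels R n)"
proof (induction k)
  case (Suc k)
  define ys zs where "ys = rotate k xs" and "zs = rotate1 ys"
  have ys: "ys \<in> tuples R n" and zs: "zs \<in> tuples R n"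
    using assms rotate_tuples[of xs R n "Suc k"] rotate_tuples[of xs R n k] by (simp_all add: ys_def zs_def)
  have "last zs # butlast zs = ys"
    using ys by (cases ys) (auto simp: zs_def tuples_def)
  then have "word zs - fscale ((-1) ^ n) (word ys) \<in> free.span (cyclic_rels R n)"
    using zs by (intro free.span_base) (auto simp: cyclic_rels_def t_word_def)
  then have "fscale ((-1) ^ (n * k + n)) (word zs - fscale ((-1) ^ n) (word ys)) \<in> free.span (cyclic_rels R n)"
    by (rule free.span_scale)
  moreover have "(-1 :: 'k) ^ (n * k + n) * (-1) ^ n = (-1) ^ (n * k)"
    unfolding power_add[symmetric] by (rule sign_eq) (cases "even n"; cases "even k"; simp)
  ultimately have "fscale ((-1) ^ (n * k + n)) (word zs) - fscale ((-1) ^ (n * k)) (word ys) \<in> free.span (cyclic_rels R n)"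
    by (simp add: free.scale_right_diff_distrib)
  from free.span_diff[OF Suc this] show ?case
    by (simp add: ys_def zs_def add.commute)
qed (simp add: free.span_zero)

lemma norm_average:
  fixes R :: "('k::field, 'a) module"
  assumes "x \<in> chain_space R n"
  shows "fscale (of_nat (Suc n)) x - lin_ext norm_word x \<in> free.span (cyclic_rels R n)"
proof (rule hom_chains[OF _ _ _ assms])
  show "module_hom fscale fscale (\<lambda>x. fscale (of_nat (Suc n)) x - lin_ext norm_word x)"
    by unfold_locales (simp_all add: lin_ext_linear free.scale_right_diff_distrib free.scale_right_distrib mult.commute)
  fix xs assume xs: "xs \<in> tuples R n"
  have "fscale (of_nat (Suc n)) (word xs) - lin_ext norm_word (word xs)
      = (\<Sum>k<Suc n. word xs - fscale ((-1) ^ (n * k)) (word (rotate k xs)))"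
    using xs by (simp add: norm_word_def tuples_def sum_subtractf free.sum_constant_scale del: sum.lessThan_Suc)
  also have "\<dots> \<in> free.span (cyclic_rels R n)"
    using rotate_cyclic[OF xs] by (intro free.span_sum) blast
  finally show "fscale (of_nat (Suc n)) (word xs) - lin_ext norm_word (word xs) \<in> free.span (cyclic_rels R n)" .
qed simp

text \<open>In characteristic zero the norm detects the relations of the cyclic coinvariants.  Together
  with \<open>N b = b' N\<close>, this reduces statements on \<open>b\<close> modulo these relations to the bar differential.\<close>

lemma norm_zero_imp_cyclic:
  fixes R :: "('k::field_char_0, 'a) module"
  assumes "x \<in> chain_space R n" "lin_ext norm_word x = 0"
  shows "x \<in> cyclic_null R n"
proof -
  have "fscale (of_nat (Suc n)) x \<in> free.span (cyclic_rels R n)"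
    using norm_average[OF assms(1)] assms(2) by simp
  then have "fscale (inverse (of_nat (Suc n))) (fscale (of_nat (Suc n)) x) \<in> free.span (cyclic_rels R n)"
    by (rule free.span_scale)
  moreover have "inverse (of_nat (Suc n)) * of_nat (Suc n) = (1 :: 'k)" by (rule left_inverse) (rule of_nat_neq_0)
  ultimately have "x \<in> free.span (cyclic_rels R n)" by (simp del: of_nat_Suc)
  then show ?thesis using cyclic_rels_le_cyclic_null by blast
qed

lemma norm_eq_rotations:
  assumes "x \<in> chain_space R n"
  shows "lin_ext norm_word x = (\<Sum>k<Suc n. fscale ((-1) ^ (n * k)) (word_map (rotate k) x))"
proof (rule hom_eq_on_chains[OF module_hom_lin_ext _ _ assms])
  show "module_hom fscale fscale (\<lambda>x. \<Sum>k<Suc n. fscale ((-1) ^ (n * k)) (word_map (rotate k) x))"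
    by unfold_locales (simp_all add: word_map_linear free.scale_right_distrib sum.distrib free.scale_sum_right mult.commute del: sum.lessThan_Suc)
qed (simp add: norm_word_def tuples_def del: sum.lessThan_Suc)

lemma norm_tensor_null:
  assumes "closed_carrier R" "x \<in> tensor_null R n"
  shows "lin_ext norm_word x \<in> tensor_null R n"
proof -
  have "x \<in> chain_space R n" using assms tensor_null_le_chains by blast
  then show ?thesis
    using word_map_tensor_null[OF assms(1) slotwise_rotate assms(2)]
    by (simp only: norm_eq_rotations) (intro free.subspace_sum free.subspace_scale; simp)
qed

lemma norm_chains:
  assumes "x \<in> chain_space R n"
  shows "lin_ext norm_word x \<in> chain_space R n"
  using word_map_chains[OF slotwise_rotate assms]
  by (simp only: norm_eq_rotations[OF assms]) (intro free.subspace_sum free.subspace_scale; simp)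


section \<open>The Hochschild differential on the cyclic coinvariants\<close>

lemma word_map_comp:
  fixes f :: "'a list \<Rightarrow>\<^sub>0 'k::field"
  shows "word_map L (word_map L' f) = word_map (\<lambda>xs. L (L' xs)) f"
proof (rule hom_eq_on_span[where S = "(word :: _ \<Rightarrow> 'a list \<Rightarrow>\<^sub>0 'k) ` UNIV"])
  show "module_hom fscale fscale (\<lambda>f. word_map L (word_map L' f))"
    by unfold_locales (simp_all add: word_map_linear)
  show "f \<in> free.span (word ` UNIV)" by (simp add: span_singles)
qed (use module_hom_word_map in auto)

context weak_algebra
begin

lemma bar_word_chains: "xs \<in> tuples R (Suc n) \<Longrightarrow> bar_word R xs \<in> chain_space R n"
  unfolding bar_word_def
  using contract_tuples[of _ "Suc n" xs]
  by (intro free.subspace_sum free.subspace_scale) (auto simp: tuples_def)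

text \<open>By induction on the word.  Contracting \<open>x # w\<close> first at its head and then in \<open>w\<close>, or in the other order,
  gives terms that cancel; the two ways to multiply its first three letters agree by associativity.\<close>

lemma bar_bar_word:
  assumes "set xs \<subseteq> carrier R"
  shows "lin_ext (bar_word R) (bar_word R xs) = 0"
  using assms
proof (induction xs rule: induct_list012)
  case (3 x y r)
  define mulx :: "'a list \<Rightarrow> 'a list" where "mulx = (\<lambda>zs. (x \<otimes> hd zs) # tl zs)"
  show ?case
  proof (cases r)
    case Nil
    then show ?thesis by (simp add: bar_word_simps word_map_linear)
  next
    case (Cons z s)
    have "y # r \<in> tuples R (Suc (length s))" using 3(3) Cons by (auto simp: tuples_def)
    then have mem: "bar_word R (y # r) \<in> chain_space R (length s)" by (rule bar_word_chains)
    have "lin_ext (bar_word R) (word_map (Cons x) (bar_word R (y # r)))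
        = word_map mulx (bar_word R (y # r)) - word_map (Cons x) (lin_ext (bar_word R) (bar_word R (y # r)))"
    proof (rule hom_eq_on_chains[OF _ _ _ mem])
      show "module_hom fscale fscale (\<lambda>f. lin_ext (bar_word R) (word_map (Cons x) f))"
        by unfold_locales (simp_all add: lin_ext_linear word_map_linear)
      show "module_hom fscale fscale (\<lambda>f. word_map mulx f - word_map (Cons x) (lin_ext (bar_word R) f))"
        by unfold_locales (simp_all add: lin_ext_linear word_map_linear free.scale_right_diff_distrib)
      fix zs assume "zs \<in> tuples R (length s)"
      then show "lin_ext (bar_word R) (word_map (Cons x) (word zs))
          = word_map mulx (word zs) - word_map (Cons x) (lin_ext (bar_word R) (word zs))"
        by (cases zs) (auto simp: tuples_def bar_word_simps mulx_def)
    qed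
    moreover have "word_map mulx (bar_word R (y # r)) = bar_word R ((x \<otimes> y) # r)"
      using 3(3) by (simp add: Cons bar_word_simps word_map_linear word_map_comp mulx_def times_assoc)
    ultimately show ?thesis
      using 3 by (simp add: bar_word_simps lin_ext_linear word_map_linear)
  qed
qed (simp_all add: bar_word_simps)

lemma b_word_chains:
  assumes "xs \<in> tuples R n"
  shows "b_word R n xs \<in> chain_space R (n - 1)"
proof (cases n)
  case 0
  then show ?thesis using free.subspace_0[OF subspace_chain_space] by (simp add: b_word_def)
next
  case (Suc m)
  have "contract R 0 (rotate n xs) \<in> tuples R m"
    using contract_tuples[OF _ rotate_tuples[OF assms, of n], of 0] Suc by (simp del: rotate_Suc)
  then show ?thesis
    using assms Suc bar_word_chains[of xs m]
    by (subst b_word_eq) (simp_all add: tuples_def free.subspace_add free.subspace_scale del: rotate_Suc power_Suc)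
qed

lemma b_chains: "x \<in> chain_space R n \<Longrightarrow> lin_ext (b_word R n) x \<in> chain_space R (n - 1)"
  by (rule hom_chains[OF module_hom_lin_ext]) (use b_word_chains in auto)

lemma b_zero: "lin_ext (b_word R 0) x = 0"
  by (simp add: lin_ext_def b_word_def)

lemma b_eq_contractions:
  assumes "x \<in> chain_space R (Suc n)"
  shows "lin_ext (b_word R (Suc n)) x
    = (\<Sum>i<Suc n. fscale ((-1) ^ i) (word_map (contract R i) x))
      + fscale ((-1) ^ Suc n) (word_map (\<lambda>xs. contract R 0 (rotate (Suc n) xs)) x)"
proof (rule hom_eq_on_chains[OF module_hom_lin_ext _ _ assms])
  show "module_hom fscale fscale (\<lambda>x. (\<Sum>i<Suc n. fscale ((-1) ^ i) (word_map (contract R i) x))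
      + fscale ((-1) ^ Suc n) (word_map (\<lambda>xs. contract R 0 (rotate (Suc n) xs)) x))"
    by unfold_locales (simp_all add: word_map_linear free.scale_right_distrib sum.distrib
        free.scale_sum_right mult.commute del: sum.lessThan_Suc rotate_Suc power_Suc)
  fix xs assume "xs \<in> tuples R (Suc n)"
  then have "length xs = Suc (Suc n)" by (simp add: tuples_def)
  then show "lin_ext (b_word R (Suc n)) (word xs)
    = (\<Sum>i<Suc n. fscale ((-1) ^ i) (word_map (contract R i) (word xs)))
      + fscale ((-1) ^ Suc n) (word_map (\<lambda>xs. contract R 0 (rotate (Suc n) xs)) (word xs))"
    by (simp add: b_word_eq bar_word_def del: sum.lessThan_Suc rotate_Suc power_Suc)
qed

lemma b_tensor_null:
  assumes "x \<in> tensor_null R n"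
  shows "lin_ext (b_word R n) x \<in> tensor_null R (n - 1)"
proof (cases n)
  case 0
  then show ?thesis using free.subspace_0[OF subspace_tensor_null] by (simp add: b_zero)
next
  case (Suc m)
  have "x \<in> chain_space R (Suc m)" using assms tensor_null_le_chains[OF closed] Suc by blast
  moreover have "word_map (contract R i) x \<in> tensor_null R m" if "i < Suc m" for i
    using word_map_tensor_null[OF closed slotwise_contract assms] that Suc by simp
  moreover have "word_map (\<lambda>xs. contract R 0 (rotate (Suc m) xs)) x \<in> tensor_null R m"
    using word_map_tensor_null[OF closed slotwise_comp[OF slotwise_rotate slotwise_contract[of 0 n]] assms] Suc
    by (simp del: rotate_Suc)
  ultimately show ?thesis
    unfolding Suc by (simp only: b_eq_contractions diff_Suc_1)
      (intro free.subspace_add free.subspace_sum free.subspace_scale; simp)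
qed

lemma norm_b:
  assumes "x \<in> chain_space R (Suc n)"
  shows "lin_ext norm_word (lin_ext (b_word R (Suc n)) x) = lin_ext (bar_word R) (lin_ext norm_word x)"
proof (rule hom_eq_on_chains[OF _ _ _ assms])
  show "module_hom fscale fscale (\<lambda>x. lin_ext norm_word (lin_ext (b_word R (Suc n)) x))"
    "module_hom fscale fscale (\<lambda>x. lin_ext (bar_word R) (lin_ext norm_word x))"
    by (unfold_locales; simp add: lin_ext_linear)+
qed (simp add: norm_b_eq_bar_norm tuples_def)

lemma bar_bar:
  assumes "x \<in> chain_space R n"
  shows "lin_ext (bar_word R) (lin_ext (bar_word R) x) = 0"
proof (rule hom_eq_on_chains[where h = "\<lambda>_. 0", OF _ _ _ assms])
  show "module_hom fscale fscale (\<lambda>x. lin_ext (bar_word R) (lin_ext (bar_word R) x))"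
    "module_hom fscale fscale (\<lambda>_. 0)"
    by (unfold_locales; simp add: lin_ext_linear)+
qed (simp add: bar_bar_word tuples_def)

end

locale weak_algebra_char_0 = weak_algebra R for R :: "('k::field_char_0, 'a) module" (structure)
begin

lemma b_cyclic_null:
  assumes "x \<in> cyclic_null R n"
  shows "lin_ext (b_word R n) x \<in> cyclic_null R (n - 1)"
proof (cases n)
  case 0
  then show ?thesis using free.subspace_0[OF subspace_cyclic_null] by (simp add: b_zero)
next
  case (Suc m)
  show ?thesis
  proof (rule hom_cyclic_null[OF module_hom_lin_ext subspace_cyclic_null _ _ assms])
    show "lin_ext (b_word R n) y \<in> cyclic_null R (n - 1)" if "y \<in> tensor_null R n" for y
      using b_tensor_null[OF that] tensor_null_le_cyclic_null by blast
    fix xs assume xs: "xs \<in> tuples R n"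
    then have mem: "word xs - t_word n xs \<in> chain_space R n"
      by (intro free.subspace_diff) (simp_all add: t_word_in_chains)
    show "lin_ext (b_word R n) (word xs - t_word n xs) \<in> cyclic_null R (n - 1)"
    proof (rule norm_zero_imp_cyclic[OF b_chains[OF mem]])
      have "lin_ext norm_word (word xs - t_word n xs :: 'a list \<Rightarrow>\<^sub>0 'k) = 0"
        using xs by (intro norm_one_minus_t) (simp add: tuples_def)
      then show "lin_ext norm_word (lin_ext (b_word R n) (word xs - t_word n xs)) = 0"
        using norm_b[of "word xs - t_word n xs" m] mem Suc by simp
    qed
  qed
qed

lemma b_b_cyclic_null:
  assumes x: "x \<in> chain_space R n"
  shows "lin_ext (b_word R (n - 1)) (lin_ext (b_word R n) x) \<in> cyclic_null R (n - 1 - 1)"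
proof (cases "n < 2")
  case True
  then have "n - 1 = 0" by simp
  then show ?thesis using free.subspace_0[OF subspace_cyclic_null] by (simp add: b_zero)
next
  case False
  define m where "m = n - 2"
  have n: "n = Suc (Suc m)" using False by (simp add: m_def)
  have b: "lin_ext (b_word R n) x \<in> chain_space R (Suc m)" using b_chains[OF x] n by simp
  show ?thesis
  proof (rule norm_zero_imp_cyclic)
    show "lin_ext (b_word R (n - 1)) (lin_ext (b_word R n) x) \<in> chain_space R (n - 1 - 1)"
      by (intro b_chains x)
    have "lin_ext norm_word (lin_ext (b_word R (Suc m)) (lin_ext (b_word R n) x))
        = lin_ext (bar_word R) (lin_ext norm_word (lin_ext (b_word R n) x))"
      by (rule norm_b[OF b])
    also have "\<dots> = lin_ext (bar_word R) (lin_ext (bar_word R) (lin_ext norm_word x))"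
      using norm_b[of x "Suc m"] x n by simp
    also have "\<dots> = 0" by (rule bar_bar[OF norm_chains[OF x]])
    finally show "lin_ext norm_word (lin_ext (b_word R (n - 1)) (lin_ext (b_word R n) x)) = 0" by (simp add: n)
  qed
qed

lemma CC_b_class:
  assumes "f \<in> chain_space R n"
  shows "CC_b R n (cyclic_class R n f) = cyclic_class R (n - 1) (lin_ext (b_word R n) f)"
  unfolding CC_b_def hochschild_b_def
  by (rule CC_induced_class[OF closed closed assms b_chains b_tensor_null b_cyclic_null])

end


section \<open>The filtration by the number of letters outside the ideal\<close>

definition map_hd :: "('a \<Rightarrow> 'a) \<Rightarrow> 'a list \<Rightarrow> 'a list" where
  "map_hd f xs = (case xs of [] \<Rightarrow> [] | x # r \<Rightarrow> f x # r)"

fun map_last :: "('a \<Rightarrow> 'a) \<Rightarrow> 'a list \<Rightarrow> 'a list" where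
  "map_last f [] = []"
| "map_last f [x] = [f x]"
| "map_last f (x # y # r) = x # map_last f (y # r)"

lemma map_hd_simps [simp]: "map_hd f (x # r) = f x # r"
  by (simp add: map_hd_def)

lemma map_last_append: "map_last f (us @ y # vs) = us @ map_last f (y # vs)"
proof (induction us)
  case (Cons u us)
  then show ?case by (cases us) auto
qed simp

lemma map_last_snoc [simp]: "map_last f (y # us @ [z]) = y # us @ [f z]"
  using map_last_append[of f "y # us" z "[]"] by simp

lemma slotwise_map_hd:
  assumes "linear_on R R f"
  shows "slotwise R R n n (map_hd f)"
  unfolding slotwise_def
proof (intro conjI ballI allI impI)
  show "map_hd f xs \<in> tuples R n" if "xs \<in> tuples R n" for xs
    using that assms by (cases xs) (auto simp: tuples_def linear_on_def)
  show "\<exists>us' g vs'. linear_on R R g \<and> (\<forall>z\<in>carrier R. map_hd f (us @ z # vs) = us' @ g z # vs')" for us x vs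
  proof (cases us)
    case Nil
    then have "map_hd f (us @ z # vs) = [] @ f z # vs" for z by simp
    then show ?thesis using assms by blast
  next
    case (Cons u us')
    then have "map_hd f (us @ z # vs) = (f u # us') @ z # vs" for z by simp
    then show ?thesis using linear_on_ident by blast
  qed
qed

lemma slotwise_map_last:
  assumes "linear_on R R f"
  shows "slotwise R R n n (map_last f)"
  unfolding slotwise_def
proof (intro conjI ballI allI impI)
  show "map_last f xs \<in> tuples R n" if "xs \<in> tuples R n" for xs
    using that assms by (cases xs rule: rev_cases) (auto simp: tuples_def linear_on_def map_last_append)
  show "\<exists>us' g vs'. linear_on R R g \<and> (\<forall>z\<in>carrier R. map_last f (us @ z # vs) = us' @ g z # vs')" for us x vs
  proof (cases vs)
    case Nil
    then have "map_last f (us @ z # vs) = us @ f z # []" for z by (simp add: map_last_append)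
    then show ?thesis using assms by blast
  next
    case (Cons v vs')
    then have "map_last f (us @ z # vs) = us @ z # map_last f (v # vs')" for z
      by (simp add: map_last_append)
    then show ?thesis using linear_on_ident by blast
  qed
qed

lemma count_list_rotate [simp]: "count_list (rotate k ts) x = count_list ts x"
proof (induction k)
  case (Suc k)
  have "count_list (rotate1 us) x = count_list us x" for us by (cases us) auto
  then show ?case using Suc by simp
qed simp

lemma list_all2_rotate:
  assumes "list_all2 P ts xs"
  shows "list_all2 P (rotate k ts) (rotate k xs)"
proof (induction k)
  case (Suc k)
  have "list_all2 P (rotate1 us) (rotate1 vs)" if "list_all2 P us vs" for us vs
    using that by (cases us; cases vs) (auto intro: list_all2_appendI)
  then show ?case using Suc by simp
qed (use assms in simp)

text \<open>The word is read cyclically: a crossing is a letter of the kind \<open>h\<close> whose predecessor is of the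
  other kind, seen at the ends of a suitable rotation.\<close>

definition crosses :: "bool \<Rightarrow> bool list \<Rightarrow> bool" where
  "crosses h ts \<longleftrightarrow> hd ts = h \<and> last ts \<noteq> h"

definition crossings :: "bool \<Rightarrow> bool list \<Rightarrow> nat" where
  "crossings h ts = card {k. k < length ts \<and> crosses h (rotate k ts)}"

lemma crossings_le: "crossings h ts \<le> length ts"
  unfolding crossings_def using card_mono[of "{..<length ts}" "{k. k < length ts \<and> crosses h (rotate k ts)}"] by auto

lemma crossings_pos:
  assumes "h \<in> set ts" "(\<not> h) \<in> set ts"
  shows "crossings h ts \<noteq> 0"
proof
  assume none: "crossings h ts = 0"
  obtain n where n: "length ts = Suc n" using assms by (cases ts) auto
  have hd: "hd (rotate k ts) = ts ! (k mod Suc n)" for k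
    using hd_rotate_conv_nth[of ts k] n by (cases ts) auto
  have "\<not> crosses h (rotate k ts)" for k
  proof -
    have "\<not> crosses h (rotate (k mod Suc n) ts)"
      using none n by (auto simp: crossings_def)
    then show ?thesis using rotate_conv_mod[of k ts] n by simp
  qed
  \<comment> \<open>Without a crossing, a letter \<open>h\<close> is preceded by a letter \<open>h\<close>; going round reaches every letter.\<close>
  then have prev: "hd (rotate (k + n) ts) = h" if "hd (rotate k ts) = h" for k
    using that rotate_last[of "rotate k ts" n] n by (metis add.commute crosses_def length_rotate list.sel(1) rotate_rotate)
  have all: "hd (rotate (k + j * n) ts) = h" if "hd (rotate k ts) = h" for k j
  proof (induction j)
    case (Suc j)
    then show ?case using prev[of "k + j * n"] by (simp add: algebra_simps)
  qed (use that in simp)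
  obtain k where k: "k < Suc n" "ts ! k = h" using assms(1) n by (metis in_set_conv_nth)
  obtain m where m: "m < Suc n" "ts ! m = (\<not> h)" using assms(2) n by (metis in_set_conv_nth)
  define i where "i = k + n - m"
  have "k + n = m + i" using m by (simp add: i_def)
  then have "k + Suc i * n = m + i * Suc n" by (simp add: algebra_simps)
  moreover have "hd (rotate (k + Suc i * n) ts) = h" using k hd by (intro all) simp
  ultimately have "hd (rotate (m + i * Suc n) ts) = h" by metis
  then have "ts ! ((m + i * Suc n) mod Suc n) = h" by (simp only: hd)
  then show False using m unfolding mod_mult_self1 by simp
qed

text \<open>The linear maps \<open>\<pi>\<close> and \<open>\<nu>\<close> are the projections onto \<open>I\<close> and onto a complement of \<open>I\<close>.  The
  flag \<open>h\<close> tells left units from right units, so that both cases are treated by one computation.\<close>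

locale ideal_extension = weak_algebra_char_0 A for A :: "('k::field_char_0, 'a) module" (structure) +
  fixes I :: "'a set" and \<pi> \<nu> :: "'a \<Rightarrow> 'a" and h :: bool
  assumes ideal_le: "I \<subseteq> carrier A"
    and ideal_closed: "closed_carrier (subalg A I)"
    and ideal_left: "\<lbrakk>a \<in> carrier A; x \<in> I\<rbrakk> \<Longrightarrow> a \<otimes> x \<in> I"
    and ideal_right: "\<lbrakk>a \<in> carrier A; x \<in> I\<rbrakk> \<Longrightarrow> x \<otimes> a \<in> I"
    and zero_in_ideal: "\<zero> \<in> I"
    and scale_zero: "x \<in> carrier A \<Longrightarrow> 0 \<odot> x = \<zero>"
    and linear_\<pi>: "linear_on A (subalg A I) \<pi>"
    and linear_\<nu>: "linear_on A A \<nu>"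
    and \<pi>_ideal: "x \<in> I \<Longrightarrow> \<pi> x = x"
    and \<nu>_ideal: "x \<in> I \<Longrightarrow> \<nu> x = \<zero>"
    and \<pi>_plus_\<nu>: "x \<in> carrier A \<Longrightarrow> \<pi> x \<oplus> \<nu> x = x"
    and \<pi>_\<nu>: "x \<in> carrier A \<Longrightarrow> \<pi> (\<nu> x) = \<zero>"
    and \<nu>_\<nu>: "x \<in> carrier A \<Longrightarrow> \<nu> (\<nu> x) = \<nu> x"
    and local_units: "\<lbrakk>finite S; S \<subseteq> I\<rbrakk> \<Longrightarrow> \<exists>e\<in>I. \<forall>x\<in>S. if h then e \<otimes> x = x else x \<otimes> e = x"
begin

lemma zero_carrier: "\<zero> \<in> carrier A"
  using zero_in_ideal ideal_le by blast

lemma zero_times: "x \<in> carrier A \<Longrightarrow> \<zero> \<otimes> x = \<zero>"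
  using linear_times_right[of x] scale_zero[OF zero_carrier] scale_zero[of "\<zero> \<otimes> x"] times_closed[OF zero_carrier]
    zero_carrier unfolding linear_on_def by metis

lemma times_zero: "x \<in> carrier A \<Longrightarrow> x \<otimes> \<zero> = \<zero>"
  using linear_times_left[of x] scale_zero[OF zero_carrier] scale_zero[of "x \<otimes> \<zero>"] times_closed[OF _ zero_carrier]
    zero_carrier unfolding linear_on_def by metis

lemma \<pi>_in_ideal: "x \<in> carrier A \<Longrightarrow> \<pi> x \<in> I"
  using linear_\<pi> by (simp add: linear_on_def)

lemma \<nu>_closed: "x \<in> carrier A \<Longrightarrow> \<nu> x \<in> carrier A"
  using linear_\<nu> by (simp add: linear_on_def)

lemma linear_\<pi>': "linear_on A A \<pi>"
  using linear_\<pi> ideal_le by (auto simp: linear_on_def)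

lemma word_zero_letter:
  assumes "xs \<in> tuples A n" "\<zero> \<in> set xs"
  shows "word xs \<in> cyclic_null A n"
proof -
  obtain us vs where xs: "xs = us @ \<zero> # vs" using assms(2) by (meson split_list)
  then show ?thesis
    using tensor_null_zero_letter[of us \<zero> vs A n] assms(1) scale_zero[OF zero_carrier]
      tensor_null_le_cyclic_null by auto
qed

text \<open>A mark \<open>True\<close> certifies a letter of \<open>I\<close>; a letter marked \<open>False\<close> is arbitrary.\<close>

definition marking :: "bool list \<Rightarrow> 'a list \<Rightarrow> bool" where
  "marking = list_all2 (\<lambda>m x. x \<in> carrier A \<and> (m \<longrightarrow> x \<in> I))"

text \<open>The relations are included, so that these subspaces are determined by their images in the cyclic
  coinvariants.  The mark \<open>True\<close> that is asked for keeps them in the relative complex.\<close>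

definition level :: "nat \<Rightarrow> nat \<Rightarrow> ('a list \<Rightarrow>\<^sub>0 'k) set" where
  "level n p = free.span ({word xs | xs ts. xs \<in> tuples A n \<and> marking ts xs \<and> True \<in> set ts \<and>
     count_list ts False \<le> p} \<union> cyclic_null A n)"

lemma subspace_level [simp]: "free.subspace (level n p)"
  by (simp add: level_def)

lemma level_word:
  "\<lbrakk>xs \<in> tuples A n; marking ts xs; True \<in> set ts; count_list ts False \<le> p\<rbrakk> \<Longrightarrow> word xs \<in> level n p"
  unfolding level_def by (rule free.span_base) blast

lemma cyclic_null_le_level: "cyclic_null A n \<subseteq> level n p"
  unfolding level_def by (rule order_trans[OF Un_upper2 free.span_superset])

lemma level_mono: "p \<le> p' \<Longrightarrow> level n p \<subseteq> level n p'"
  unfolding level_def by (rule free.span_mono) fastforce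

lemma hom_level:
  assumes "module_hom fscale fscale g" "free.subspace W"
    and "\<And>xs ts. \<lbrakk>xs \<in> tuples A n; marking ts xs; True \<in> set ts; count_list ts False \<le> p\<rbrakk> \<Longrightarrow> g (word xs) \<in> W"
    and "\<And>x. x \<in> cyclic_null A n \<Longrightarrow> g x \<in> W" and "x \<in> level n p"
  shows "g x \<in> W"
  by (rule hom_span[OF assms(1,2) _ assms(5)[unfolded level_def]]) (use assms(3,4) in blast)

lemma level_le_chains: "level n p \<subseteq> chain_space A n"
  unfolding level_def
  by (rule free.span_minimal) (use cyclic_null_le_chains[OF closed] in auto)

lemma marking_Cons [simp]: "marking (t # ts) (x # xs) \<longleftrightarrow> x \<in> carrier A \<and> (t \<longrightarrow> x \<in> I) \<and> marking ts xs"
  by (auto simp: marking_def)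

lemma marking_append [simp]:
  "length us = length ts \<Longrightarrow> marking (ts @ ts') (us @ us') \<longleftrightarrow> marking ts us \<and> marking ts' us'"
  by (simp add: marking_def list_all2_append)

lemma marking_Nil [simp]: "marking [] []"
  by (simp add: marking_def)

lemma marking_length: "marking ts xs \<Longrightarrow> length ts = length xs"
  by (simp add: marking_def list_all2_lengthD)

lemma marking_no_False: "marking ts xs \<Longrightarrow> False \<notin> set ts \<Longrightarrow> set xs \<subseteq> I"
  unfolding marking_def list_all2_conv_all_nth by (metis (full_types) in_set_conv_nth subsetI)

lemma marking_rotate: "marking ts xs \<Longrightarrow> marking (rotate k ts) (rotate k xs)"
  unfolding marking_def by (rule list_all2_rotate)

lemma split_marking:
  assumes "length ts = length xs" "Suc i < length xs"
  obtains us x y vs ss s t rs where "xs = us @ x # y # vs" "ts = ss @ s # t # rs"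
    "length us = i" "length ss = i" "length rs = length vs"
proof -
  obtain us x y vs where xs: "xs = us @ x # y # vs" "length us = i"
    using split_neighbours[OF assms(2)] .
  obtain ss s t rs where ts: "ts = ss @ s # t # rs" "length ss = i"
    using split_neighbours[of i ts] assms by metis
  have "length rs = length vs" using assms xs ts by simp
  then show ?thesis using that xs ts by blast
qed

text \<open>A product lies in \<open>I\<close> if one of its factors does, so that a contraction removes a mark \<open>False\<close> unless
  both letters are marked \<open>True\<close>.\<close>

lemma marking_contract:
  assumes "marking ts xs" "Suc i < length xs" "True \<in> set ts"
  shows "\<exists>ts'. marking ts' (contract A i xs) \<and> True \<in> set ts' \<and> count_list ts' False \<le> count_list ts False \<and>
    (\<not> (ts ! i \<and> ts ! Suc i) \<longrightarrow> count_list ts' False < count_list ts False)"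
proof -
  obtain us x y vs ss s t rs where d: "xs = us @ x # y # vs" "ts = ss @ s # t # rs"
    "length us = i" "length ss = i" "length rs = length vs"
    using split_marking[OF marking_length[OF assms(1)] assms(2)] .
  have c: "contract A i xs = us @ (x \<otimes> y) # vs" using d contract_append by metis
  have *: "marking ss us" "marking rs vs" "x \<in> carrier A" "y \<in> carrier A" "s \<longrightarrow> x \<in> I" "t \<longrightarrow> y \<in> I"
    using assms(1) d by simp_all
  then have "x \<otimes> y \<in> carrier A" "s \<or> t \<longrightarrow> x \<otimes> y \<in> I"
    using times_closed ideal_left ideal_right by auto
  then have "marking (ss @ (s \<or> t) # rs) (contract A i xs)"
    using * d c by simp
  moreover have "True \<in> set (ss @ (s \<or> t) # rs)" using assms(3) d by auto
  moreover have "ts ! i = s" "ts ! Suc i = t" using d by (simp_all add: nth_append)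
  ultimately show ?thesis using d by (intro exI[of _ "ss @ (s \<or> t) # rs"]) (cases s; cases t; simp)
qed

lemma b_level:
  assumes "x \<in> level n p"
  shows "lin_ext (b_word A n) x \<in> level (n - 1) p"
proof (cases n)
  case 0
  then show ?thesis using free.subspace_0[OF subspace_level] by (simp add: b_zero)
next
  case (Suc m)
  show ?thesis
  proof (rule hom_level[OF module_hom_lin_ext subspace_level _ _ assms])
    show "lin_ext (b_word A n) y \<in> level (n - 1) p" if "y \<in> cyclic_null A n" for y
      using b_cyclic_null[OF that] cyclic_null_le_level by blast
    fix xs ts assume xs: "xs \<in> tuples A n" "marking ts xs" "True \<in> set ts" "count_list ts False \<le> p"
    have contract: "word (contract A i (rotate k xs)) \<in> level m p" if i: "i < n" for i k
    proof -
      have "Suc i < length (rotate k xs)" "True \<in> set (rotate k ts)" using xs i by (simp_all add: tuples_def)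
      then obtain ts' where "marking ts' (contract A i (rotate k xs))" "True \<in> set ts'"
        "count_list ts' False \<le> count_list ts False"
        using marking_contract[OF marking_rotate[OF xs(2), of k], of i] by auto
      then show ?thesis
        using contract_tuples[OF i rotate_tuples[OF xs(1)], of k] xs(4) Suc
        by (intro level_word[of _ _ ts']) auto
    qed
    have len: "length xs = Suc n" using xs by (simp add: tuples_def)
    have "bar_word A xs \<in> level m p"
      unfolding bar_word_def using contract[of _ 0] len
      by (intro free.subspace_sum free.subspace_scale) auto
    then show "lin_ext (b_word A n) (word xs) \<in> level (n - 1) p"
      using contract[of 0 n] b_word_eq[OF len, of A] Suc
      by (simp add: free.subspace_add free.subspace_scale del: rotate_Suc power_Suc)
  qed
qed


section \<open>The homotopy\<close>

text \<open>At the ends of a word, \<open>\<alpha>\<close> and \<open>\<beta>\<close> keep a first letter of the kind \<open>h\<close> and a last letter of the other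
  kind, and annihilate the other letters of \<open>I\<close> and of its complement.
  Thus \<open>e\<close> is inserted at a crossing only, by a formula that is linear in every letter.  Since the word is cyclic, for right units this place is the end of a block of
  letters of \<open>I\<close>.\<close>

definition \<alpha> :: "'a \<Rightarrow> 'a" where "\<alpha> = (if h then \<pi> else \<nu>)"
definition \<beta> :: "'a \<Rightarrow> 'a" where "\<beta> = (if h then \<nu> else \<pi>)"

definition ends :: "'a list \<Rightarrow> 'a list" where
  "ends xs = map_hd \<alpha> (map_last \<beta> xs)"

definition insert_unit :: "'a \<Rightarrow> ('a list \<Rightarrow>\<^sub>0 'k) \<Rightarrow> ('a list \<Rightarrow>\<^sub>0 'k)" where
  "insert_unit e = word_map (\<lambda>xs. e # ends xs)"

definition homotopy :: "'a \<Rightarrow> ('a list \<Rightarrow>\<^sub>0 'k) \<Rightarrow> ('a list \<Rightarrow>\<^sub>0 'k)" where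
  "homotopy e x = insert_unit e (lin_ext norm_word x)"

lemma linear_\<alpha>: "linear_on A A \<alpha>" and linear_\<beta>: "linear_on A A \<beta>"
  using linear_\<pi>' linear_\<nu> by (simp_all add: \<alpha>_def \<beta>_def)

lemma \<alpha>_carrier: "x \<in> carrier A \<Longrightarrow> \<alpha> x \<in> carrier A" and \<beta>_carrier: "x \<in> carrier A \<Longrightarrow> \<beta> x \<in> carrier A"
  using linear_\<alpha> linear_\<beta> by (simp_all add: linear_on_def)

lemma \<alpha>_ideal: "x \<in> I \<Longrightarrow> \<alpha> x = (if h then x else \<zero>)" and \<beta>_ideal: "x \<in> I \<Longrightarrow> \<beta> x = (if h then \<zero> else x)"
  using \<pi>_ideal \<nu>_ideal by (simp_all add: \<alpha>_def \<beta>_def)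

lemma slotwise_insert:
  assumes "e \<in> I"
  shows "slotwise A A n (Suc n) (\<lambda>xs. e # ends xs)"
  unfolding ends_def using assms ideal_le
  by (intro slotwise_comp[OF slotwise_comp[OF slotwise_map_last[OF linear_\<beta>] slotwise_map_hd[OF linear_\<alpha>]] slotwise_Cons]) auto

lemma module_hom_homotopy: "module_hom fscale fscale (homotopy e)"
  unfolding homotopy_def insert_unit_def
  by unfold_locales (simp_all add: word_map_linear lin_ext_linear)

lemmas homotopy_linear = module_hom.add[OF module_hom_homotopy] module_hom.diff[OF module_hom_homotopy]
  module_hom.neg[OF module_hom_homotopy] module_hom.scale[OF module_hom_homotopy] module_hom.zero[OF module_hom_homotopy]

lemma homotopy_word:
  assumes "length xs = Suc n"
  shows "homotopy e (word xs) = (\<Sum>k<Suc n. fscale ((-1) ^ (n * k)) (word (e # ends (rotate k xs))))"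
  using assms by (simp add: homotopy_def insert_unit_def norm_word_def word_map_linear del: sum.lessThan_Suc)

lemma homotopy_cyclic_null:
  assumes "e \<in> I" "x \<in> cyclic_null A n"
  shows "homotopy e x \<in> cyclic_null A (Suc n)"
proof (rule hom_cyclic_null[OF module_hom_homotopy subspace_cyclic_null _ _ assms(2)])
  show "homotopy e y \<in> cyclic_null A (Suc n)" if "y \<in> tensor_null A n" for y
    unfolding homotopy_def insert_unit_def
    using word_map_tensor_null[OF closed slotwise_insert[OF assms(1)] norm_tensor_null[OF closed that]]
      tensor_null_le_cyclic_null by blast
  fix xs assume "xs \<in> tuples A n"
  then have "lin_ext norm_word (word xs - t_word n xs :: 'a list \<Rightarrow>\<^sub>0 'k) = 0"
    by (intro norm_one_minus_t) (simp add: tuples_def)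
  then show "homotopy e (word xs - t_word n xs) \<in> cyclic_null A (Suc n)"
    using free.subspace_0[OF subspace_cyclic_null] by (simp add: homotopy_def insert_unit_def word_map_linear)
qed

lemma ends_tuples: "xs \<in> tuples A n \<Longrightarrow> ends xs \<in> tuples A n"
  using slotwise_comp[OF slotwise_map_last[OF linear_\<beta>] slotwise_map_hd[OF linear_\<alpha>]]
  unfolding slotwise_def ends_def by blast

lemma marking_ends:
  assumes "marking ts xs"
  shows "marking ts (ends xs)"
proof -
  have \<alpha>: "\<alpha> x \<in> carrier A \<and> (t \<longrightarrow> \<alpha> x \<in> I)" if "x \<in> carrier A \<and> (t \<longrightarrow> x \<in> I)" for x t
    using that \<alpha>_carrier \<alpha>_ideal zero_in_ideal by auto
  have \<beta>: "\<beta> x \<in> carrier A \<and> (t \<longrightarrow> \<beta> x \<in> I)" if "x \<in> carrier A \<and> (t \<longrightarrow> x \<in> I)" for x t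
    using that \<beta>_carrier \<beta>_ideal zero_in_ideal by auto
  have "marking ts (map_last \<beta> xs)"
  proof (cases xs rule: rev_cases)
    case (snoc ys y)
    then obtain ss t where "ts = ss @ [t]" "length ss = length ys"
      using marking_length[OF assms] by (cases ts rule: rev_cases) auto
    then show ?thesis using assms snoc \<beta>[of y t] by (simp add: map_last_append)
  qed (use assms in simp)
  then show ?thesis
    unfolding ends_def using \<alpha>
    by (cases ts; cases "map_last \<beta> xs") (auto simp: map_hd_def marking_def)
qed

lemma homotopy_level:
  assumes "e \<in> I" "x \<in> level n p"
  shows "homotopy e x \<in> level (Suc n) p"
proof (rule hom_level[OF module_hom_homotopy subspace_level _ _ assms(2)])
  show "homotopy e y \<in> level (Suc n) p" if "y \<in> cyclic_null A n" for y
    using homotopy_cyclic_null[OF assms(1) that] cyclic_null_le_level by blast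
  fix xs ts assume xs: "xs \<in> tuples A n" "marking ts xs" "True \<in> set ts" "count_list ts False \<le> p"
  have "word (e # ends (rotate k xs)) \<in> level (Suc n) p" for k
  proof (rule level_word)
    show "e # ends (rotate k xs) \<in> tuples A (Suc n)"
      using ends_tuples[OF rotate_tuples[OF xs(1)]] assms(1) ideal_le by (auto simp: tuples_Cons)
    show "marking (True # rotate k ts) (e # ends (rotate k xs))"
      using marking_ends[OF marking_rotate[OF xs(2)]] assms(1) ideal_le by auto
  qed (use xs in auto)
  moreover have "length xs = Suc n" using xs by (simp add: tuples_def)
  ultimately show "homotopy e (word xs) \<in> level (Suc n) p"
    unfolding homotopy_word[OF \<open>length xs = Suc n\<close>] by (intro free.subspace_sum free.subspace_scale) auto
qed

text \<open>On words in the ideal one of the two projections at the ends is zero.\<close>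

lemma homotopy_level_0:
  assumes "e \<in> I" "x \<in> level n 0"
  shows "homotopy e x \<in> cyclic_null A (Suc n)"
proof (rule hom_level[OF module_hom_homotopy subspace_cyclic_null _ homotopy_cyclic_null[OF assms(1)] assms(2)])
  fix xs ts assume xs: "xs \<in> tuples A n" "marking ts xs" "True \<in> set ts" "count_list ts False \<le> 0"
  have "set xs \<subseteq> I" using marking_no_False[OF xs(2)] xs(4) by (simp add: count_list_0_iff)
  have "word (e # ends (rotate k xs)) \<in> cyclic_null A (Suc n)" for k
  proof (rule word_zero_letter)
    show "e # ends (rotate k xs) \<in> tuples A (Suc n)"
      using ends_tuples[OF rotate_tuples[OF xs(1)]] assms(1) ideal_le by (auto simp: tuples_Cons)
    have "set (rotate k xs) \<subseteq> I" "rotate k xs \<noteq> []" using \<open>set xs \<subseteq> I\<close> xs(1) by (auto simp: tuples_def)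
    then obtain zs z where z: "rotate k xs = zs @ [z]" "z \<in> I" "set zs \<subseteq> I"
      by (cases "rotate k xs" rule: rev_cases) auto
    then show "\<zero> \<in> set (e # ends (rotate k xs))"
      by (cases zs) (simp_all add: ends_def map_last_append \<alpha>_ideal \<beta>_ideal zero_in_ideal)
  qed
  moreover have "length xs = Suc n" using xs by (simp add: tuples_def)
  ultimately show "homotopy e (word xs) \<in> cyclic_null A (Suc n)"
    unfolding homotopy_word[OF \<open>length xs = Suc n\<close>] by (intro free.subspace_sum free.subspace_scale) auto
qed

text \<open>On \<open>I\<close> each of \<open>\<alpha>\<close> and \<open>\<beta>\<close> is the identity or zero, and therefore compatible with products of letters
  of \<open>I\<close>.\<close>

lemma contract_ends:
  assumes "set xs \<subseteq> carrier A" "Suc i < length xs" "xs ! i \<in> I" "xs ! Suc i \<in> I"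
  shows "contract A i (ends xs) = ends (contract A i xs)"
proof -
  obtain us x y vs where xs: "xs = us @ x # y # vs" "length us = i"
    using split_neighbours[OF assms(2)] .
  have xy: "x \<in> I" "y \<in> I" "x \<in> carrier A" "y \<in> carrier A" "x \<otimes> y \<in> I"
    using assms xs ideal_left by (auto simp: nth_append)
  have c: "contract A i (us' @ x' # y' # vs') = us' @ (x' \<otimes> y') # vs'" if "length us' = i" for us' x' y' vs'
    using contract_append that by metis
  show ?thesis
  proof (cases us)
    case Nil
    then show ?thesis
      using xs xy by (cases vs) (simp_all add: ends_def \<alpha>_ideal \<beta>_ideal zero_times times_zero zero_in_ideal)
  next
    case (Cons u us')
    have "length (\<alpha> u # us') = i" using xs(2) Cons by simp
    then show ?thesis
      using xs Cons c[OF xs(2)] c[of "\<alpha> u # us'"] xy map_last_append[of \<beta> us]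
      by (cases vs) (simp_all add: ends_def \<beta>_ideal times_zero)
  qed
qed


text \<open>Words whose letters marked \<open>False\<close> lie in the complement of \<open>I\<close>.\<close>

definition pure :: "bool list \<Rightarrow> 'a list \<Rightarrow> bool" where
  "pure = list_all2 (\<lambda>m x. if m then x \<in> I else x \<in> carrier A \<and> \<pi> x = \<zero> \<and> \<nu> x = x)"

lemma pure_marking: "pure ts xs \<Longrightarrow> marking ts xs"
  unfolding pure_def marking_def using ideal_le by (auto elim!: list_all2_mono split: if_splits)

lemma pure_length: "pure ts xs \<Longrightarrow> length ts = length xs"
  by (simp add: pure_def list_all2_lengthD)

lemma pure_rotate: "pure ts xs \<Longrightarrow> pure (rotate k ts) (rotate k xs)"
  unfolding pure_def by (rule list_all2_rotate)

lemma pure_Cons [simp]: "pure (t # ts) (x # xs) \<longleftrightarrow>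
    (if t then x \<in> I else x \<in> carrier A \<and> \<pi> x = \<zero> \<and> \<nu> x = x) \<and> pure ts xs"
  by (simp add: pure_def)

lemma pure_append [simp]:
  "length us = length ts \<Longrightarrow> pure (ts @ ts') (us @ us') \<longleftrightarrow> pure ts us \<and> pure ts' us'"
  by (simp add: pure_def list_all2_append)

text \<open>For left units the word is recovered from the first contraction.  For right units it is recovered from the
  contraction across the ends, and the rotation that is needed leaves a minus sign.\<close>

definition \<sigma> :: 'k where "\<sigma> = (if h then 1 else -1)"

text \<open>The two contractions that involve \<open>e\<close>: one of them absorbs \<open>e\<close> and gives the word back, up to a
  rotation, and the other one turns a letter outside \<open>I\<close> into a letter of \<open>I\<close>.  If the ends
  of the word are not a crossing, then both contain the letter zero.\<close>

lemma unit_contractions: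
  assumes xs: "xs \<in> tuples A n" and "0 < n" and p: "pure ts xs" "count_list ts False = Suc p" "True \<in> set ts"
    and e: "e \<in> I" and unit: "\<And>x. x \<in> set xs \<Longrightarrow> x \<in> I \<Longrightarrow> if h then e \<otimes> x = x else x \<otimes> e = x"
    and y: "ends xs = y # ys"
  shows "word ((e \<otimes> y) # ys) + fscale ((-1) ^ Suc n) (word ((last (y # ys) \<otimes> e) # butlast (y # ys)))
    - (if crosses h ts then fscale \<sigma> (word xs) else 0) \<in> level n p"
proof -
  have len: "length xs = Suc n" using xs by (simp add: tuples_def)
  obtain a zs c where ac: "xs = a # zs @ [c]"
    using len \<open>0 < n\<close> by (cases xs; cases "tl xs" rule: rev_cases) auto
  obtain s us t where st: "ts = s # us @ [t]" "length us = length zs"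
    using pure_length[OF p(1)] ac by (cases ts; cases "tl ts" rule: rev_cases) auto
  have pure: "if s then a \<in> I else a \<in> carrier A \<and> \<pi> a = \<zero> \<and> \<nu> a = a" "pure us zs"
    "if t then c \<in> I else c \<in> carrier A \<and> \<pi> c = \<zero> \<and> \<nu> c = c"
    using p(1) ac st by simp_all
  have carr: "a \<in> carrier A" "c \<in> carrier A" "e \<in> carrier A" "set zs \<subseteq> carrier A"
    using xs ac e ideal_le by (auto simp: tuples_def)
  have y': "y = \<alpha> a" "ys = zs @ [\<beta> c]" using y ac by (simp_all add: ends_def)
  have \<alpha>: "\<alpha> a = (if s = h then a else \<zero>)" using pure(1) \<pi>_ideal \<nu>_ideal by (auto simp: \<alpha>_def)
  have \<beta>: "\<beta> c = (if t = h then \<zero> else c)" using pure(3) \<pi>_ideal \<nu>_ideal by (auto simp: \<beta>_def)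
  have cross: "crosses h ts \<longleftrightarrow> s = h \<and> t \<noteq> h" using st by (simp add: crosses_def)
  have lenzs: "length zs = n - 1" using len ac by simp
  let ?w1 = "(e \<otimes> y) # ys" and ?w2 = "(\<beta> c \<otimes> e) # y # zs"
  have w2: "(last (y # ys) \<otimes> e) # butlast (y # ys) = ?w2" by (simp add: y' butlast_append)
  have tup: "?w1 \<in> tuples A n" "?w2 \<in> tuples A n"
    using carr lenzs \<open>0 < n\<close> times_closed \<alpha>_carrier \<beta>_carrier by (auto simp: tuples_def y')
  show ?thesis
  proof (cases "crosses h ts")
    case False
    then have "\<zero> \<in> set ?w1" "\<zero> \<in> set ?w2"
      using \<alpha> \<beta> cross carr by (auto simp: y' times_zero zero_times)
    then have "word ?w1 \<in> level n p" "word ?w2 \<in> level n p"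
      using word_zero_letter tup cyclic_null_le_level by blast+
    then show ?thesis using False unfolding w2 by (simp add: free.subspace_add free.subspace_scale del: power_Suc)
  next
    case True
    note crs = True
    have mark: "marking us zs" by (rule pure_marking[OF pure(2)])
    show ?thesis
    proof (cases h)
      case True
      then have h: "s" "\<not> t" "h" using crs cross by auto
      have "e \<otimes> a = a" using unit[of a] pure(1) h ac by auto
      then have w1: "?w1 = xs" using h \<alpha> \<beta> by (simp add: y' ac)
      have "word ?w2 \<in> level n p"
      proof (rule level_word[OF tup(2)])
        show "marking (True # s # us) ?w2"
          using mark carr \<beta> \<alpha> h pure e ideal_left times_closed by (simp add: y')
        show "count_list (True # s # us) False \<le> p" using p(2) st h by simp
      qed simp
      moreover have "\<sigma> = 1" unfolding \<sigma>_def using h by simp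
      ultimately show ?thesis
        unfolding w2 w1 using crs by (simp add: free.subspace_scale del: power_Suc)
    next
      case False
      then have h: "\<not> s" "t" "\<not> h" using crs cross by auto
      have "c \<otimes> e = c" using unit[of c] pure(3) h ac by auto
      then have "?w2 = c # a # zs" using h \<alpha> \<beta> by (simp add: y')
      then have t: "word xs + fscale ((-1) ^ Suc n) (word ?w2) = word xs - t_word n xs"
        by (simp add: t_word_def ac butlast_append)
      have "word ?w1 \<in> level n p"
      proof (rule level_word[OF tup(1)])
        show "marking (True # us @ [t]) ?w1"
          using mark carr \<beta> \<alpha> h pure e ideal_right times_closed st by (simp add: y')
        show "count_list (True # us @ [t]) False \<le> p" using p(2) st h by simp
      qed simp
      moreover have "word xs - t_word n xs \<in> cyclic_rels A n"
        using xs by (auto simp: cyclic_rels_def)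
      then have "word xs - t_word n xs \<in> level n p"
        using cyclic_rels_le_cyclic_null free.span_base cyclic_null_le_level by blast
      moreover have "\<sigma> = -1" unfolding \<sigma>_def using h by simp
      ultimately have "\<sigma> = -1" "word ?w1 + (word xs + fscale ((-1) ^ Suc n) (word ?w2)) \<in> level n p"
        unfolding t by (simp_all add: free.subspace_add)
      then show ?thesis
        unfolding w2 using crs by (simp add: algebra_simps del: power_Suc)
    qed
  qed
qed

text \<open>Contractions of two letters of \<open>I\<close> commute with the insertion of \<open>e\<close> and cancel, and all the other
  contractions lower the number of letters outside \<open>I\<close>.\<close>

lemma insert_unit_homotopy:
  assumes xs: "xs \<in> tuples A n" and "0 < n" and p: "pure ts xs" "count_list ts False = Suc p" "True \<in> set ts"
    and e: "e \<in> I" and unit: "\<And>x. x \<in> set xs \<Longrightarrow> x \<in> I \<Longrightarrow> if h then e \<otimes> x = x else x \<otimes> e = x"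
  shows "b_word A (Suc n) (e # ends xs) + insert_unit e (bar_word A xs)
    - (if crosses h ts then fscale \<sigma> (word xs) else 0) \<in> level n p"
proof -
  have len: "length xs = Suc n" using xs by (simp add: tuples_def)
  have ends: "ends xs \<in> tuples A n" by (rule ends_tuples[OF xs])
  then have len_ends: "length (ends xs) = Suc n" by (simp add: tuples_def)
  then obtain y ys where y: "ends xs = y # ys" by (cases "ends xs") auto
  define U where "U = word ((e \<otimes> y) # ys) + fscale ((-1) ^ Suc n) (word ((last (y # ys) \<otimes> e) # butlast (y # ys)))
    - (if crosses h ts then fscale \<sigma> (word xs) else 0)"
  define V where "V = (\<Sum>i<n. fscale ((-1) ^ i) (word (e # ends (contract A i xs)) - word (e # contract A i (ends xs))) :: 'a list \<Rightarrow>\<^sub>0 'k)"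
  have "U \<in> level n p"
    unfolding U_def by (rule unit_contractions[OF xs \<open>0 < n\<close> p e unit y])
  moreover have "V \<in> level n p"
    unfolding V_def
  proof (intro free.subspace_sum free.subspace_scale subspace_level)
    fix i assume "i \<in> {..<n}"
    then have i: "i < n" by simp
    have i': "Suc i < length xs" "Suc i < length (ends xs)" using i len len_ends by auto
    note mark = pure_marking[OF p(1)]
    have e_tup: "e # zs \<in> tuples A n" if "zs \<in> tuples A (n - 1)" for zs
      using that e ideal_le \<open>0 < n\<close> by (cases n) (auto simp: tuples_Cons)
    have "word (e # zs) \<in> level n p"
      if "zs \<in> tuples A (n - 1)" "marking us zs" "count_list us False < Suc p" for zs us
      using that e_tup e ideal_le by (intro level_word[of _ _ "True # us"]) auto
    note low = this
    show "word (e # ends (contract A i xs)) - word (e # contract A i (ends xs)) \<in> level n p"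
    proof (cases "ts ! i \<and> ts ! Suc i")
      case True
      have "xs ! i \<in> I" "xs ! Suc i \<in> I"
        using p(1) i' True pure_length[OF p(1)] unfolding pure_def list_all2_conv_all_nth by auto
      then have "contract A i (ends xs) = ends (contract A i xs)"
        using contract_ends i' xs by (simp add: tuples_def)
      then show ?thesis using free.subspace_0[OF subspace_level] by simp
    next
      case False
      obtain us where us: "marking us (contract A i xs)" "count_list us False < Suc p"
        using marking_contract[OF mark i'(1) p(3)] False p(2) by auto
      obtain vs where vs: "marking vs (contract A i (ends xs))" "count_list vs False < Suc p"
        using marking_contract[OF marking_ends[OF mark] i'(2) p(3)] False p(2) by auto
      show ?thesis
        using low[OF _ marking_ends[OF us(1)] us(2)] low[OF _ vs] ends_tuples
          contract_tuples[OF i xs] contract_tuples[OF i ends]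
        by (intro free.subspace_diff) auto
    qed
  qed
  moreover have "b_word A (Suc n) (e # ends xs) + insert_unit e (bar_word A xs)
    - (if crosses h ts then fscale \<sigma> (word xs) else 0) = U + V"
  proof -
    have "contract A 0 (rotate (Suc n) (e # ends xs)) = (last (y # ys) \<otimes> e) # butlast (y # ys)"
      using rotate_last[of "e # ends xs" "Suc n"] len_ends y by simp
    then have "b_word A (Suc n) (e # ends xs) = bar_word A (e # ends xs)
        + fscale ((-1) ^ Suc n) (word ((last (y # ys) \<otimes> e) # butlast (y # ys)))"
      using b_word_eq[of "e # ends xs" "Suc n" A] len_ends by (simp del: rotate_Suc power_Suc)
    moreover have "bar_word A (e # ends xs) = word ((e \<otimes> y) # ys) - word_map (Cons e) (bar_word A (ends xs))"
      unfolding y by (rule bar_word_simps(3))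
    moreover have "insert_unit e (bar_word A xs) - word_map (Cons e) (bar_word A (ends xs)) = V"
      using len len_ends
      by (simp add: bar_word_def V_def insert_unit_def word_map_linear sum_subtractf free.scale_right_diff_distrib)
    ultimately show ?thesis unfolding U_def by (simp add: algebra_simps del: power_Suc)
  qed
  ultimately show ?thesis by (simp add: free.subspace_add)
qed

lemma homotopy_b_word:
  assumes "0 < n" and xs: "xs \<in> tuples A n"
  shows "homotopy e (lin_ext (b_word A n) (word xs))
    = (\<Sum>k<Suc n. fscale ((-1) ^ (n * k)) (insert_unit e (bar_word A (rotate k xs))))"
proof -
  have len: "length xs = Suc n" using xs by (simp add: tuples_def)
  show ?thesis
    using norm_b_eq_bar_norm[OF len \<open>0 < n\<close>, of A] len
    by (simp add: homotopy_def insert_unit_def norm_word_def[of xs] lin_ext_linear word_map_linear del: sum.lessThan_Suc)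
qed

text \<open>Summed over all rotations, \<open>insert_unit_homotopy\<close> gives one rotated copy of the word for each crossing, and
  a rotated copy with its sign equals the word modulo the cyclic relations.\<close>

lemma homotopy_pure_word:
  assumes xs: "xs \<in> tuples A n" and n: "0 < n" and p: "pure ts xs" "count_list ts False = Suc p" "True \<in> set ts"
    and e: "e \<in> I" and unit: "\<And>x. x \<in> set xs \<Longrightarrow> x \<in> I \<Longrightarrow> if h then e \<otimes> x = x else x \<otimes> e = x"
  shows "lin_ext (b_word A (Suc n)) (homotopy e (word xs)) + homotopy e (lin_ext (b_word A n) (word xs))
    - fscale (\<sigma> * of_nat (crossings h ts)) (word xs) \<in> level n p"
proof -
  have len: "length xs = Suc n" using xs by (simp add: tuples_def)
  let ?s = "\<lambda>k. (-1 :: 'k) ^ (n * k)"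
  let ?c = "\<lambda>k. crosses h (rotate k ts)"
  define X where "X = (\<lambda>k. b_word A (Suc n) (e # ends (rotate k xs)) + insert_unit e (bar_word A (rotate k xs))
    - (if ?c k then fscale \<sigma> (word (rotate k xs)) else 0))"
  define Y where "Y = (\<lambda>k. word xs - fscale (?s k) (word (rotate k xs)) :: 'a list \<Rightarrow>\<^sub>0 'k)"
  have "X k \<in> level n p" for k
    unfolding X_def
    by (rule insert_unit_homotopy[OF rotate_tuples[OF xs] n pure_rotate[OF p(1)] _ _ e]) (use p unit in auto)
  moreover have "Y k \<in> level n p" for k
    using rotate_cyclic[OF xs, of k] cyclic_rels_le_cyclic_null cyclic_null_le_level unfolding Y_def by blast
  ultimately have mem: "(\<Sum>k<Suc n. fscale (?s k) (X k)) - (\<Sum>k<Suc n. if ?c k then fscale \<sigma> (Y k) else 0) \<in> level n p"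
    by (intro free.subspace_diff free.subspace_sum free.subspace_scale subspace_level)
      (auto intro: free.subspace_scale free.subspace_0)
  have q: "fscale (\<sigma> * of_nat (crossings h ts)) (word xs) = (\<Sum>k<Suc n. if ?c k then fscale \<sigma> (word xs) else 0)"
  proof -
    have "length ts = Suc n" using pure_length[OF p(1)] len by simp
    then have "{k. k < length ts \<and> ?c k} = {k \<in> {..<Suc n}. ?c k}" by auto
    moreover have "(\<Sum>k<Suc n. if ?c k then fscale \<sigma> (word xs) else 0) = (\<Sum>k\<in>{k \<in> {..<Suc n}. ?c k}. fscale \<sigma> (word xs))"
      by (rule sum.inter_filter[symmetric]) simp
    ultimately show ?thesis
      by (simp add: crossings_def free.sum_constant_scale mult.commute)
  qed
  have "(\<Sum>k<Suc n. fscale (?s k) (X k)) - (\<Sum>k<Suc n. if ?c k then fscale \<sigma> (Y k) else 0)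
    = (\<Sum>k<Suc n. fscale (?s k) (b_word A (Suc n) (e # ends (rotate k xs)))
        + fscale (?s k) (insert_unit e (bar_word A (rotate k xs))) - (if ?c k then fscale \<sigma> (word xs) else 0))"
    unfolding sum_subtractf[symmetric]
    by (intro sum.cong refl)
      (auto simp: X_def Y_def free.scale_right_distrib free.scale_right_diff_distrib mult.commute)
  also have "\<dots> = lin_ext (b_word A (Suc n)) (homotopy e (word xs)) + homotopy e (lin_ext (b_word A n) (word xs))
    - fscale (\<sigma> * of_nat (crossings h ts)) (word xs)"
    unfolding homotopy_b_word[OF n xs] homotopy_word[OF len] q
    by (simp add: lin_ext_linear sum.distrib sum_subtractf del: sum.lessThan_Suc)
  finally show ?thesis using mem by simp
qed


section \<open>Descending the filtration\<close>

lemma span_level: "free.span (level n p) = level n p"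
  by (simp add: level_def free.span_span)

abbreviation purify :: "bool list \<Rightarrow> 'a list \<Rightarrow> 'a list" where
  "purify \<equiv> map2 (\<lambda>t x. if t then x else \<nu> x)"

text \<open>The letters are replaced one at a time.  By \<open>x = \<pi> x + \<nu> x\<close>, the error of one replacement is a word with
  the letter \<open>\<pi> x\<close> of \<open>I\<close> in place of a letter that was marked \<open>False\<close>.\<close>

lemma purify_append:
  assumes "us @ xs \<in> tuples A n" "length us = length ss" "marking ss us" "marking ts xs"
    "count_list (ss @ ts) False \<le> Suc p"
  shows "word (us @ xs) - word (us @ purify ts xs) \<in> level n p"
  using assms
proof (induction ts arbitrary: us ss xs)
  case Nil
  then have "xs = []" by (auto dest: marking_length)
  then show ?case using free.subspace_0[OF subspace_level] by simp
next
  case (Cons t ts)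
  obtain x ys where xs: "xs = x # ys" using marking_length[OF Cons.prems(4)] by (cases xs) auto
  have m: "x \<in> carrier A" "t \<longrightarrow> x \<in> I" "marking ts ys" using Cons.prems(4) xs by simp_all
  define x' where "x' = (if t then x else \<nu> x)"
  have x': "x' \<in> carrier A" "t \<longrightarrow> x' \<in> I" using m \<nu>_closed by (auto simp: x'_def)
  have tup: "us @ x' # ys \<in> tuples A n" using Cons.prems(1) x'(1) tuples_replace xs by fastforce
  have "word (us @ x' # ys) - word (us @ x' # purify ts ys) \<in> level n p"
    using Cons.IH[of "us @ [x']" ys "ss @ [t]"] Cons.prems tup x' m by simp
  moreover have "word (us @ x # ys) - word (us @ x' # ys) \<in> level n p"
  proof (cases t)
    case True
    then show ?thesis using free.subspace_0[OF subspace_level] by (simp add: x'_def)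
  next
    case False
    have \<pi>: "\<pi> x \<in> I" "\<pi> x \<in> carrier A" using m \<pi>_in_ideal ideal_le by auto
    have tup': "us @ \<pi> x # ys \<in> tuples A n" using Cons.prems(1) \<pi>(2) tuples_replace xs by fastforce
    have "word (us @ \<pi> x # ys) \<in> level n p"
    proof (rule level_word[OF tup'])
      show "marking (ss @ True # ts) (us @ \<pi> x # ys)" using Cons.prems m \<pi> by simp
      show "count_list (ss @ True # ts) False \<le> p" using Cons.prems(5) False by simp
    qed simp
    moreover have "word (us @ x # ys) - word (us @ \<pi> x # ys) - word (us @ \<nu> x # ys) \<in> level n p"
      using tensor_null_add[OF tup' \<nu>_closed[OF m(1)]] \<pi>_plus_\<nu>[OF m(1)]
        tensor_null_le_cyclic_null cyclic_null_le_level by (metis subsetD)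
    ultimately have "(word (us @ x # ys) - word (us @ \<pi> x # ys) - word (us @ \<nu> x # ys)) + word (us @ \<pi> x # ys) \<in> level n p"
      by (intro free.subspace_add) auto
    then show ?thesis using False by (simp add: x'_def)
  qed
  ultimately have "(word (us @ x # ys) - word (us @ x' # ys)) + (word (us @ x' # ys) - word (us @ x' # purify ts ys)) \<in> level n p"
    by (intro free.subspace_add) auto
  then show ?case by (simp add: xs x'_def)
qed

lemma purify_level:
  assumes "xs \<in> tuples A n" "marking ts xs" "count_list ts False \<le> Suc p"
  shows "word xs - word (purify ts xs) \<in> level n p"
  using purify_append[of "[]" xs n "[]" ts p] assms by simp

lemma pure_purify: "marking ts xs \<Longrightarrow> pure ts (purify ts xs)"
  unfolding marking_def
  by (induction rule: list_all2_induct) (auto simp: pure_def \<nu>_closed \<pi>_\<nu> \<nu>_\<nu>)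

lemma marking_carrier: "marking ts xs \<Longrightarrow> set xs \<subseteq> carrier A"
  unfolding marking_def by (induction rule: list_all2_induct) auto

lemma purify_tuples:
  assumes "xs \<in> tuples A n" "marking ts xs"
  shows "purify ts xs \<in> tuples A n"
proof -
  have "length (purify ts xs) = length xs" using marking_length[OF assms(2)] by simp
  moreover have "set (purify ts xs) \<subseteq> carrier A"
    by (rule marking_carrier[OF pure_marking[OF pure_purify[OF assms(2)]]])
  ultimately show ?thesis using assms(1) by (simp add: tuples_def)
qed

lemma map_\<nu>_level:
  assumes "x \<in> chain_space A n"
  shows "x - word_map (map \<nu>) x \<in> level n n"
proof (rule hom_chains[OF _ subspace_level _ assms])
  show "module_hom fscale fscale (\<lambda>x. x - word_map (map \<nu>) x)"
    by unfold_locales (simp_all add: word_map_linear free.scale_right_diff_distrib)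
  fix xs assume xs: "xs \<in> tuples A n"
  let ?F = "\<lambda>ys :: 'a list. replicate (length ys) False"
  have "marking (?F ys) ys" if "set ys \<subseteq> carrier A" for ys using that by (induction ys) auto
  moreover have "set xs \<subseteq> carrier A" using xs by (simp add: tuples_def)
  ultimately have "marking (?F xs) xs" by blast
  moreover have "count_list (replicate k False) False = k" for k by (induction k) auto
  then have "count_list (?F xs) False \<le> Suc n" using xs by (simp add: tuples_def del: replicate_Suc)
  moreover have "purify (?F ys) ys = map \<nu> ys" for ys by (induction ys) auto
  ultimately show "word xs - word_map (map \<nu>) (word xs) \<in> level n n"
    using purify_level[OF xs, of "?F xs" n] by simp
qed

definition sublevel_words :: "nat \<Rightarrow> nat \<Rightarrow> nat \<Rightarrow> ('a list \<Rightarrow>\<^sub>0 'k) set" where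
  "sublevel_words n p q = {word xs | xs ts. xs \<in> tuples A n \<and> pure ts xs \<and> True \<in> set ts \<and>
     count_list ts False = Suc p \<and> crossings h ts \<le> q}"

text \<open>The factor in the homotopy formula depends on the number of crossings.  To divide by it, words with different
  numbers of crossings have to be handled separately; these subspaces interpolate between two levels.\<close>

definition sublevel :: "nat \<Rightarrow> nat \<Rightarrow> nat \<Rightarrow> ('a list \<Rightarrow>\<^sub>0 'k) set" where
  "sublevel n p q = free.span (sublevel_words n p q \<union> level n p)"

lemma subspace_sublevel [simp]: "free.subspace (sublevel n p q)"
  by (simp add: sublevel_def)

lemma level_le_sublevel: "level n p \<subseteq> sublevel n p q"
  unfolding sublevel_def by (rule order_trans[OF Un_upper2 free.span_superset])

lemma sublevel_le_level: "sublevel n p q \<subseteq> level n (Suc p)"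
  unfolding sublevel_def
proof (rule free.span_minimal)
  have "sublevel_words n p q \<subseteq> level n (Suc p)"
    unfolding sublevel_words_def using level_word pure_marking by fastforce
  then show "sublevel_words n p q \<union> level n p \<subseteq> level n (Suc p)"
    using level_mono[of p "Suc p"] by simp
qed simp

lemma level_le_top_sublevel: "level n (Suc p) \<subseteq> sublevel n p (Suc n)"
proof -
  have "word xs \<in> sublevel n p (Suc n)"
    if xs: "xs \<in> tuples A n" "marking ts xs" "True \<in> set ts" "count_list ts False \<le> Suc p" for xs ts
  proof (cases "count_list ts False = Suc p")
    case True
    have "crossings h ts \<le> Suc n"
      using crossings_le[of h ts] marking_length[OF xs(2)] xs(1) by (simp add: tuples_def)
    then have "word (purify ts xs) \<in> sublevel_words n p (Suc n)"
      unfolding sublevel_words_def using pure_purify[OF xs(2)] purify_tuples[OF xs(1,2)] xs(3) True by blast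
    then have "word (purify ts xs) \<in> sublevel n p (Suc n)"
      unfolding sublevel_def by (intro free.span_base) simp
    moreover have "word xs - word (purify ts xs) \<in> sublevel n p (Suc n)"
      using purify_level[OF xs(1,2,4)] level_le_sublevel by blast
    ultimately have "(word xs - word (purify ts xs)) + word (purify ts xs) \<in> sublevel n p (Suc n)"
      by (intro free.subspace_add) auto
    then show ?thesis by simp
  next
    case False
    then have "word xs \<in> level n p" using xs by (intro level_word) auto
    then show ?thesis using level_le_sublevel by blast
  qed
  then have "{word xs | xs ts. xs \<in> tuples A n \<and> marking ts xs \<and> True \<in> set ts \<and> count_list ts False \<le> Suc p}
      \<subseteq> sublevel n p (Suc n)"
    by blast
  moreover have "cyclic_null A n \<subseteq> sublevel n p (Suc n)"
    by (rule order_trans[OF cyclic_null_le_level level_le_sublevel])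
  ultimately show ?thesis
    unfolding level_def[of n "Suc p"] by (rule free.span_minimal[OF Un_least subspace_sublevel])
qed

lemma sublevel_0: "sublevel n p 0 \<subseteq> level n p"
proof -
  have "crossings h ts \<noteq> 0" if "count_list ts False = Suc p" "True \<in> set ts" for ts
  proof -
    have "count_list ts False \<noteq> 0" using that(1) by simp
    then have "False \<in> set ts" unfolding count_list_0_iff by simp
    then have "s \<in> set ts" for s using that(2) by (cases s) simp_all
    then show ?thesis by (intro crossings_pos)
  qed
  then have "\<not> crossings h ts \<le> 0" if "count_list ts False = Suc p" "True \<in> set ts" for ts
    using that by simp
  then have "sublevel_words n p 0 = {}" unfolding sublevel_words_def by blast
  then show ?thesis unfolding sublevel_def by (simp add: span_level)
qed

text \<open>The unit \<open>e\<close> has to fix the letters of the finitely many words in the top part \<open>a\<close> only: for the lower part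
  \<open>r\<close> it suffices that \<open>b\<close> and \<open>D\<close> preserve the levels.\<close>

lemma homotopy_sublevel:
  assumes x: "x \<in> sublevel n p (Suc q)" and n: "0 < n"
  shows "\<exists>e\<in>I. lin_ext (b_word A (Suc n)) (homotopy e x) + homotopy e (lin_ext (b_word A n) x)
    - fscale (\<sigma> * of_nat (Suc q)) x \<in> sublevel n p q"
proof -
  obtain a r where ar: "x = a + r" "a \<in> free.span (sublevel_words n p (Suc q))" "r \<in> level n p"
    using x unfolding sublevel_def free.span_Un span_level by blast
  obtain T c where T: "finite T" "T \<subseteq> sublevel_words n p (Suc q)" "a = (\<Sum>w\<in>T. fscale (c w) w)"
    using ar(2) unfolding free.span_explicit by blast
  then have a: "a \<in> free.span T" by (auto intro: free.span_sum free.span_scale free.span_base)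
  define L where "L = {y \<in> I. \<exists>w\<in>T. \<exists>xs\<in>Poly_Mapping.keys w. y \<in> set xs}"
  have "L \<subseteq> (\<Union>w\<in>T. \<Union>xs\<in>Poly_Mapping.keys w. set xs)" by (auto simp: L_def)
  then have "finite L" by (rule finite_subset) (use T in auto)
  then obtain e where e: "e \<in> I" "\<forall>y\<in>L. if h then e \<otimes> y = y else y \<otimes> e = y"
    using local_units[of L] by (auto simp: L_def)
  define P where "P = (\<lambda>x. lin_ext (b_word A (Suc n)) (homotopy e x) + homotopy e (lin_ext (b_word A n) x)
    - fscale (\<sigma> * of_nat (Suc q)) x)"
  have hom: "module_hom fscale fscale P"
    unfolding P_def by unfold_locales
      (simp_all add: lin_ext_linear homotopy_linear free.scale_right_distrib free.scale_right_diff_distrib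
        mult.commute del: of_nat_Suc)
  have "P a \<in> sublevel n p q"
  proof (rule hom_span[OF hom subspace_sublevel _ a])
    fix w assume w: "w \<in> T"
    then obtain xs ts where xs: "w = word xs" "xs \<in> tuples A n" "pure ts xs" "True \<in> set ts"
      "count_list ts False = Suc p" "crossings h ts \<le> Suc q"
      using T(2) unfolding sublevel_words_def by blast
    have unit: "if h then e \<otimes> y = y else y \<otimes> e = y" if "y \<in> set xs" "y \<in> I" for y
    proof -
      have "xs \<in> Poly_Mapping.keys w" by (simp add: xs(1))
      then have "y \<in> L" unfolding L_def using that w by blast
      then show ?thesis using e(2) by blast
    qed
    have 1: "lin_ext (b_word A (Suc n)) (homotopy e w) + homotopy e (lin_ext (b_word A n) w)
        - fscale (\<sigma> * of_nat (crossings h ts)) w \<in> sublevel n p q"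
      unfolding xs(1)
      by (rule subsetD[OF level_le_sublevel homotopy_pure_word[OF xs(2) n xs(3,5,4) e(1)]]) (fact unit)
    have 2: "fscale (\<sigma> * (of_nat (Suc q) - of_nat (crossings h ts))) w \<in> sublevel n p q"
    proof (cases "crossings h ts = Suc q")
      case False
      then have "w \<in> sublevel n p q"
        unfolding sublevel_def sublevel_words_def using xs by (intro free.span_base UnI1) (auto intro!: exI[of _ xs] exI[of _ ts])
      then show ?thesis by (intro free.subspace_scale) auto
    qed (simp add: free.subspace_0)
    have "P w = (lin_ext (b_word A (Suc n)) (homotopy e w) + homotopy e (lin_ext (b_word A n) w)
        - fscale (\<sigma> * of_nat (crossings h ts)) w) - fscale (\<sigma> * (of_nat (Suc q) - of_nat (crossings h ts))) w"
      by (simp add: P_def right_diff_distrib free.scale_left_diff_distrib del: of_nat_Suc)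
    then show "P w \<in> sublevel n p q"
      using free.subspace_diff[OF subspace_sublevel 1 2] by simp
  qed
  moreover have "P r \<in> sublevel n p q"
  proof -
    have "lin_ext (b_word A n) r \<in> level (n - 1) p" by (rule b_level[OF ar(3)])
    then have "homotopy e (lin_ext (b_word A n) r) \<in> level n p"
      using homotopy_level[OF e(1), of _ "n - 1" p] n by simp
    moreover have "lin_ext (b_word A (Suc n)) (homotopy e r) \<in> level n p"
      using b_level[OF homotopy_level[OF e(1) ar(3)]] by simp
    ultimately have "P r \<in> level n p"
      unfolding P_def using ar(3) by (intro free.subspace_diff free.subspace_add free.subspace_scale) auto
    then show ?thesis using level_le_sublevel by blast
  qed
  ultimately have "P x \<in> sublevel n p q"
    unfolding ar(1) module_hom.add[OF hom] by (intro free.subspace_add) auto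
  then show ?thesis using e(1) unfolding P_def by blast
qed

text \<open>Up to lower terms, \<open>x\<close> is the boundary of \<open>D x\<close> divided by the number of crossings.  The summand
  \<open>D b x\<close> disappears, because \<open>D\<close> vanishes on words in the ideal.\<close>

lemma lower_crossings:
  assumes x: "x \<in> sublevel n p (Suc q)" and n: "0 < n" and bx: "lin_ext (b_word A n) x \<in> level (n - 1) 0"
  shows "\<exists>y\<in>level (Suc n) (Suc p). x - lin_ext (b_word A (Suc n)) y \<in> sublevel n p q"
proof -
  obtain e where e: "e \<in> I" and
    mem: "lin_ext (b_word A (Suc n)) (homotopy e x) + homotopy e (lin_ext (b_word A n) x)
      - fscale (\<sigma> * of_nat (Suc q)) x \<in> sublevel n p q"
    using homotopy_sublevel[OF x n] by blast
  define c where "c = \<sigma> * of_nat (Suc q)"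
  have "\<sigma> \<noteq> 0" unfolding \<sigma>_def by simp
  then have c: "c \<noteq> 0" unfolding c_def using of_nat_neq_0[of q] by simp
  have "homotopy e (lin_ext (b_word A n) x) \<in> cyclic_null A n"
    using homotopy_level_0[OF e bx] n by simp
  then have null: "homotopy e (lin_ext (b_word A n) x) \<in> sublevel n p q"
    using cyclic_null_le_level level_le_sublevel by blast
  have "fscale (- inverse c) ((lin_ext (b_word A (Suc n)) (homotopy e x) + homotopy e (lin_ext (b_word A n) x)
      - fscale c x) - homotopy e (lin_ext (b_word A n) x)) \<in> sublevel n p q"
    by (rule free.subspace_scale[OF subspace_sublevel free.subspace_diff[OF subspace_sublevel mem[folded c_def] null]])
  moreover have "fscale (- inverse c) ((lin_ext (b_word A (Suc n)) (homotopy e x) + homotopy e (lin_ext (b_word A n) x)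
      - fscale c x) - homotopy e (lin_ext (b_word A n) x))
    = x - lin_ext (b_word A (Suc n)) (fscale (inverse c) (homotopy e x))"
    using c by (simp add: lin_ext_linear free.scale_right_diff_distrib free.scale_right_distrib)
  moreover have "fscale (inverse c) (homotopy e x) \<in> level (Suc n) (Suc p)"
    by (intro free.subspace_scale subspace_level homotopy_level[OF e subsetD[OF sublevel_le_level x]])
  ultimately show ?thesis by metis
qed

lemma b_b_level_0:
  "y \<in> chain_space A (Suc n) \<Longrightarrow> lin_ext (b_word A n) (lin_ext (b_word A (Suc n)) y) \<in> level (n - 1) 0"
  using b_b_cyclic_null[of y "Suc n"] cyclic_null_le_level by auto

lemma lower_level:
  assumes n: "0 < n"
  shows "\<lbrakk>x \<in> sublevel n p q; lin_ext (b_word A n) x \<in> level (n - 1) 0\<rbrakk>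
    \<Longrightarrow> \<exists>y\<in>level (Suc n) (Suc p). x - lin_ext (b_word A (Suc n)) y \<in> level n p"
proof (induction q arbitrary: x)
  case 0
  then have "x - lin_ext (b_word A (Suc n)) 0 \<in> level n p" using sublevel_0 by auto
  then show ?case using free.subspace_0[OF subspace_level] by blast
next
  case (Suc q)
  obtain y where y: "y \<in> level (Suc n) (Suc p)" "x - lin_ext (b_word A (Suc n)) y \<in> sublevel n p q"
    using lower_crossings[OF Suc.prems(1) n Suc.prems(2)] by blast
  have "lin_ext (b_word A n) (x - lin_ext (b_word A (Suc n)) y) \<in> level (n - 1) 0"
    using Suc.prems(2) b_b_level_0[of y n] y(1) level_le_chains
    by (auto simp: lin_ext_linear intro!: free.subspace_diff)
  then obtain z where z: "z \<in> level (Suc n) (Suc p)"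
    "x - lin_ext (b_word A (Suc n)) y - lin_ext (b_word A (Suc n)) z \<in> level n p"
    using Suc.IH[OF y(2)] by blast
  have "x - lin_ext (b_word A (Suc n)) (y + z) \<in> level n p"
    using z(2) by (simp add: lin_ext_linear diff_diff_eq)
  then show ?case using y(1) z(1) free.subspace_add[OF subspace_level] by blast
qed

text \<open>The quotient of the relative complex by the complex of \<open>I\<close> is acyclic: here \<open>x\<close> represents a cycle of
  the quotient and \<open>y\<close> a chain of which it is the boundary.\<close>

theorem reduce_to_ideal:
  assumes "x \<in> level n p" "lin_ext (b_word A n) x \<in> level (n - 1) 0"
  shows "\<exists>y\<in>level (Suc n) p. x - lin_ext (b_word A (Suc n)) y \<in> level n 0"
proof (cases "n = 0")
  case True
  have "level 0 p \<subseteq> level 0 0"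
    unfolding level_def
  proof (rule free.span_mono)
    have "count_list ts False \<le> 0" if xs: "xs \<in> tuples A 0" "marking ts xs" "True \<in> set ts" for xs ts
    proof -
      obtain t where "ts = [t]" using xs(1) marking_length[OF xs(2)] by (cases ts) (auto simp: tuples_def)
      then show ?thesis using xs(3) by simp
    qed
    then show "{word xs |xs ts. xs \<in> tuples A 0 \<and> marking ts xs \<and> True \<in> set ts \<and> count_list ts False \<le> p} \<union> cyclic_null A 0
        \<subseteq> {word xs |xs ts. xs \<in> tuples A 0 \<and> marking ts xs \<and> True \<in> set ts \<and> count_list ts False \<le> 0} \<union> cyclic_null A 0"
      by blast
  qed
  then have "x - lin_ext (b_word A (Suc n)) 0 \<in> level n 0" using assms True by auto
  then show ?thesis using free.subspace_0[OF subspace_level] by blast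
next
  case False
  then have n: "0 < n" by simp
  show ?thesis using assms
  proof (induction p arbitrary: x)
    case 0
    then have "x - lin_ext (b_word A (Suc n)) 0 \<in> level n 0" by simp
    then show ?case using free.subspace_0[OF subspace_level] by blast
  next
    case (Suc p)
    obtain y where y: "y \<in> level (Suc n) (Suc p)" "x - lin_ext (b_word A (Suc n)) y \<in> level n p"
      using lower_level[OF n _ Suc.prems(2)] level_le_top_sublevel Suc.prems(1) by blast
    have "lin_ext (b_word A n) (x - lin_ext (b_word A (Suc n)) y) \<in> level (n - 1) 0"
      using Suc.prems(2) b_b_level_0[of y n] y(1) level_le_chains
      by (auto simp: lin_ext_linear intro!: free.subspace_diff)
    then obtain z where z: "z \<in> level (Suc n) p"
      "x - lin_ext (b_word A (Suc n)) y - lin_ext (b_word A (Suc n)) z \<in> level n 0"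
      using Suc.IH[OF y(2)] by blast
    have "x - lin_ext (b_word A (Suc n)) (y + z) \<in> level n 0"
      using z(2) by (simp add: lin_ext_linear diff_diff_eq)
    moreover have "y + z \<in> level (Suc n) (Suc p)"
      using y(1) z(1) level_mono[of p "Suc p"] by (intro free.subspace_add) auto
    ultimately show ?case by blast
  qed
qed

end


section \<open>Presentations of homology\<close>

lemma a_r_coset_carrier_update: "H +>\<^bsub>M\<lparr>carrier := X\<rparr>\<^esub> x = H +>\<^bsub>M\<^esub> x"
  by (simp add: a_r_coset_def')

text \<open>Chain complexes are presented degreewise, with a differential that is covered by the linear
  maps \<open>g m\<close>.\<close>

locale complex_presentation =
  fixes F K :: "nat \<Rightarrow> ('x \<Rightarrow>\<^sub>0 'k::field) set" and c :: "nat \<Rightarrow> ('x \<Rightarrow>\<^sub>0 'k) \<Rightarrow> 'm"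
    and M :: "nat \<Rightarrow> ('k, 'm) module" and d :: "nat \<Rightarrow> 'm \<Rightarrow> 'm" and g :: "nat \<Rightarrow> ('x \<Rightarrow>\<^sub>0 'k) \<Rightarrow> ('x \<Rightarrow>\<^sub>0 'k)"
  assumes pres: "presentation (F m) (K m) (c m) (M m)"
    and hom_g: "module_hom fscale fscale (g m)"
    and d_class: "f \<in> F m \<Longrightarrow> d m (c m f) = c (m - 1) (g m f)"
    and g_F: "f \<in> F m \<Longrightarrow> g m f \<in> F (m - 1)"
    and g_K: "f \<in> K m \<Longrightarrow> g m f \<in> K (m - 1)"
    and g_g: "f \<in> F (Suc m) \<Longrightarrow> g m (g (Suc m) f) \<in> K (m - 1)"
begin

definition Z :: "nat \<Rightarrow> ('x \<Rightarrow>\<^sub>0 'k) set" where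
  "Z n = {f \<in> F n. g n f \<in> K (n - 1)}"

definition B :: "nat \<Rightarrow> ('x \<Rightarrow>\<^sub>0 'k) set" where
  "B n = {g (Suc n) y + z | y z. y \<in> F (Suc n) \<and> z \<in> K n}"

lemma subspace_Z: "free.subspace (Z n)"
proof -
  have "Z n = F n \<inter> {f. g n f \<in> K (n - 1)}" by (auto simp: Z_def)
  moreover have "free.subspace {f. g n f \<in> K (n - 1)}"
    by (rule module_hom.subspace_linear_preimage[OF hom_g presentation.subspace_K[OF pres]])
  ultimately show ?thesis using free.subspace_inter presentation.subspace_F[OF pres] by metis
qed

lemma subspace_B: "free.subspace (B n)"
proof (rule free.subspaceI)
  note sF = presentation.subspace_F[OF pres] and sK = presentation.subspace_K[OF pres]
  have "0 = g (Suc n) 0 + 0" using module_hom.zero[OF hom_g] by simp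
  then show "0 \<in> B n" unfolding B_def using free.subspace_0[OF sF] free.subspace_0[OF sK] by blast
  fix x y assume "x \<in> B n" "y \<in> B n"
  then obtain a z a' z' where *: "a \<in> F (Suc n)" "z \<in> K n" "a' \<in> F (Suc n)" "z' \<in> K n"
    "x = g (Suc n) a + z" "y = g (Suc n) a' + z'" unfolding B_def by blast
  then have "x + y = g (Suc n) (a + a') + (z + z')" by (simp add: module_hom.add[OF hom_g])
  moreover have "a + a' \<in> F (Suc n)" "z + z' \<in> K n"
    using * free.subspace_add[OF sF] free.subspace_add[OF sK] by auto
  ultimately show "x + y \<in> B n" unfolding B_def by blast
next
  fix r x assume "x \<in> B n"
  then obtain a z where *: "a \<in> F (Suc n)" "z \<in> K n" "x = g (Suc n) a + z" unfolding B_def by blast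
  then have "fscale r x = g (Suc n) (fscale r a) + fscale r z"
    by (simp add: module_hom.scale[OF hom_g] free.scale_right_distrib)
  moreover have "fscale r a \<in> F (Suc n)" "fscale r z \<in> K n"
    using * free.subspace_scale presentation.subspace_F[OF pres] presentation.subspace_K[OF pres] by blast+
  ultimately show "fscale r x \<in> B n" unfolding B_def by blast
qed

lemma K_le_B: "K n \<subseteq> B n"
proof
  fix z assume "z \<in> K n"
  moreover have "z = g (Suc n) 0 + z" using module_hom.zero[OF hom_g] by simp
  ultimately show "z \<in> B n"
    unfolding B_def using free.subspace_0[OF presentation.subspace_F[OF pres]] by blast
qed

lemma B_le_F: "B n \<subseteq> F n"
proof
  fix x assume "x \<in> B n"
  then obtain y z where *: "y \<in> F (Suc n)" "z \<in> K n" "x = g (Suc n) y + z" unfolding B_def by blast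
  have "g (Suc n) y \<in> F n" "z \<in> F n"
    using g_F[OF *(1)] *(2) presentation.K_le[OF pres] by auto
  then show "x \<in> F n" unfolding *(3) by (rule free.subspace_add[OF presentation.subspace_F[OF pres]])
qed

lemma B_le_Z: "B n \<subseteq> Z n"
proof
  fix x assume x: "x \<in> B n"
  then obtain y z where *: "y \<in> F (Suc n)" "z \<in> K n" "x = g (Suc n) y + z" unfolding B_def by blast
  have "g n x \<in> K (n - 1)"
    unfolding *(3) module_hom.add[OF hom_g]
    by (rule free.subspace_add[OF presentation.subspace_K[OF pres] g_g[OF *(1)] g_K[OF *(2)]])
  then show "x \<in> Z n" using B_le_F x by (auto simp: Z_def)
qed

lemma cycles_eq: "cycles M d n = c n ` Z n"
proof -
  have "x \<in> cycles M d n \<longleftrightarrow> x \<in> c n ` Z n" for x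
  proof -
    have "x \<in> cycles M d n \<longleftrightarrow> x \<in> c n ` F n \<and> d n x = \<zero>\<^bsub>M (n - 1)\<^esub>"
      by (simp add: cycles_def a_kernel_def' presentation.carrier_eq[OF pres])
    also have "\<dots> \<longleftrightarrow> (\<exists>f\<in>F n. x = c n f \<and> g n f \<in> K (n - 1))"
      using d_class presentation.class_zero_iff[OF pres g_F] by auto
    finally show ?thesis by (auto simp: Z_def)
  qed
  then show ?thesis by blast
qed

lemma boundaries_eq: "boundaries M d n = c n ` B n"
proof -
  have d: "d (Suc n) (c (Suc n) y) = c n (g (Suc n) y)" if "y \<in> F (Suc n)" for y
    using d_class[OF that] by simp
  have k: "c n (g (Suc n) y + z) = c n (g (Suc n) y)" if y: "y \<in> F (Suc n)" and z: "z \<in> K n" for y z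
  proof -
    have "g (Suc n) y \<in> F n" using g_F[OF y] by simp
    moreover have "g (Suc n) y + z \<in> F n" using B_le_F y z unfolding B_def by blast
    ultimately show ?thesis using presentation.class_eq[OF pres] z by simp
  qed
  have "boundaries M d n = (\<lambda>y. c n (g (Suc n) y)) ` F (Suc n)"
    unfolding boundaries_def presentation.carrier_eq[OF pres] image_image using d by (intro image_cong) auto
  also have "\<dots> = c n ` B n"
  proof
    show "(\<lambda>y. c n (g (Suc n) y)) ` F (Suc n) \<subseteq> c n ` B n"
    proof
      fix x assume "x \<in> (\<lambda>y. c n (g (Suc n) y)) ` F (Suc n)"
      then obtain y where y: "y \<in> F (Suc n)" "x = c n (g (Suc n) y + 0)" by auto
      moreover have "g (Suc n) y + 0 \<in> B n"
        unfolding B_def using y(1) free.subspace_0[OF presentation.subspace_K[OF pres]] by blast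
      ultimately show "x \<in> c n ` B n" by blast
    qed
    show "c n ` B n \<subseteq> (\<lambda>y. c n (g (Suc n) y)) ` F (Suc n)"
      unfolding B_def using k by auto
  qed
  finally show ?thesis .
qed

lemma presentation_homology:
  "presentation (Z n) (B n) (\<lambda>f. boundaries M d n +>\<^bsub>M n\<^esub> c n f) (homology M d n)"
proof -
  have "presentation (Z n) (K n) (c n) ((M n)\<lparr>carrier := c n ` Z n\<rparr>)"
    by (rule presentation.presentation_subspace[OF pres subspace_Z])
      (use K_le_B B_le_Z in \<open>auto simp: Z_def\<close>)
  from presentation.presentation_quot[OF this subspace_B K_le_B B_le_Z] show ?thesis
    by (simp add: homology_def cycles_eq boundaries_eq a_r_coset_carrier_update)
qed

end


section \<open>Excision\<close>

lemma word_map_ident: "word_map (\<lambda>xs. xs) f = f"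
proof (rule hom_eq_on_span[OF module_hom_word_map])
  show "f \<in> free.span (word ` UNIV)" by (simp add: span_singles)
  show "module_hom fscale fscale (\<lambda>f. f)" by unfold_locales simp_all
qed auto

context ideal_extension
begin

abbreviation J :: "('k, 'a) module" where "J \<equiv> subalg A I"

lemma weak_algebra_ideal: "weak_algebra_char_0 J"
proof -
  have "weak_algebra J"
  proof
    show "closed_carrier J" by (rule ideal_closed)
    fix x y assume xy: "x \<in> carrier J" "y \<in> carrier J"
    then show "x \<otimes>\<^bsub>J\<^esub> y \<in> carrier J" using ideal_left ideal_le by auto
    fix z assume "z \<in> carrier J"
    then show "x \<otimes>\<^bsub>J\<^esub> y \<otimes>\<^bsub>J\<^esub> z = x \<otimes>\<^bsub>J\<^esub> (y \<otimes>\<^bsub>J\<^esub> z)"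
      using xy times_assoc[of x y z] ideal_le by auto
  next
    fix y assume "y \<in> carrier J"
    then have y: "y \<in> I" "y \<in> carrier A" using ideal_le by auto
    show "linear_on J J (\<lambda>x. x \<otimes>\<^bsub>J\<^esub> y)"
      using linear_times_right[OF y(2)] ideal_left[OF _ y(1)] ideal_le by (simp add: linear_on_def subset_iff)
    show "linear_on J J (\<lambda>x. y \<otimes>\<^bsub>J\<^esub> x)"
      using linear_times_left[OF y(2)] ideal_right[OF _ y(1)] ideal_le by (simp add: linear_on_def subset_iff)
  qed
  then show ?thesis by (simp add: weak_algebra_char_0_def)
qed

sublocale J: weak_algebra_char_0 J
  by (rule weak_algebra_ideal)

lemma b_word_ideal: "b_word J n = b_word A n"
  by (simp add: b_word_def fun_eq_iff)

lemma linear_inclusion: "linear_on J A (\<lambda>x. x)"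
  using ideal_le by (auto simp: linear_on_def)

lemma cyclic_null_ideal_le: "cyclic_null J n \<subseteq> cyclic_null A n"
  using map_cyclic_null[OF ideal_closed linear_inclusion] by (auto simp: word_map_ident)

text \<open>The projection \<open>\<pi>\<close> is linear, so it retracts the coinvariants of \<open>A\<close> onto those of \<open>I\<close>.\<close>

lemma cyclic_null_ideal:
  assumes "x \<in> chain_space J n" "x \<in> cyclic_null A n"
  shows "x \<in> cyclic_null J n"
proof -
  have "word_map (map \<pi>) x = word_map (\<lambda>xs. xs) x"
  proof (rule hom_eq_on_chains[OF module_hom_word_map module_hom_word_map _ assms(1)])
    fix xs assume "xs \<in> tuples J n"
    then have "map \<pi> xs = xs" using \<pi>_ideal by (auto simp: tuples_def intro!: map_idI)
    then show "word_map (map \<pi>) (word xs) = word_map (\<lambda>xs. xs) (word xs)" by simp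
  qed
  then show ?thesis
    using map_cyclic_null[OF closed linear_\<pi> assms(2)] by (simp add: word_map_ident)
qed

lemma chains_ideal_le_level: "chain_space J n \<subseteq> level n 0"
  unfolding chains_span[of J]
proof (rule free.span_minimal)
  show "word ` tuples J n \<subseteq> level n 0"
  proof clarify
    fix xs assume xs: "xs \<in> tuples J n"
    let ?T = "\<lambda>ys :: 'a list. replicate (length ys) True"
    have m: "marking (?T ys) ys" if "set ys \<subseteq> I" for ys using that ideal_le by (induction ys) auto
    have k: "count_list (replicate k True) False \<le> 0" for k by (induction k) auto
    show "word xs \<in> level n 0"
    proof (rule level_word)
      show "marking (?T xs) xs" by (rule m) (use xs in \<open>simp add: tuples_def\<close>)
    qed (use xs k ideal_le in \<open>auto simp: tuples_def\<close>)
  qed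
qed simp

lemma level_0_decompose:
  assumes "x \<in> level n 0"
  shows "\<exists>z\<in>chain_space J n. x - z \<in> cyclic_null A n"
proof -
  let ?S = "{word xs | xs ts. xs \<in> tuples A n \<and> marking ts xs \<and> True \<in> set ts \<and> count_list ts False \<le> 0} :: ('a list \<Rightarrow>\<^sub>0 'k) set"
  obtain z y where zy: "x = z + y" "z \<in> free.span ?S" "y \<in> free.span (cyclic_null A n)"
    using assms unfolding level_def free.span_Un by blast
  have "?S \<subseteq> chain_space J n"
  proof
    fix w assume "w \<in> ?S"
    then obtain xs ts where *: "xs \<in> tuples A n" "marking ts xs" "count_list ts False \<le> 0" "w = word xs"
      by blast
    have "set xs \<subseteq> I" using marking_no_False[OF *(2)] *(3) by (simp add: count_list_0_iff)
    then show "w \<in> chain_space J n" using *(1,4) by (simp add: tuples_def)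
  qed
  then have "z \<in> chain_space J n" using zy(2) free.span_minimal[OF _ subspace_chain_space] by blast
  moreover have "y \<in> cyclic_null A n" using zy(3) by (simp add: cyclic_null_def free.span_span)
  ultimately show ?thesis using zy(1) by (intro bexI[of _ z]) auto
qed

end

locale ideal_extension_quotient = ideal_extension A I \<pi> \<nu> h
  for A :: "('k::field_char_0, 'a) module" (structure) and I \<pi> \<nu> h +
  fixes \<phi> :: "'a \<Rightarrow> 'a set" and s :: "'a set \<Rightarrow> 'a"
  assumes \<phi>_eq: "\<phi> = (\<lambda>a. I +>\<^bsub>A\<^esub> a)"
    and quot_closed: "closed_carrier (quot A I)"
    and linear_\<phi>: "linear_on A (quot A I) \<phi>"
    and \<phi>_ideal: "x \<in> I \<Longrightarrow> \<phi> x = \<phi> \<zero>"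
    and linear_s: "linear_on (quot A I) A s"
    and s_\<phi>: "x \<in> carrier A \<Longrightarrow> s (\<phi> x) = \<nu> x"
begin

definition relative :: "nat \<Rightarrow> ('a list \<Rightarrow>\<^sub>0 'k) set" where
  "relative n = {f \<in> chain_space A n. word_map (map \<phi>) f \<in> cyclic_null (quot A I) n}"

text \<open>A letter of \<open>I\<close> becomes zero in \<open>A/I\<close>.\<close>

lemma level_le_relative: "level n p \<subseteq> relative n"
proof
  fix x assume x: "x \<in> level n p"
  have "word_map (map \<phi>) x \<in> cyclic_null (quot A I) n"
  proof (rule hom_level[OF module_hom_word_map subspace_cyclic_null _ map_cyclic_null[OF closed linear_\<phi>] x])
    fix xs ts assume xs: "xs \<in> tuples A n" and m: "marking ts xs" "True \<in> set ts"
    from m have "\<exists>x\<in>set xs. x \<in> I"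
      unfolding marking_def by (induction rule: list_all2_induct) auto
    then obtain us x vs where d: "xs = us @ x # vs" "x \<in> I" by (meson split_list)
    have "\<phi> \<zero> = 0 \<odot>\<^bsub>quot A I\<^esub> \<phi> \<zero>"
      using linear_\<phi> zero_carrier scale_zero[OF zero_carrier] unfolding linear_on_def by metis
    then have "map \<phi> xs = map \<phi> us @ (0 \<odot>\<^bsub>quot A I\<^esub> \<phi> \<zero>) # map \<phi> vs"
      using d \<phi>_ideal by simp
    moreover have "map \<phi> us @ \<phi> \<zero> # map \<phi> vs \<in> tuples (quot A I) n"
      using xs d zero_carrier linear_\<phi> by (auto simp: tuples_def linear_on_def)
    ultimately show "word_map (map \<phi>) (word xs) \<in> cyclic_null (quot A I) n"
      using tensor_null_zero_letter tensor_null_le_cyclic_null by fastforce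
  qed
  then show "x \<in> relative n" using x level_le_chains by (auto simp: relative_def)
qed

text \<open>A linear section \<open>s\<close> carries the relations of \<open>A/I\<close> back to relations of \<open>A\<close>, and \<open>s \<circ> \<phi> = \<nu>\<close>.\<close>

lemma relative_le_level: "relative n \<subseteq> level n n"
proof
  fix x assume "x \<in> relative n"
  then have x: "x \<in> chain_space A n" "word_map (map \<phi>) x \<in> cyclic_null (quot A I) n"
    by (auto simp: relative_def)
  have "word_map (map s) (word_map (map \<phi>) x) \<in> cyclic_null A n"
    by (rule map_cyclic_null[OF quot_closed linear_s x(2)])
  moreover have "word_map (map s) (word_map (map \<phi>) x) = word_map (map \<nu>) x"
    unfolding word_map_comp
  proof (rule hom_eq_on_chains[OF module_hom_word_map module_hom_word_map _ x(1)])
    fix xs assume "xs \<in> tuples A n"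
    then have "map s (map \<phi> xs) = map \<nu> xs" using s_\<phi> by (auto simp: tuples_def)
    then show "word_map (\<lambda>xs. map s (map \<phi> xs)) (word xs) = word_map (map \<nu>) (word xs)"
      by (simp only: word_map_word)
  qed
  ultimately have "word_map (map \<nu>) x \<in> level n n" using cyclic_null_le_level by auto
  from free.subspace_add[OF subspace_level map_\<nu>_level[OF x(1)] this] show "x \<in> level n n" by simp
qed

lemma relative_eq_level: "relative n = level n n"
  using relative_le_level level_le_relative by blast

lemma presentation_CC_rel:
  "presentation (relative n) (cyclic_null A n) (cyclic_class A n) (CC_rel A I n)"
proof -
  note A = presentation_CC[OF closed, of n] and Q = presentation_CC[OF quot_closed, of n]
  have "a_kernel (CC A n) (CC (quot A I) n) (CC_map (quot A I) \<phi> n) = cyclic_class A n ` relative n"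
  proof -
    have "x \<in> a_kernel (CC A n) (CC (quot A I) n) (CC_map (quot A I) \<phi> n)
        \<longleftrightarrow> (\<exists>f\<in>chain_space A n. x = cyclic_class A n f \<and> CC_map (quot A I) \<phi> n x = \<zero>\<^bsub>CC (quot A I) n\<^esub>)" for x
      by (auto simp: a_kernel_def' presentation.carrier_eq[OF A])
    moreover have "CC_map (quot A I) \<phi> n (cyclic_class A n f) = \<zero>\<^bsub>CC (quot A I) n\<^esub> \<longleftrightarrow> f \<in> relative n"
      if f: "f \<in> chain_space A n" for f
      using CC_map_class[OF closed quot_closed linear_\<phi> f]
        presentation.class_zero_iff[OF Q word_map_chains[OF slotwise_map[OF linear_\<phi>] f]] f
      by (simp add: relative_def)
    ultimately show ?thesis by (auto simp: relative_def)
  qed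
  then have "CC_rel A I n = (CC A n)\<lparr>carrier := cyclic_class A n ` relative n\<rparr>"
    by (simp add: CC_rel_def \<phi>_eq)
  moreover have "cyclic_null A n \<subseteq> relative n" "relative n \<subseteq> chain_space A n" "free.subspace (relative n)"
    using cyclic_null_le_level level_le_chains by (simp_all add: relative_eq_level)
  ultimately show ?thesis
    using presentation.presentation_subspace[OF A] by simp
qed

sublocale abs: complex_presentation "chain_space J" "cyclic_null J" "cyclic_class J" "CC J" "CC_b J"
  "\<lambda>n. lin_ext (b_word J n)"
proof (rule complex_presentation.intro)
  show "lin_ext (b_word J m) (lin_ext (b_word J (Suc m)) f) \<in> cyclic_null J (m - 1)"
    if "f \<in> chain_space J (Suc m)" for f m
    using J.b_b_cyclic_null[OF that] by simp
qed (use presentation_CC[OF ideal_closed] module_hom_lin_ext J.CC_b_class J.b_chains J.b_cyclic_null in auto)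

sublocale rel: complex_presentation relative "cyclic_null A" "cyclic_class A" "CC_rel A I" "CC_b A"
  "\<lambda>n. lin_ext (b_word A n)"
proof (rule complex_presentation.intro)
  have le: "f \<in> chain_space A m" if "f \<in> relative m" for f m using that by (simp add: relative_def)
  show "lin_ext (b_word A m) (lin_ext (b_word A (Suc m)) f) \<in> cyclic_null A (m - 1)"
    if "f \<in> relative (Suc m)" for f m
    using b_b_cyclic_null[OF le[OF that]] by simp
  show "lin_ext (b_word A m) f \<in> relative (m - 1)" if "f \<in> relative m" for f m
    using b_level[of f m m] that level_le_relative relative_le_level by blast
  show "CC_b A m (cyclic_class A m f) = cyclic_class A (m - 1) (lin_ext (b_word A m) f)" if "f \<in> relative m" for f m
    by (rule CC_b_class[OF le[OF that]])
qed (use presentation_CC_rel module_hom_lin_ext b_cyclic_null in auto)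

text \<open>A chain \<open>y\<close> of the relative complex with boundary \<open>z\<close> is a cycle modulo the complex of \<open>I\<close>.  By
  \<open>reduce_to_ideal\<close> it differs from a chain \<open>v\<close> of \<open>I\<close> by a boundary, so that \<open>z\<close> is the boundary of \<open>v\<close> as well.\<close>

lemma boundary_in_ideal:
  assumes z: "z \<in> chain_space J n" "z \<in> rel.B n"
  shows "z \<in> abs.B n"
proof -
  obtain y k where y: "y \<in> relative (Suc n)" "k \<in> cyclic_null A n" "z = lin_ext (b_word A (Suc n)) y + k"
    using z(2) unfolding rel.B_def by blast
  have "lin_ext (b_word A (Suc n)) y = z - k" using y(3) by simp
  moreover have "z - k \<in> level n 0"
    using free.subspace_diff[OF subspace_level subsetD[OF chains_ideal_le_level z(1)]
      subsetD[OF cyclic_null_le_level y(2)]] .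
  ultimately obtain y' where y': "y' \<in> level (Suc (Suc n)) (Suc n)"
    "y - lin_ext (b_word A (Suc (Suc n))) y' \<in> level (Suc n) 0"
    using reduce_to_ideal[of y "Suc n" "Suc n"] y(1) relative_le_level by auto
  then obtain v where v: "v \<in> chain_space J (Suc n)"
    "y - lin_ext (b_word A (Suc (Suc n))) y' - v \<in> cyclic_null A (Suc n)"
    using level_0_decompose by blast
  define w where "w = z - lin_ext (b_word J (Suc n)) v"
  have "w = k + lin_ext (b_word A (Suc n)) (lin_ext (b_word A (Suc (Suc n))) y')
      + lin_ext (b_word A (Suc n)) (y - lin_ext (b_word A (Suc (Suc n))) y' - v)"
    by (simp add: w_def y(3) lin_ext_linear b_word_ideal)
  moreover have "lin_ext (b_word A (Suc n)) (lin_ext (b_word A (Suc (Suc n))) y') \<in> cyclic_null A n"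
    using b_b_cyclic_null[of y' "Suc (Suc n)"] y'(1) level_le_chains by auto
  moreover have "lin_ext (b_word A (Suc n)) (y - lin_ext (b_word A (Suc (Suc n))) y' - v) \<in> cyclic_null A n"
    using b_cyclic_null[OF v(2)] by simp
  ultimately have "w \<in> cyclic_null A n"
    using y(2) by (simp only: free.subspace_add[OF subspace_cyclic_null])
  moreover have "w \<in> chain_space J n"
    unfolding w_def using J.b_chains[OF v(1)] z(1) by (intro free.subspace_diff) auto
  ultimately have "w \<in> cyclic_null J n" by (rule cyclic_null_ideal[rotated])
  moreover have "z = lin_ext (b_word J (Suc n)) v + w" by (simp add: w_def)
  ultimately show ?thesis unfolding abs.B_def using v(1) by blast
qed

lemma cycle_homologous_to_ideal:
  assumes f: "f \<in> rel.Z n"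
  shows "\<exists>z\<in>abs.Z n. f - z \<in> rel.B n"
proof -
  have f': "f \<in> relative n" "lin_ext (b_word A n) f \<in> cyclic_null A (n - 1)"
    using f by (auto simp: rel.Z_def)
  have "f \<in> level n n" "lin_ext (b_word A n) f \<in> level (n - 1) 0"
    using f' relative_le_level cyclic_null_le_level by blast+
  then obtain y where y: "y \<in> level (Suc n) n" "f - lin_ext (b_word A (Suc n)) y \<in> level n 0"
    using reduce_to_ideal by blast
  then obtain z where z: "z \<in> chain_space J n" "f - lin_ext (b_word A (Suc n)) y - z \<in> cyclic_null A n"
    using level_0_decompose by blast
  have "lin_ext (b_word A n) z = lin_ext (b_word A n) f - lin_ext (b_word A n) (lin_ext (b_word A (Suc n)) y)
      - lin_ext (b_word A n) (f - lin_ext (b_word A (Suc n)) y - z)"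
    by (simp add: lin_ext_linear)
  moreover have "lin_ext (b_word A n) (lin_ext (b_word A (Suc n)) y) \<in> cyclic_null A (n - 1)"
    using b_b_cyclic_null[of y "Suc n"] y(1) level_le_chains by auto
  ultimately have "lin_ext (b_word A n) z \<in> cyclic_null A (n - 1)"
    using f'(2) b_cyclic_null[OF z(2)] by (simp only: free.subspace_diff[OF subspace_cyclic_null])
  then have "lin_ext (b_word J n) z \<in> cyclic_null J (n - 1)"
    using cyclic_null_ideal J.b_chains[OF z(1)] by (simp add: b_word_ideal)
  then have "z \<in> abs.Z n" using z(1) by (simp add: abs.Z_def)
  moreover have "f - z = lin_ext (b_word A (Suc n)) y + (f - lin_ext (b_word A (Suc n)) y - z)" by simp
  then have "f - z \<in> rel.B n"
    unfolding rel.B_def using y(1) z(2) level_le_relative by blast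
  ultimately show ?thesis by blast
qed

lemma abs_le_rel: "chain_space J n \<subseteq> relative n" "abs.Z n \<subseteq> rel.Z n" "abs.B n \<subseteq> rel.B n"
proof -
  show le: "chain_space J n \<subseteq> relative n" for n
    using chains_ideal_le_level level_le_relative by blast
  show "abs.Z n \<subseteq> rel.Z n"
    using le cyclic_null_ideal_le unfolding abs.Z_def rel.Z_def unfolding b_word_ideal by blast
  show "abs.B n \<subseteq> rel.B n"
    using le cyclic_null_ideal_le unfolding abs.B_def rel.B_def unfolding b_word_ideal by blast
qed

theorem excision: "linear_iso (HC J n) (HC_rel A I n) (excision_map A I n)"
proof -
  have on_class: "excision_map A I n (boundaries (CC J) (CC_b J) n +>\<^bsub>CC J n\<^esub> cyclic_class J n f)
      = boundaries (CC_rel A I) (CC_b A) n +>\<^bsub>CC_rel A I n\<^esub> cyclic_class A n f" if f: "f \<in> abs.Z n" for f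
    unfolding excision_map_def abs.boundaries_eq rel.boundaries_eq
  proof (rule induced_class[OF abs.pres rel.pres abs.subspace_B abs.K_le_B abs.B_le_F
      rel.subspace_B rel.K_le_B rel.B_le_F])
    show "CC_map A (\<lambda>x. x) n (cyclic_class J n f) = cyclic_class A n f" if "f \<in> chain_space J n" for f
      using CC_map_class[OF ideal_closed closed linear_inclusion that] by (simp add: word_map_ident)
    show "module_hom fscale fscale (\<lambda>f. f)" by unfold_locales simp_all
    show "f \<in> chain_space J n" using f by (simp add: abs.Z_def)
  qed (use abs_le_rel in blast)+
  show ?thesis
    unfolding HC_def HC_rel_def
  proof (rule linear_iso_presentations[OF abs.presentation_homology rel.presentation_homology on_class])
    show "abs.Z n \<inter> rel.B n \<subseteq> abs.B n" using boundary_in_ideal by (auto simp: abs.Z_def)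
  qed (use abs_le_rel cycle_homologous_to_ideal in auto)
qed

end


section \<open>Linear projections and quotients of algebras\<close>

context assoc_algebra
begin

lemma scale_closed: "x \<in> carrier A \<Longrightarrow> a \<odot> x \<in> carrier A"
  using smult_closed[of a x] by (simp add: ground_field_def)

lemma scale_add: "\<lbrakk>x \<in> carrier A; y \<in> carrier A\<rbrakk> \<Longrightarrow> a \<odot> (x \<oplus> y) = a \<odot> x \<oplus> a \<odot> y"
  using smult_r_distr[of a x y] by (simp add: ground_field_def)

lemma add_scale: "x \<in> carrier A \<Longrightarrow> (a + b) \<odot> x = a \<odot> x \<oplus> b \<odot> x"
  using smult_l_distr[of a b x] by (simp add: ground_field_def)

lemma scale_scale: "x \<in> carrier A \<Longrightarrow> (a * b) \<odot> x = a \<odot> (b \<odot> x)"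
  using smult_assoc1[of a b x] by (simp add: ground_field_def)

lemma one_scale: "x \<in> carrier A \<Longrightarrow> 1 \<odot> x = x"
  using smult_one[of x] by (simp add: ground_field_def)

lemma zero_scale: "x \<in> carrier A \<Longrightarrow> 0 \<odot> x = \<zero>"
  using smult_l_null[of x] by (simp add: ground_field_def)

lemma closed_carrier: "closed_carrier A"
  by (simp add: closed_carrier_def scale_closed)

lemma weak_algebra: "weak_algebra A"
  by unfold_locales (simp_all add: closed_carrier mult_closed mult_assoc linear_on_def
      mult_l_distr mult_r_distr smult_mult_left smult_mult_right)

text \<open>The value of a formal linear combination of elements of \<open>A\<close>.  Through it, \<open>A\<close> is a quotient of a
  free vector space, where subspaces are known to have linear projections.\<close>

definition ev :: "('a \<Rightarrow>\<^sub>0 'k) \<Rightarrow> 'a" where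
  "ev f = (\<Oplus>x\<in>Poly_Mapping.keys f. Poly_Mapping.lookup f x \<odot> x)"

lemma ev_superset:
  assumes "finite S" "S \<subseteq> carrier A" "Poly_Mapping.keys f \<subseteq> S"
  shows "ev f = (\<Oplus>x\<in>S. Poly_Mapping.lookup f x \<odot> x)"
  unfolding ev_def
proof (rule add.finprod_mono_neutral_cong_left)
  show "Poly_Mapping.lookup f i \<odot> i = \<zero>" if "i \<in> S - Poly_Mapping.keys f" for i
    using that assms zero_scale by (auto simp: in_keys_iff)
qed (use assms in \<open>auto simp: scale_closed\<close>)

lemma ev_closed: "Poly_Mapping.keys f \<subseteq> carrier A \<Longrightarrow> ev f \<in> carrier A"
  unfolding ev_def by (rule finsum_closed) (auto simp: scale_closed)

lemma ev_add:
  assumes "Poly_Mapping.keys f \<subseteq> carrier A" "Poly_Mapping.keys g \<subseteq> carrier A"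
  shows "ev (f + g) = ev f \<oplus> ev g"
proof -
  let ?S = "Poly_Mapping.keys f \<union> Poly_Mapping.keys g"
  have S: "finite ?S" "?S \<subseteq> carrier A" using assms by auto
  have "ev (f + g) = (\<Oplus>x\<in>?S. Poly_Mapping.lookup (f + g) x \<odot> x)"
    by (rule ev_superset[OF S keys_add])
  also have "\<dots> = (\<Oplus>x\<in>?S. Poly_Mapping.lookup f x \<odot> x \<oplus> Poly_Mapping.lookup g x \<odot> x)"
    by (rule add.finprod_cong') (use S in \<open>auto simp: lookup_add add_scale scale_closed subset_iff\<close>)
  also have "\<dots> = (\<Oplus>x\<in>?S. Poly_Mapping.lookup f x \<odot> x) \<oplus> (\<Oplus>x\<in>?S. Poly_Mapping.lookup g x \<odot> x)"
    by (rule finsum_addf) (use S in \<open>auto simp: scale_closed subset_iff\<close>)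
  finally show ?thesis using ev_superset[OF S, of f] ev_superset[OF S, of g] by simp
qed

lemma ev_scale:
  assumes "Poly_Mapping.keys f \<subseteq> carrier A"
  shows "ev (fscale a f) = a \<odot> ev f"
proof -
  let ?S = "Poly_Mapping.keys f"
  have "Poly_Mapping.keys (fscale a f) \<subseteq> ?S" by (auto simp: in_keys_iff lookup_fscale)
  then have "ev (fscale a f) = (\<Oplus>x\<in>?S. Poly_Mapping.lookup (fscale a f) x \<odot> x)"
    using assms by (intro ev_superset) auto
  also have "\<dots> = (\<Oplus>x\<in>?S. a \<odot> (Poly_Mapping.lookup f x \<odot> x))"
    by (rule add.finprod_cong') (use assms in \<open>auto simp: lookup_fscale scale_scale scale_closed subset_iff\<close>)
  also have "\<dots> = a \<odot> ev f"
    unfolding ev_def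
    by (rule finsum_smult_ldistr[symmetric]) (use assms in \<open>auto simp: ground_field_def scale_closed subset_iff\<close>)
  finally show ?thesis .
qed

lemma ev_single: "x \<in> carrier A \<Longrightarrow> ev (Poly_Mapping.single x 1) = x"
  by (simp add: ev_def one_scale scale_closed)

lemma scale_minus_one: "x \<in> carrier A \<Longrightarrow> (-1) \<odot> x = \<ominus> x"
  using add_scale[of x "-1" 1] zero_scale[of x] one_scale[of x] scale_closed[of x "-1"]
  by (intro minus_equality[symmetric]) simp_all

lemma ev_zero: "ev 0 = \<zero>"
  by (simp add: ev_def)

lemma linear_projection_exists:
  assumes I: "I \<subseteq> carrier A" "closed_carrier (subalg A I)" "\<zero> \<in> I"
  shows "\<exists>\<pi>. linear_on A (subalg A I) \<pi> \<and> (\<forall>x\<in>I. \<pi> x = x)"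
proof -
  define U where "U = {f :: 'a \<Rightarrow>\<^sub>0 'k. Poly_Mapping.keys f \<subseteq> carrier A}"
  define J where "J = {f \<in> U. ev f \<in> I}"
  have U: "free.subspace U"
    unfolding U_def by (rule presentation.subspace_F[OF presentation_free_space])
  have J: "free.subspace J"
  proof (rule free.subspaceI)
    show "0 \<in> J" using free.subspace_0[OF U] I(3) by (simp add: J_def ev_zero)
    show "f + g \<in> J" if "f \<in> J" "g \<in> J" for f g
      using that free.subspace_add[OF U] ev_add[of f g] I(2) by (auto simp: J_def U_def closed_carrier_def)
    show "fscale a f \<in> J" if "f \<in> J" for a f
      using that free.subspace_scale[OF U] ev_scale[of f a] I(2) by (auto simp: J_def U_def closed_carrier_def)
  qed
  interpret vector_space_pair "fscale :: 'k \<Rightarrow> ('a \<Rightarrow>\<^sub>0 'k) \<Rightarrow> _" "fscale :: 'k \<Rightarrow> ('a \<Rightarrow>\<^sub>0 'k) \<Rightarrow> _" ..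
  obtain P where P: "range P \<subseteq> J" "Vector_Spaces.linear fscale fscale P" "\<forall>f\<in>J. P f = f"
    using linear_exists_left_inverse_on[OF free.linear_ident J] by (auto simp: inj_on_def)
  have hom: "module_hom fscale fscale P" using P(2) by (simp add: Vector_Spaces.linear_def)
  have PU: "Poly_Mapping.keys (P f) \<subseteq> carrier A" "ev (P f) \<in> I" for f
    using P(1) by (auto simp: J_def U_def)
  define \<pi> where "\<pi> = (\<lambda>x. ev (P (Poly_Mapping.single x 1)))"
  let ?s = "\<lambda>x :: 'a. Poly_Mapping.single x (1 :: 'k)"
  have s: "?s x \<in> U" if "x \<in> carrier A" for x using that by (simp add: U_def)
  \<comment> \<open>Formal combinations with the same value differ by an element of \<open>J\<close>, which \<open>P\<close> fixes.\<close>
  have step: "ev (P f) = ev (P g)" if fg: "f \<in> U" "g \<in> U" "ev f = ev g" for f g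
  proof -
    have "ev (f - g) = ev f \<oplus> ev (fscale (-1) g)"
      using ev_add[of f "fscale (-1) g"] fg free.subspace_scale[OF U fg(2), of "-1"] by (simp add: U_def)
    also have "\<dots> = \<zero>"
      using fg ev_scale[of g "-1"] ev_closed[of g] by (simp add: U_def scale_minus_one r_neg)
    finally have k: "f - g \<in> J" "ev (f - g) = \<zero>"
      using fg free.subspace_diff[OF U] I(3) by (auto simp: J_def)
    have "P f = (f - g) + P g"
      using P(3) k(1) module_hom.diff[OF hom, of f g] by (metis diff_add_cancel)
    then have "ev (P f) = ev (f - g) \<oplus> ev (P g)"
      using ev_add[of "f - g" "P g"] PU k(1) by (simp add: J_def U_def)
    then show ?thesis using k(2) ev_closed[OF PU(1)] by simp
  qed
  have "linear_on A (subalg A I) \<pi>"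
    unfolding linear_on_def
  proof (intro conjI ballI allI)
    show "\<pi> x \<in> carrier (subalg A I)" for x using PU by (simp add: \<pi>_def)
    fix x assume x: "x \<in> carrier A"
    show "\<pi> (x \<oplus> y) = \<pi> x \<oplus>\<^bsub>subalg A I\<^esub> \<pi> y" if y: "y \<in> carrier A" for y
    proof -
      have "\<pi> (x \<oplus> y) = ev (P (?s x + ?s y))"
        unfolding \<pi>_def
        by (rule step) (use x y s free.subspace_add[OF U] in \<open>auto simp: ev_add ev_single\<close>)
      then show ?thesis using ev_add[OF PU(1) PU(1)] by (simp add: \<pi>_def module_hom.add[OF hom])
    qed
    show "\<pi> (a \<odot> x) = a \<odot>\<^bsub>subalg A I\<^esub> \<pi> x" for a
    proof -
      have "\<pi> (a \<odot> x) = ev (P (fscale a (?s x)))"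
        unfolding \<pi>_def
        by (rule step) (use x s free.subspace_scale[OF U] in \<open>auto simp: ev_scale ev_single scale_closed\<close>)
      then show ?thesis using ev_scale[OF PU(1)] by (simp add: \<pi>_def module_hom.scale[OF hom])
    qed
  qed
  moreover have "\<pi> x = x" if "x \<in> I" for x
  proof -
    have "?s x \<in> J" using that I(1) s by (auto simp: J_def ev_single)
    then show ?thesis using P(3) that I(1) by (auto simp: \<pi>_def ev_single)
  qed
  ultimately show ?thesis by blast
qed

lemma quotient_map_facts:
  assumes I: "two_sided_ideal I A"
  shows "closed_carrier (quot A I)" "linear_on A (quot A I) (\<lambda>a. I +> a)"
    "carrier (quot A I) = (\<lambda>a. I +> a) ` carrier A"
    "\<And>x y. \<lbrakk>x \<in> carrier A; y \<in> carrier A\<rbrakk> \<Longrightarrow> I +> x = I +> y \<longleftrightarrow> (\<exists>i\<in>I. x = i \<oplus> y)"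
proof -
  have sub: "submodule I (ground_field :: 'k ring) A" using I by (simp add: two_sided_ideal_def)
  have subgroup: "subgroup I (add_monoid A)" by (rule submodule.axioms(1)[OF sub])
  interpret abelian_subgroup I A
    by (rule abelian_subgroupI3, simp add: additive_subgroup_def subgroup, unfold_locales)
  have scale_I: "a \<odot> x \<in> I" if "x \<in> I" for a x
    using submodule.smult_closed[OF sub, of a x] that by (simp add: ground_field_def)
  have IA: "x \<in> carrier A" if "x \<in> I" for x using that a_subset by blast
  show carr: "carrier (quot A I) = (\<lambda>a. I +> a) ` carrier A"
    by (auto simp: quot_def FactRing_simps ring.defs module.defs)
  show eq: "I +> x = I +> y \<longleftrightarrow> (\<exists>i\<in>I. x = i \<oplus> y)" if "x \<in> carrier A" "y \<in> carrier A" for x y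
  proof
    assume "I +> x = I +> y"
    then have "x \<in> I +> y" using a_rcos_self[OF that(1)] by simp
    then show "\<exists>i\<in>I. x = i \<oplus> y" by (auto simp: a_r_coset_def')
  next
    assume "\<exists>i\<in>I. x = i \<oplus> y"
    then have "x \<in> I +> y" by (auto simp: a_r_coset_def')
    then show "I +> x = I +> y" using a_repr_independence[OF _ that(2) subgroup] by simp
  qed
  have add: "(I +> x) \<oplus>\<^bsub>quot A I\<^esub> (I +> y) = I +> (x \<oplus> y)" if "x \<in> carrier A" "y \<in> carrier A" for x y
    using a_rcos_sum[OF that] by (simp add: quot_def FactRing_def ring.defs module.defs)
  have scale: "a \<odot>\<^bsub>quot A I\<^esub> (I +> x) = I +> (a \<odot> x)" if x: "x \<in> carrier A" for a x
  proof -
    have "I +> (a \<odot> y) = I +> (a \<odot> x)" if y: "y \<in> I +> x" for y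
    proof -
      obtain i where i: "i \<in> I" "y = i \<oplus> x" using y by (auto simp: a_r_coset_def')
      have "a \<odot> y = a \<odot> i \<oplus> a \<odot> x" using i x IA by (simp add: scale_add)
      then show ?thesis using eq[of "a \<odot> y" "a \<odot> x"] scale_I[OF i(1)] i x IA scale_closed by auto
    qed
    then have "(\<Union>y\<in>I +> x. I +> (a \<odot> y)) = I +> (a \<odot> x)" using a_rcos_self[OF x] by blast
    then show ?thesis by (simp add: quot_def ring.defs module.defs)
  qed
  show "closed_carrier (quot A I)"
    unfolding closed_carrier_def carr using add scale scale_closed by auto
  show "linear_on A (quot A I) (\<lambda>a. I +> a)"
    unfolding linear_on_def carr using add scale by auto
qed

end

text \<open>The complement of \<open>I\<close> is the kernel of a projection \<open>\<pi>\<close>; \<open>\<nu> = 1 - \<pi>\<close> factors through \<open>A/I\<close>, which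
  gives the section \<open>s\<close>.\<close>

lemma ideal_extension_exists:
  fixes A :: "('k::field_char_0, 'a) module" (structure)
  assumes A: "assoc_algebra A" and I: "two_sided_ideal I A"
    and units: "\<And>S. \<lbrakk>finite S; S \<subseteq> I\<rbrakk> \<Longrightarrow> \<exists>e\<in>I. \<forall>x\<in>S. if h then e \<otimes> x = x else x \<otimes> e = x"
  shows "\<exists>\<pi> \<nu> s. ideal_extension_quotient A I \<pi> \<nu> h (\<lambda>a. I +> a) s"
proof -
  interpret assoc_algebra A by (rule A)
  have sub: "submodule I (ground_field :: 'k ring) A" using I by (simp add: two_sided_ideal_def)
  have subgroup: "subgroup I (add_monoid A)" by (rule submodule.axioms(1)[OF sub])
  have IA: "I \<subseteq> carrier A" and zero: "\<zero> \<in> I" and add_I: "\<And>x y. x \<in> I \<Longrightarrow> y \<in> I \<Longrightarrow> x \<oplus> y \<in> I"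
    and neg_I: "\<And>x. x \<in> I \<Longrightarrow> \<ominus> x \<in> I"
    using subgroup.subset[OF subgroup] subgroup.one_closed[OF subgroup] subgroup.m_closed[OF subgroup]
      subgroup.m_inv_closed[OF subgroup] by (simp_all add: a_inv_def)
  have scale_I: "a \<odot> x \<in> I" if "x \<in> I" for a x
    using submodule.smult_closed[OF sub, of a x] that by (simp add: ground_field_def)
  have closed_I: "closed_carrier (subalg A I)"
    using add_I scale_I by (simp add: closed_carrier_def)
  obtain \<pi> where \<pi>: "linear_on A (subalg A I) \<pi>" "\<forall>x\<in>I. \<pi> x = x"
    using linear_projection_exists[OF IA closed_I zero] by blast
  have \<pi>_I: "\<pi> x \<in> I" and \<pi>_carr: "\<pi> x \<in> carrier A" if "x \<in> carrier A" for x
    using \<pi>(1) that IA by (auto simp: linear_on_def)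
  have \<pi>_add: "\<pi> (x \<oplus> y) = \<pi> x \<oplus> \<pi> y" if "x \<in> carrier A" "y \<in> carrier A" for x y
    using \<pi>(1) that by (simp add: linear_on_def)
  have \<pi>_scale: "\<pi> (a \<odot> x) = a \<odot> \<pi> x" if "x \<in> carrier A" for a x
    using \<pi>(1) that by (simp add: linear_on_def)
  define \<nu> where "\<nu> = (\<lambda>x. x \<oplus> \<ominus> \<pi> x)"
  have \<nu>_carr: "\<nu> x \<in> carrier A" if "x \<in> carrier A" for x using that \<pi>_carr by (simp add: \<nu>_def)
  have \<nu>_add: "\<nu> (x \<oplus> y) = \<nu> x \<oplus> \<nu> y" if "x \<in> carrier A" "y \<in> carrier A" for x y
    using that \<pi>_carr by (simp add: \<nu>_def \<pi>_add minus_add a_ac)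
  have \<nu>_scale: "\<nu> (a \<odot> x) = a \<odot> \<nu> x" if "x \<in> carrier A" for a x
  proof -
    have "a \<odot> (\<ominus> \<pi> x) = \<ominus> (a \<odot> \<pi> x)"
      using that \<pi>_carr[OF that] scale_closed
      by (simp add: scale_minus_one[symmetric] scale_scale[symmetric])
    then show ?thesis using that \<pi>_carr by (simp add: \<nu>_def \<pi>_scale scale_add)
  qed
  have \<nu>_I: "\<nu> x = \<zero>" if "x \<in> I" for x using that \<pi>(2) IA by (auto simp: \<nu>_def r_neg)
  have \<pi>_\<nu>: "\<pi> (\<nu> x) = \<zero>" if "x \<in> carrier A" for x
    using that \<pi>_add[of x "\<ominus> \<pi> x"] \<pi>(2) neg_I[OF \<pi>_I[OF that]] \<pi>_carr[OF that] by (simp add: \<nu>_def r_neg)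
  have linear_\<nu>: "linear_on A A \<nu>" using \<nu>_carr \<nu>_add \<nu>_scale by (simp add: linear_on_def)
  note Q = quotient_map_facts[OF I]
  define s where "s = (\<lambda>q. \<nu> (SOME a. a \<in> carrier A \<and> q = I +> a))"
  have s: "s (I +> x) = \<nu> x" if x: "x \<in> carrier A" for x
  proof -
    define y where "y = (SOME a. a \<in> carrier A \<and> I +> x = I +> a)"
    have y: "y \<in> carrier A \<and> I +> x = I +> y"
      unfolding y_def by (rule someI[of _ x]) (use x in simp)
    then obtain i where i: "i \<in> I" "x = i \<oplus> y" using Q(4)[OF x] by blast
    then have "\<nu> x = \<nu> y" using y IA \<nu>_carr by (auto simp: \<nu>_add \<nu>_I)
    then show ?thesis by (simp add: s_def y_def)
  qed
  have linear_\<phi>: "linear_on A (quot A I) (\<lambda>a. I +> a)" by (rule Q(2))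
  have linear_s: "linear_on (quot A I) A s"
    unfolding linear_on_def Q(3)
  proof (intro conjI ballI allI; elim imageE; clarify)
    fix x assume x: "x \<in> carrier A"
    show "s (I +> x) \<in> carrier A" using s[OF x] \<nu>_carr[OF x] by simp
    show "s (a \<odot>\<^bsub>quot A I\<^esub> (I +> x)) = a \<odot> s (I +> x)" for a
    proof -
      have "a \<odot>\<^bsub>quot A I\<^esub> (I +> x) = I +> (a \<odot> x)" using linear_\<phi> x by (simp add: linear_on_def)
      then show ?thesis using s x scale_closed \<nu>_scale by simp
    qed
    fix y assume y: "y \<in> carrier A"
    have "(I +> x) \<oplus>\<^bsub>quot A I\<^esub> (I +> y) = I +> (x \<oplus> y)" using linear_\<phi> x y by (simp add: linear_on_def)
    then show "s ((I +> x) \<oplus>\<^bsub>quot A I\<^esub> (I +> y)) = s (I +> x) \<oplus> s (I +> y)" using s x y \<nu>_add by simp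
  qed
  have "ideal_extension A I \<pi> \<nu> h"
  proof (rule ideal_extension.intro)
    show "weak_algebra_char_0 A" using weak_algebra by (simp add: weak_algebra_char_0_def)
    show "ideal_extension_axioms A I \<pi> \<nu> h"
    proof
      show "\<nu> (\<nu> x) = \<nu> x" if "x \<in> carrier A" for x
        using \<pi>_\<nu>[OF that] \<nu>_carr[OF that] by (simp add: \<nu>_def)
      show "\<pi> x \<oplus> \<nu> x = x" if "x \<in> carrier A" for x
        using that \<pi>_carr[OF that] by (simp add: \<nu>_def a_lcomm r_neg)
      show "a \<otimes> x \<in> I" "x \<otimes> a \<in> I" if "a \<in> carrier A" "x \<in> I" for a x
        using I that by (auto simp: two_sided_ideal_def)
    qed (use IA closed_I zero zero_scale \<pi> linear_\<nu> \<nu>_I \<pi>_\<nu> units in auto)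
  qed
  moreover have "ideal_extension_quotient_axioms A I \<nu> (\<lambda>a. I +> a) s"
  proof
    show "I +> x = I +> \<zero>" if "x \<in> I" for x
    proof -
      have x: "x \<in> carrier A" using that IA by auto
      then have "\<exists>i\<in>I. x = i \<oplus> \<zero>" using that by (intro bexI[of _ x]) simp_all
      then show ?thesis using Q(4)[OF x zero_closed] by simp
    qed
  qed (use Q linear_s s in auto)
  ultimately have "ideal_extension_quotient A I \<pi> \<nu> h (\<lambda>a. I +> a) s"
    by (rule ideal_extension_quotient.intro)
  then show ?thesis by blast
qed

theorem theorem1:
  fixes A :: "('k::field_char_0, 'a) module" and I :: "'a set" and n :: nat
  assumes "assoc_algebra A"
    and "two_sided_ideal I A"
    and "(has_local_left_units (subalg A I) \<and> has_local_left_units A) \<or>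
         (has_local_right_units (subalg A I) \<and> has_local_right_units A)"
  shows "linear_iso (HC (subalg A I) n) (HC_rel A I n) (excision_map A I n)"
proof -
  define h where "h \<longleftrightarrow> has_local_left_units (subalg A I)"
  have "\<exists>e\<in>I. \<forall>x\<in>S. if h then e \<otimes>\<^bsub>A\<^esub> x = x else x \<otimes>\<^bsub>A\<^esub> e = x" if "finite S" "S \<subseteq> I" for S
  proof (cases h)
    case True
    then show ?thesis using that by (simp add: h_def has_local_left_units_def)
  next
    case False
    then have "has_local_right_units (subalg A I)" using assms(3) by (simp add: h_def)
    then show ?thesis using that False by (simp add: has_local_right_units_def)
  qed
  then obtain \<pi> \<nu> s where "ideal_extension_quotient A I \<pi> \<nu> h (\<lambda>a. I +>\<^bsub>A\<^esub> a) s"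
    using ideal_extension_exists[OF assms(1,2)] by blast
  then show ?thesis by (rule ideal_extension_quotient.excision)
qed

end
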